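(* Every golden tiling of $\mathbb{R}^3$ that satisfies the alternation condition is planar.
   Context: Let $\varphi=\frac{1+\sqrt5}{2}$ and let $\pm\vec v_1,\dots,\pm\vec v_6$ be the twelve vertices of the regular icosahedron, with $\vec v_1=(\varphi,1,0)$, $\vec v_2=(\varphi,-1,0)$, $\vec v_3=(0,\varphi,1)$, $\vec v_4=(0,\varphi,-1)$, $\vec v_5=(1,0,\varphi)$, $\vec v_6=(-1,0,\varphi)$. For distinct $i,j,k\in\{1,\dots,6\}$ the golden rhombohedron is $T_{ijk}=\{\lambda\vec v_i+\mu\vec v_j+\nu\vec v_k : 0\le\lambda,\mu,\nu\le1\}$; it depends only on the set $\{i,j,k\}$. Up to isometry there are two of them: the prolate ones $T_{123},T_{124},T_{136},T_{145},T_{156},T_{235},T_{246},T_{256},T_{345},T_{346}$ and the oblate ones $T_{125},T_{126},T_{134},T_{135},T_{146},T_{234},T_{236},T_{245},T_{356},T_{456}$. A golden tiling is a covering of $\mathbb{R}^3$ by translates of golden rhombohedra such that any two tiles intersect only in a whole common face, a whole common edge, a common vertex, or not at all (face-to-face condition). Lift: let $\vec e_1,\dots,\vec e_6$ be the canonical basis of $\mathbb{R}^6$. A golden tiling is lifted to $\mathbb{R}^6$ by sending an arbitrary vertex to the origin and sending each tile $\vec x+T_{ijk}$ to the $3$-dimensional face $h(\vec x)+\{\lambda\vec e_i+\mu\vec e_j+\nu\vec e_k : 0\le\lambda,\mu,\nu\le1\}$ of a unit cube of $\mathbb{Z}^6$. Here the vertex map $h$ is determined by requiring that adjacent tiles are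 mapped to adjacent $3$-faces: if two vertices of the tiling differ by an edge vector $\vec v_i$, then their images differ by $\vec e_i$. This gives a stepped $3$-dimensional surface in $\mathbb{R}^6$, unique up to translation. The tiling is planar if there exist $t\ge1$ and a $3$-dimensional linear subspace $E\subset\mathbb{R}^6$ such that the lifted tiling lies in $E+[0,t]^6$. Worms and alternation: for distinct $i,j$, an $ij$-worm of a golden tiling is a bi-infinite sequence of tiles of the tiling in which each tile is adjacent to the next one along a common face spanned by $\vec v_i$ and $\vec v_j$. Every tile of an $ij$-worm is a translate of some $T_{ijk}$ with $k\notin\{i,j\}$. Among the four such $k$, exactly two give prolate rhombohedra and two give oblate ones, so within a worm each type occurs in two orientations. The tiling has alternation if, in every worm, the subsequence of its prolate tiles alternates strictly between the two prolate rhombohedra $T_{ijk}$ occurring in that worm, and likewise the subsequence of its oblate tiles alternates strictly between the two oblate rhombohedra. *)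

theory Defs
  imports "HOL-Analysis.Analysis"
begin

definition golden_ratio :: real where
  "golden_ratio = (1 + sqrt 5) / 2"

text \<open>Indices 1, ..., 6 live in the numeral type \<^typ>\<open>6\<close>, where the literal 6 denotes
  the same element as 0; the last branch is thus the vector with index 6.\<close>

definition ico :: "6 \<Rightarrow> real ^ 3" where
  "ico i =
    (if i = 1 then vector [golden_ratio, 1, 0]
     else if i = 2 then vector [golden_ratio, -1, 0]
     else if i = 3 then vector [0, golden_ratio, 1]
     else if i = 4 then vector [0, golden_ratio, -1]
     else if i = 5 then vector [1, 0, golden_ratio]
     else vector [-1, 0, golden_ratio])"

definition rhombohedron :: "6 \<Rightarrow> 6 \<Rightarrow> 6 \<Rightarrow> (real ^ 3) set" where
  "rhombohedron i j k =
    {a *\<^sub>R ico i + b *\<^sub>R ico j + c *\<^sub>R ico k | a b c.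
      0 \<le> a \<and> a \<le> 1 \<and> 0 \<le> b \<and> b \<le> 1 \<and> 0 \<le> c \<and> c \<le> 1}"

definition rhombus :: "6 \<Rightarrow> 6 \<Rightarrow> (real ^ 3) set" where
  "rhombus i j =
    {a *\<^sub>R ico i + b *\<^sub>R ico j | a b. 0 \<le> a \<and> a \<le> 1 \<and> 0 \<le> b \<and> b \<le> 1}"

definition translate_of :: "'a::ab_group_add set \<Rightarrow> 'a set \<Rightarrow> bool" where
  "translate_of S R \<longleftrightarrow> (\<exists>x. S = (\<lambda>y. x + y) ` R)"

text \<open>With the vectors above, the rhombohedra of the first list are geometrically the flat ones
  and those of the second list the elongated ones, so that the two names are interchanged with
  respect to common usage. Only the partition into two classes matters: alternation is required
  of both.\<close>

definition prolate :: "6 set set" where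
  "prolate = {{1,2,3}, {1,2,4}, {1,3,6}, {1,4,5}, {1,5,6},
              {2,3,5}, {2,4,6}, {2,5,6}, {3,4,5}, {3,4,6}}"

definition oblate :: "6 set set" where
  "oblate = {{1,2,5}, {1,2,6}, {1,3,4}, {1,3,5}, {1,4,6},
             {2,3,4}, {2,3,6}, {2,4,5}, {3,5,6}, {4,5,6}}"

definition face_to_face :: "(real ^ 3) set \<Rightarrow> (real ^ 3) set \<Rightarrow> bool" where
  "face_to_face S S' \<longleftrightarrow>
     S \<inter> S' = {} \<or>
     (\<exists>p. S \<inter> S' = {p} \<and> p extreme_point_of S \<and> p extreme_point_of S') \<or>
     (S \<inter> S' edge_of S \<and> S \<inter> S' edge_of S') \<or>
     (S \<inter> S' facet_of S \<and> S \<inter> S' facet_of S')"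

definition golden_tiling :: "(real ^ 3) set set \<Rightarrow> bool" where
  "golden_tiling \<T> \<longleftrightarrow>
     (\<forall>S\<in>\<T>. \<exists>i j k. distinct [i, j, k] \<and> translate_of S (rhombohedron i j k)) \<and>
     \<Union>\<T> = UNIV \<and>
     (\<forall>S\<in>\<T>. \<forall>S'\<in>\<T>. S \<noteq> S' \<longrightarrow> face_to_face S S')"

definition tiling_vertices :: "(real ^ 3) set set \<Rightarrow> (real ^ 3) set" where
  "tiling_vertices \<T> = {p. \<exists>S\<in>\<T>. p extreme_point_of S}"

text \<open>A lifting map is a total function, but only its values at vertices of the tiling are
  constrained and used.\<close>

definition lifting_map :: "(real ^ 3) set set \<Rightarrow> (real ^ 3 \<Rightarrow> real ^ 6) \<Rightarrow> bool" where
  "lifting_map \<T> h \<longleftrightarrow>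
     (\<exists>p\<in>tiling_vertices \<T>. h p = 0) \<and>
     (\<forall>p\<in>tiling_vertices \<T>. \<forall>q\<in>tiling_vertices \<T>. \<forall>i.
        q - p = ico i \<longrightarrow> h q - h p = axis i 1)"

definition cube_face :: "6 \<Rightarrow> 6 \<Rightarrow> 6 \<Rightarrow> (real ^ 6) set" where
  "cube_face i j k =
    {a *\<^sub>R axis i 1 + b *\<^sub>R axis j 1 + c *\<^sub>R axis k 1 | a b c.
      0 \<le> a \<and> a \<le> 1 \<and> 0 \<le> b \<and> b \<le> 1 \<and> 0 \<le> c \<and> c \<le> 1}"

definition lifted_tiling ::
  "(real ^ 3) set set \<Rightarrow> (real ^ 3 \<Rightarrow> real ^ 6) \<Rightarrow> (real ^ 6) set" where
  "lifted_tiling \<T> h =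
    \<Union>{(\<lambda>y. h x + y) ` cube_face i j k | x i j k.
        distinct [i, j, k] \<and> (\<lambda>y. x + y) ` rhombohedron i j k \<in> \<T>}"

text \<open>The lift depends on the vertex sent to the origin. A lift has to exist, and the inclusion
  is required for every choice of that vertex.\<close>

definition planar_tiling :: "(real ^ 3) set set \<Rightarrow> bool" where
  "planar_tiling \<T> \<longleftrightarrow>
     (\<exists>h. lifting_map \<T> h) \<and>
     (\<forall>h. lifting_map \<T> h \<longrightarrow>
        (\<exists>t\<ge>1. \<exists>E :: (real ^ 6) set. subspace E \<and> dim E = 3 \<and>
           lifted_tiling \<T> h \<subseteq> {x + y | x y. x \<in> E \<and> y \<in> cbox 0 (\<chi> _. t)}))"

text \<open>Injectivity expresses that a worm never turns back: otherwise going back and forth between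
  two adjacent tiles would be a worm.\<close>

definition worm :: "(real ^ 3) set set \<Rightarrow> 6 \<Rightarrow> 6 \<Rightarrow> (int \<Rightarrow> (real ^ 3) set) \<Rightarrow> bool" where
  "worm \<T> i j w \<longleftrightarrow>
     i \<noteq> j \<and> range w \<subseteq> \<T> \<and> inj w \<and>
     (\<forall>n. translate_of (w n \<inter> w (n + 1)) (rhombus i j))"

text \<open>For fixed distinct \<open>i\<close>, \<open>j\<close> there are exactly two \<open>k\<close> with \<open>{i, j, k}\<close> in either class,
  so strict alternation of the tiles of class \<open>C\<close> means that no two consecutive
  ones have the same \<open>k\<close>.\<close>

definition alternates ::
  "6 set set \<Rightarrow> 6 \<Rightarrow> 6 \<Rightarrow> (int \<Rightarrow> (real ^ 3) set) \<Rightarrow> bool" where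
  "alternates C i j w \<longleftrightarrow>
     (\<forall>m n k l. m < n \<and>
        {i, j, k} \<in> C \<and> translate_of (w m) (rhombohedron i j k) \<and>
        {i, j, l} \<in> C \<and> translate_of (w n) (rhombohedron i j l) \<and>
        (\<forall>r. m < r \<and> r < n \<longrightarrow>
           \<not> (\<exists>p. {i, j, p} \<in> C \<and> translate_of (w r) (rhombohedron i j p)))
        \<longrightarrow> k \<noteq> l)"

definition has_alternation :: "(real ^ 3) set set \<Rightarrow> bool" where
  "has_alternation \<T> \<longleftrightarrow>
     (\<forall>i j w. worm \<T> i j w \<longrightarrow> alternates prolate i j w \<and> alternates oblate i j w)"

end

theory Submission
  imports Defs
begin

text \<open>A lift sends a vertex to its integer coordinates with respect to the six vectors, which are
  linearly independent over the rationals. Its projection to the internal space (where the golden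
  ratio is replaced by its conjugate) has to be bounded. By alternation an \<open>ij\<close>-worm stays close to a
  line parallel to \<open>v\<^sub>i \<times> v\<^sub>j\<close>, and its internal projection stays close to a line in the conjugate
  direction, although at an unknown speed. Near every tile containing \<open>v\<^sub>i\<close> at least four of the
  five kinds of \<open>ij\<close>-worms occur. In the plane orthogonal to \<open>v\<^sub>i\<close> their directions form triangles
  whose sides have ratio \<open>\<phi>\<close>, and conjugation inverts these ratios. Comparing both ways around a
  triangle bounds the internal displacement over distance \<open>\<phi> s\<close> by \<open>1/\<phi>\<close> times the one over
  distance \<open>s\<close> plus a constant, hence it is bounded along every worm. This forces each worm to show
  all four kinds of tiles in every long enough stretch, so all fifteen kinds of worms occur near
  every point, and any two points are joined by three worms in orthogonal directions.\<close>

text \<open>Two prolate tiles with different third edges advance a worm by \<open>g - 1\<close>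
  times its axis, two oblate ones by the axis itself. At \<psi> these factors are -\<phi> and 1, and
  nothing restricts the mixture of the two classes beforehand. So the internal displacement along a
  worm is known in direction but not in size, and could at first grow linearly; this is the obstacle
  that the triangles overcome. A triangle can be used only if worms in the directions of its other
  two sides start near its two ends. One direction may be missing at each end, and there are enough
  triangles over a given side to avoid both. The triangle closes up to a bounded gap, which is
  harmless because vertices at bounded distance are joined by chains of boundedly many tiles, so
  their internal images are at bounded distance too. Bounded internal projection gives planarity
  since the kernel of that projection is a 3-dimensional space E, and a large cube at the origin
  already covers every internal value that occurs.\<close>

section \<open>Incidence relations of the icosahedron\<close>

text \<open>At the golden ratio \<open>g\<close> these are the icosahedron vectors, at the other root of
  \<open>g\<^sup>2 = g + 1\<close> their Galois conjugates. Everything proved from \<open>g * g = g + 1\<close> alone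
  therefore holds in physical and in internal space at once.\<close>

definition icog :: "real \<Rightarrow> 6 \<Rightarrow> real ^ 3" where
  "icog g i =
    (if i = 1 then vector [g, 1, 0]
     else if i = 2 then vector [g, -1, 0]
     else if i = 3 then vector [0, g, 1]
     else if i = 4 then vector [0, g, -1]
     else if i = 5 then vector [1, 0, g]
     else vector [-1, 0, g])"

lemma exhaust_6:
  fixes x :: 6
  shows "x = 1 \<or> x = 2 \<or> x = 3 \<or> x = 4 \<or> x = 5 \<or> x = 6"
proof (induct x)
  case (of_int z)
  then have "z = 0 \<or> z = 1 \<or> z = 2 \<or> z = 3 \<or> z = 4 \<or> z = 5" by simp arith
  then show ?case by auto
qed

lemma forall_6: "(\<forall>i::6. P i) \<longleftrightarrow> P 1 \<and> P 2 \<and> P 3 \<and> P 4 \<and> P 5 \<and> P 6"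
  by (metis exhaust_6)

lemma ex_6: "(\<exists>i::6. P i) \<longleftrightarrow> P 1 \<or> P 2 \<or> P 3 \<or> P 4 \<or> P 5 \<or> P 6"
  by (metis exhaust_6)

lemma icog_simps [simp]:
  "icog g 1 = vector [g, 1, 0]" "icog g 2 = vector [g, -1, 0]"
  "icog g 3 = vector [0, g, 1]" "icog g 4 = vector [0, g, -1]"
  "icog g 5 = vector [1, 0, g]" "icog g 6 = vector [-1, 0, g]"
  by (simp_all add: icog_def)

text \<open>The pairs with \<open>v\<^sub>i \<bullet> v\<^sub>j < 0\<close>.\<close>

definition obtuse :: "6 \<Rightarrow> 6 \<Rightarrow> bool" where
  "obtuse i j \<longleftrightarrow> {i, j} \<in> {{1,6}, {2,3}, {2,4}, {2,6}, {4,5}, {4,6}}"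

text \<open>The sign replaces v_j by the one of v_j, -v_j that makes an acute angle with v_i. The
  five vectors so obtained are the neighbours of v_i on the icosahedron, and in terms of them the
  relations between axes look the same for all indices.\<close>

definition gsign :: "6 \<Rightarrow> 6 \<Rightarrow> real" where
  "gsign i j = (if obtuse i j then -1 else 1)"

definition nrm :: "real \<Rightarrow> 6 \<Rightarrow> 6 \<Rightarrow> real ^ 3" where
  "nrm g i j = cross3 (icog g i) (icog g j)"

text \<open>At \<open>g = 2\<close> the determinants have the same signs as at the golden ratio, and they are
  rational there.\<close>

definition orient :: "6 \<Rightarrow> 6 \<Rightarrow> 6 \<Rightarrow> real" where
  "orient i j k = sgn (nrm 2 i j \<bullet> icog 2 k)"

lemma obtuse_iff: "obtuse i j \<longleftrightarrow>
   i = 1 \<and> j = 6 \<or> i = 6 \<and> j = 1 \<or> i = 2 \<and> j = 3 \<or> i = 3 \<and> j = 2 \<or> i = 2 \<and> j = 4 \<or> i = 4 \<and> j = 2 \<or>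
   i = 2 \<and> j = 6 \<or> i = 6 \<and> j = 2 \<or> i = 4 \<and> j = 5 \<or> i = 5 \<and> j = 4 \<or> i = 4 \<and> j = 6 \<or> i = 6 \<and> j = 4"
  unfolding obtuse_def by (auto simp: doubleton_eq_iff)

lemma neq_6:
  "(1::6) \<noteq> 2" "(1::6) \<noteq> 3" "(1::6) \<noteq> 4" "(1::6) \<noteq> 5" "(1::6) \<noteq> 6"
  "(2::6) \<noteq> 3" "(2::6) \<noteq> 4" "(2::6) \<noteq> 5" "(2::6) \<noteq> 6"
  "(3::6) \<noteq> 4" "(3::6) \<noteq> 5" "(3::6) \<noteq> 6" "(4::6) \<noteq> 5" "(4::6) \<noteq> 6" "(5::6) \<noteq> 6"
  by simp_all

lemma obtuse_simps:
  "\<not> obtuse i i"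
  "\<not> obtuse 1 2" "\<not> obtuse 1 3" "\<not> obtuse 1 4" "\<not> obtuse 1 5" "obtuse 1 6"
  "\<not> obtuse 2 1" "obtuse 2 3" "obtuse 2 4" "\<not> obtuse 2 5" "obtuse 2 6"
  "\<not> obtuse 3 1" "obtuse 3 2" "\<not> obtuse 3 4" "\<not> obtuse 3 5" "\<not> obtuse 3 6"
  "\<not> obtuse 4 1" "obtuse 4 2" "\<not> obtuse 4 3" "obtuse 4 5" "obtuse 4 6"
  "\<not> obtuse 5 1" "\<not> obtuse 5 2" "\<not> obtuse 5 3" "obtuse 5 4" "\<not> obtuse 5 6"
  "obtuse 6 1" "obtuse 6 2" "\<not> obtuse 6 3" "obtuse 6 4" "\<not> obtuse 6 5"
  unfolding obtuse_iff by (simp_all add: neq_6 neq_6[symmetric])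

lemmas simps_6 = obtuse_simps neq_6 neq_6[symmetric]
    distinct.simps list.set insert_iff empty_iff simp_thms

lemma set3_eq_iff:
  assumes "distinct [i, j, k]" "distinct [a, b, c]"
  shows "{i, j, k} = {a, b, c} \<longleftrightarrow> i \<in> {a, b, c} \<and> j \<in> {a, b, c} \<and> k \<in> {a, b, c}"
  using assms by auto

text \<open>The right-hand side says that an odd number of the three pairs is obtuse. Reversing a
  vector changes two pairs, so this parity belongs to the rhombohedron. It turns later case
  distinctions into evaluations of \<open>obtuse\<close>.\<close>

lemma prolate_iff:
  assumes "distinct [i, j, k]"
  shows "{i, j, k} \<in> prolate \<longleftrightarrow> (obtuse i j \<noteq> (obtuse j k \<noteq> obtuse i k))"
proof -
  have "{i, j, k} \<in> prolate \<longleftrightarrow> (\<exists>X\<in>prolate. i \<in> X \<and> j \<in> X \<and> k \<in> X)"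
    using assms unfolding prolate_def by (auto simp: set3_eq_iff)
  also have "\<dots> \<longleftrightarrow> (obtuse i j \<noteq> (obtuse j k \<noteq> obtuse i k))"
    using exhaust_6[of i] exhaust_6[of j] exhaust_6[of k] assms unfolding prolate_def bex_simps
    by (elim disjE; simp only: simps_6)
  finally show ?thesis .
qed

lemma oblate_iff:
  assumes "distinct [i, j, k]"
  shows "{i, j, k} \<in> oblate \<longleftrightarrow> {i, j, k} \<notin> prolate"
proof -
  have "{i, j, k} \<in> oblate \<longleftrightarrow> (\<exists>X\<in>oblate. i \<in> X \<and> j \<in> X \<and> k \<in> X)"
    using assms unfolding oblate_def by (auto simp: set3_eq_iff)
  also have "\<dots> \<longleftrightarrow> \<not> (obtuse i j \<noteq> (obtuse j k \<noteq> obtuse i k))"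
    using exhaust_6[of i] exhaust_6[of j] exhaust_6[of k] assms unfolding oblate_def bex_simps
    by (elim disjE; simp only: simps_6)
  finally show ?thesis using prolate_iff[OF assms] by simp
qed

lemma prolate_pair:
  assumes "i \<noteq> j"
  shows "\<exists>k l. distinct [i, j, k, l] \<and> {i, j, k} \<in> prolate \<and> {i, j, l} \<in> prolate"
proof -
  have "\<exists>k l. distinct [i, j, k, l] \<and> (obtuse i j \<noteq> (obtuse j k \<noteq> obtuse i k))
      \<and> (obtuse i j \<noteq> (obtuse j l \<noteq> obtuse i l))"
    using exhaust_6[of i] exhaust_6[of j] assms unfolding ex_6
    by (elim disjE; simp only: simps_6)
  then obtain k l where "distinct [i, j, k, l]"
      "obtuse i j \<noteq> (obtuse j k \<noteq> obtuse i k)" "obtuse i j \<noteq> (obtuse j l \<noteq> obtuse i l)"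
    by blast
  then show ?thesis using prolate_iff[of i j k] prolate_iff[of i j l] by auto
qed

text \<open>In the pentagon around v_i the prolate triples are the diagonals and the oblate ones the
  sides; two vertices joined by a diagonal have a common neighbour.\<close>

lemma oblate_common:
  assumes "distinct [i, j, k]" "{i, j, k} \<in> prolate"
  shows "\<exists>l. distinct [i, j, k, l] \<and> {i, j, l} \<notin> prolate \<and> {i, k, l} \<notin> prolate"
proof -
  have "\<exists>l. distinct [i, j, k, l] \<and> \<not> (obtuse i j \<noteq> (obtuse j l \<noteq> obtuse i l))
      \<and> \<not> (obtuse i k \<noteq> (obtuse k l \<noteq> obtuse i l))"
    using exhaust_6[of i] exhaust_6[of j] exhaust_6[of k]
        assms(1) assms(2)[unfolded prolate_iff[OF assms(1)]]
    unfolding ex_6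
    by (elim disjE; simp only: simps_6)
  then obtain l where "distinct [i, j, k, l]"
      "\<not> (obtuse i j \<noteq> (obtuse j l \<noteq> obtuse i l))" "\<not> (obtuse i k \<noteq> (obtuse k l \<noteq> obtuse i l))"
    by blast
  then show ?thesis using prolate_iff[of i j l] prolate_iff[of i k l] by auto
qed

text \<open>Around \<open>v\<^sub>i\<close> the five directions \<open>\<plusminus>v\<^sub>j\<close> form a pentagon, where the
  two classes of triples are the two kinds of pairs, sides and diagonals.\<close>

lemma class_switch:
  assumes "distinct [i, j, k, l]" "{i, j, k} \<in> prolate \<longleftrightarrow> {i, j, l} \<in> prolate"
  shows "{i, k, l} \<in> prolate \<longleftrightarrow> {i, j, k} \<notin> prolate"
proof -
  have "(obtuse i j \<noteq> (obtuse j k \<noteq> obtuse i k)) = (obtuse i j \<noteq> (obtuse j l \<noteq> obtuse i l)) \<Longrightarrow>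
    (obtuse i k \<noteq> (obtuse k l \<noteq> obtuse i l)) = (\<not> (obtuse i j \<noteq> (obtuse j k \<noteq> obtuse i k)))"
    using exhaust_6[of i] exhaust_6[of j] exhaust_6[of k] exhaust_6[of l] assms(1)
    by (elim disjE; simp only: simps_6)
  then show ?thesis using assms prolate_iff[of i j k] prolate_iff[of i j l] prolate_iff[of i k l]
    by auto
qed

lemmas nrm_simps = nrm_def cross3_def vector_3 inner_vec_def sum_3 vec_eq_iff forall_3 inner_real_def

lemma orient_eq: "distinct [i, j, k] \<Longrightarrow> orient i j k \<in> {1, -1}"
  using exhaust_6[of i] exhaust_6[of j] exhaust_6[of k]
  by (elim disjE; (simp only: simps_6)?; simp add: orient_def nrm_simps)

lemma det_eq:
  assumes g: "g * g = g + 1" and ijk: "distinct [i, j, k]"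
  shows "nrm g i j \<bullet> icog g k = orient i j k * (if {i, j, k} \<in> prolate then 2 * g else 2 * (g + 1))"
proof -
  \<comment> \<open>Together with \<open>g\<close> this rule reduces every polynomial in
    \<open>g\<close> to degree one, so each case is settled for both roots.\<close>
  have g2: "g * (g * x) = g * x + x" for x using g by (metis mult.assoc distrib_right mult_1)
  have "nrm g i j \<bullet> icog g k =
      orient i j k * (if (obtuse i j \<noteq> (obtuse j k \<noteq> obtuse i k)) then 2 * g else 2 * (g + 1))"
    using exhaust_6[of i] exhaust_6[of j] exhaust_6[of k] ijk
    by (elim disjE; (simp only: simps_6)?; simp add: orient_def nrm_simps obtuse_simps algebra_simps g g2)
  then show ?thesis using prolate_iff[OF ijk] by simp
qed

text \<open>Two successive tiles of one class in an alternating \<open>ij\<close>-worm thus advance exactly along the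
  axis \<open>v\<^sub>i \<times> v\<^sub>j\<close> of the worm, in both spaces.\<close>

lemma pair_eq:
  assumes g: "g * g = g + 1" and ijkl: "distinct [i, j, k, l]"
    and cl: "{i, j, k} \<in> prolate \<longleftrightarrow> {i, j, l} \<in> prolate"
  shows "orient i j k *\<^sub>R icog g k + orient i j l *\<^sub>R icog g l =
    (if {i, j, k} \<in> prolate then g - 1 else 1) *\<^sub>R nrm g i j"
proof -
  have g2: "g * (g * x) = g * x + x" for x using g by (metis mult.assoc distrib_right mult_1)
  have ijk: "{i, j, k} \<in> prolate \<longleftrightarrow> (obtuse i j \<noteq> (obtuse j k \<noteq> obtuse i k))"
    and ijl: "{i, j, l} \<in> prolate \<longleftrightarrow> (obtuse i j \<noteq> (obtuse j l \<noteq> obtuse i l))"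
    using ijkl by (simp_all add: prolate_iff)
  show ?thesis
    using exhaust_6[of i] exhaust_6[of j] exhaust_6[of k] exhaust_6[of l] ijkl cl unfolding ijk ijl
    by (elim disjE; (simp only: simps_6)?; simp add: orient_def nrm_simps obtuse_simps algebra_simps g g2)
qed

text \<open>The vectors \<open>gsign i j *\<^sub>R nrm g i j\<close> form a regular pentagon at
  \<phi>, in which \<open>a\<close> and \<open>b\<close> are the vertices opposite to
  \<open>c\<close>. Opposite vertices add up to 2 cos 144 = -\<phi> times the vertex, and 1/\<phi> =
  \<phi> - 1.\<close>

lemma rel_prolate_prolate:
  assumes g: "g * g = g + 1" and d: "distinct [i, c, a, b]"
    and "{i, c, a} \<in> prolate" "{i, c, b} \<in> prolate"
  shows "gsign i c *\<^sub>R nrm g i c = - ((g - 1) *\<^sub>R (gsign i a *\<^sub>R nrm g i a + gsign i b *\<^sub>R nrm g i b))"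
proof -
  have g2: "g * (g * x) = g * x + x" for x using g by (metis mult.assoc distrib_right mult_1)
  have "obtuse i c \<noteq> (obtuse c a \<noteq> obtuse i a)" "obtuse i c \<noteq> (obtuse c b \<noteq> obtuse i b)"
    using assms prolate_iff[of i c a] prolate_iff[of i c b] by auto
  then show ?thesis
    using exhaust_6[of i] exhaust_6[of c] exhaust_6[of a] exhaust_6[of b] d
    by (elim disjE; (simp only: simps_6)?; simp add: nrm_simps gsign_def obtuse_simps algebra_simps g g2)
qed

text \<open>Here \<open>b\<close> lies between \<open>c\<close> and \<open>a\<close> on the
  pentagon, and the two neighbours of a vertex add up to 2 cos 72 = \<phi> - 1 times it.\<close>

lemma rel_prolate_oblate:
  assumes g: "g * g = g + 1" and d: "distinct [i, c, a, b]"
    and "{i, c, a} \<in> prolate" "{i, c, b} \<notin> prolate" "{i, a, b} \<notin> prolate"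
  shows "gsign i c *\<^sub>R nrm g i c = (g - 1) *\<^sub>R (gsign i b *\<^sub>R nrm g i b) - gsign i a *\<^sub>R nrm g i a"
proof -
  have g2: "g * (g * x) = g * x + x" for x using g by (metis mult.assoc distrib_right mult_1)
  have "obtuse i c \<noteq> (obtuse c a \<noteq> obtuse i a)" "\<not> (obtuse i c \<noteq> (obtuse c b \<noteq> obtuse i b))"
      "\<not> (obtuse i a \<noteq> (obtuse a b \<noteq> obtuse i b))"
    using assms prolate_iff[of i c a] prolate_iff[of i c b] prolate_iff[of i a b] by auto
  then show ?thesis
    using exhaust_6[of i] exhaust_6[of c] exhaust_6[of a] exhaust_6[of b] d
    by (elim disjE; (simp only: simps_6)?; simp add: nrm_simps gsign_def obtuse_simps algebra_simps g g2)
qed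

section \<open>The two roots and estimates valid at both of them\<close>

abbreviation \<phi> :: real where "\<phi> \<equiv> golden_ratio"
abbreviation \<psi> :: real where "\<psi> \<equiv> 1 - golden_ratio"

lemma golden_root: "\<phi> * \<phi> = \<phi> + 1" "\<psi> * \<psi> = \<psi> + 1"
  and golden_bounds: "8/5 < \<phi>" "\<phi> < 5/3"
proof -
  show 1: "\<phi> * \<phi> = \<phi> + 1" "\<psi> * \<psi> = \<psi> + 1"
    by (simp_all add: golden_ratio_def field_simps)
  have "11/5 < sqrt 5" by (rule real_less_rsqrt) (simp add: power2_eq_square)
  moreover have "sqrt 5 < 7/3" by (rule real_less_lsqrt) (simp_all add: power2_eq_square)
  ultimately show "8/5 < \<phi>" "\<phi> < 5/3" by (simp_all add: golden_ratio_def)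
qed

text \<open>The bound 5/3 admits \<phi> and \<psi> alike; the squared norm is
  \<open>g * g + 1\<close>, at most 25/9 + 1.\<close>

lemma norm_icog:
  assumes "\<bar>g\<bar> \<le> 5/3"
  shows "norm (icog g i) \<le> 2"
proof -
  have "g * g \<le> 3"
    using assms abs_le_square_iff[of g "5/3"] by (simp add: power2_eq_square)
  then have "(norm (icog g i))\<^sup>2 \<le> 2\<^sup>2"
    unfolding power2_norm_eq_inner using exhaust_6[of i]
        by (elim disjE) (simp_all add: inner_vec_def sum_3)
  then show ?thesis by (rule power2_le_imp_le) simp
qed

lemma norm_diff_mono: "norm a \<le> r \<Longrightarrow> norm b \<le> s \<Longrightarrow> norm (a - b) \<le> r + s"
  by (meson add_mono norm_triangle_ineq4 order_trans)

lemma nrm_orth [simp]: "nrm g i j \<bullet> icog g i = 0" "nrm g i j \<bullet> icog g j = 0"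
  and nrm_swap: "nrm g j i = - nrm g i j"
  by (auto simp: nrm_def dot_cross_self cross_skew[of "icog g j"] inner_commute)

lemma norm_nrm:
  assumes "\<bar>g\<bar> \<le> 5/3"
  shows "norm (nrm g i j) \<le> 4"
proof -
  have "(norm (nrm g i j))\<^sup>2 \<le> (norm (icog g i) * norm (icog g j))\<^sup>2"
    unfolding nrm_def using norm_cross_dot[of "icog g i" "icog g j"] by (smt (verit) zero_le_power2)
  then have "norm (nrm g i j) \<le> norm (icog g i) * norm (icog g j)"
    by (rule power2_le_imp_le) simp
  also have "\<dots> \<le> 2 * 2"
    by (intro mult_mono norm_icog assms) auto
  finally show ?thesis by simp
qed

text \<open>The edge \<open>\<plusminus>v\<^sub>k\<close> that points to the positive side of the plane of \<open>v\<^sub>i\<close>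
  and \<open>v\<^sub>j\<close>.\<close>

definition wv :: "real \<Rightarrow> 6 \<Rightarrow> 6 \<Rightarrow> 6 \<Rightarrow> real ^ 3" where
  "wv g i j k = orient i j k *\<^sub>R icog g k"

lemma orient_swap: "orient j i k = - orient i j k"
  by (simp add: orient_def nrm_swap[of _ j i] sgn_minus)

lemma wv_swap: "wv g j i k = - wv g i j k"
  by (simp add: wv_def orient_swap[of j i])

lemma norm_wv: "\<bar>g\<bar> \<le> 5/3 \<Longrightarrow> norm (wv g i j k) \<le> 2"
proof -
  assume g: "\<bar>g\<bar> \<le> 5/3"
  have "\<bar>orient i j k\<bar> \<le> 1" by (simp add: orient_def sgn_if)
  then have "norm (wv g i j k) \<le> 1 * norm (icog g k)"
    unfolding wv_def norm_scaleR by (intro mult_right_mono) auto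
  also have "\<dots> \<le> 2" using norm_icog[OF g] by simp
  finally show ?thesis .
qed

lemma ex_walk:
  assumes "\<And>k b. T k b \<Longrightarrow> \<exists>k'. T k' (b + w k)" "T k b"
  shows "\<exists>\<kappa> \<beta>. \<beta> 0 = b \<and> \<kappa> 0 = k \<and> (\<forall>n. T (\<kappa> n) (\<beta> n) \<and> \<beta> (Suc n) = \<beta> n + w (\<kappa> n))"
proof -
  \<comment> \<open>The clause for \<open>n = 0\<close> pins the start to \<open>(k, b)\<close>,
    because dependent choice by itself only provides some first state.\<close>
  have "\<exists>f. \<forall>n. (T (fst (f n)) (snd (f n)) \<and> (n = 0 \<longrightarrow> f n = (k, b))) \<and>
      snd (f (Suc n)) = snd (f n) + w (fst (f n))"
  proof (rule dependent_nat_choice)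
    show "\<exists>x. T (fst x) (snd x) \<and> (0 = 0 \<longrightarrow> x = (k, b))"
      using assms by auto
  next
    fix x and n :: nat
    assume "T (fst x) (snd x) \<and> (n = 0 \<longrightarrow> x = (k, b))"
    then obtain k' where "T k' (snd x + w (fst x))" using assms(1) by blast
    then show "\<exists>y. (T (fst y) (snd y) \<and> (Suc n = 0 \<longrightarrow> y = (k, b))) \<and> snd y = snd x + w (fst x)"
      by (intro exI[of _ "(k', snd x + w (fst x))"]) auto
  qed
  then obtain f where f: "\<And>n. T (fst (f n)) (snd (f n))" "f 0 = (k, b)"
      "\<And>n. snd (f (Suc n)) = snd (f n) + w (fst (f n))" by blast
  show ?thesis
    by (intro exI[of _ "\<lambda>n. fst (f n)"] exI[of _ "\<lambda>n. snd (f n)"]) (auto simp: f)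
qed

text \<open>Successive terms from \<open>P\<close> differ and therefore cancel, so at most one term
  survives.\<close>

lemma alternating_sum:
  fixes f :: "'a \<Rightarrow> 'v :: ab_group_add" and \<kappa> :: "nat \<Rightarrow> 'a"
  assumes alt: "\<And>m n. m < n \<Longrightarrow> P (\<kappa> m) \<Longrightarrow> P (\<kappa> n) \<Longrightarrow> (\<And>r. m < r \<Longrightarrow> r < n \<Longrightarrow> \<not> P (\<kappa> r)) \<Longrightarrow> \<kappa> m \<noteq> \<kappa> n"
    and opp: "\<And>m n. P (\<kappa> m) \<Longrightarrow> P (\<kappa> n) \<Longrightarrow> \<kappa> m \<noteq> \<kappa> n \<Longrightarrow> f (\<kappa> m) + f (\<kappa> n) = 0"
  shows "(\<Sum>m<N. if P (\<kappa> m) then f (\<kappa> m) else 0) = 0 \<or>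
    (\<exists>m. (\<Sum>m<N. if P (\<kappa> m) then f (\<kappa> m) else 0) = f (\<kappa> m))"
proof -
  let ?s = "\<lambda>N. \<Sum>m<N. if P (\<kappa> m) then f (\<kappa> m) else 0"
  \<comment> \<open>The induction has to remember the last index in \<open>P\<close>: the sum is 0
    or the value there, and the next term from \<open>P\<close> differs from precisely that
    one.\<close>
  have "(?s N = 0 \<and> (\<forall>m<N. \<not> P (\<kappa> m))) \<or>
    (\<exists>m<N. P (\<kappa> m) \<and> (\<forall>r. m < r \<and> r < N \<longrightarrow> \<not> P (\<kappa> r)) \<and> (?s N = 0 \<or> ?s N = f (\<kappa> m)))"
  proof (induction N)
    case (Suc N)
    show ?case
    proof (cases "P (\<kappa> N)")
      case False
      then have eq: "?s (Suc N) = ?s N" by simp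
      from Suc show ?thesis unfolding eq using False by (auto simp: less_Suc_eq)
    next
      case True
      then have eq: "?s (Suc N) = ?s N + f (\<kappa> N)" by simp
      have "?s (Suc N) = 0 \<or> ?s (Suc N) = f (\<kappa> N)"
        using Suc
      proof (elim disjE exE conjE)
        fix m assume m: "m < N" "P (\<kappa> m)" "\<forall>r. m < r \<and> r < N \<longrightarrow> \<not> P (\<kappa> r)" "?s N = f (\<kappa> m)"
        then have "\<kappa> m \<noteq> \<kappa> N" using alt[of m N] True by blast
        then show ?thesis using opp[of m N] m True eq by simp
      qed (use eq in auto)
      then show ?thesis using True by (intro disjI2 exI[of _ N]) auto
    qed
  qed simp
  then show ?thesis by blast
qed

text \<open>All fifteen axes have the same length, so coefficients along different axes can be
  compared. The value is (g^2 + 1)^2 - g^2, as the inner products of different vectors are g or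
  -g.\<close>

lemma nrm_self:
  assumes g: "g * g = g + 1" and "i \<noteq> j"
  shows "nrm g i j \<bullet> nrm g i j = 4 * (g + 1)"
proof -
  have g2: "g * (g * x) = g * x + x" for x using g by (metis mult.assoc distrib_right mult_1)
  show ?thesis
    using exhaust_6[of i] exhaust_6[of j] assms(2)
    by (elim disjE; (simp only: simps_6)?; simp add: nrm_simps algebra_simps g g2)
qed

lemma det_psi:
  assumes "distinct [i, j, k]"
  shows "2/3 < \<bar>nrm \<psi> i j \<bullet> icog \<psi> k\<bar>"
  using det_eq[OF golden_root(2) assms] orient_eq[OF assms] golden_bounds by (auto simp: abs_mult)

text \<open>Pairing with v_a kills the first summand, whose coefficient is arbitrary; the factor 3
  is the norm bound 2 divided by the 2/3 of \<open>det_psi\<close>.\<close>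

lemma coeff_bound:
  assumes "distinct [i, a, e]"
  shows "\<bar>y\<bar> \<le> 3 * norm (x *\<^sub>R nrm \<psi> i a + y *\<^sub>R nrm \<psi> i e)" (is "_ \<le> 3 * norm ?v")
proof -
  have d: "2/3 < \<bar>nrm \<psi> i e \<bullet> icog \<psi> a\<bar>" using assms by (intro det_psi) auto
  have "\<bar>y\<bar> * (2/3) \<le> \<bar>y\<bar> * \<bar>nrm \<psi> i e \<bullet> icog \<psi> a\<bar>"
    using d by (intro mult_left_mono) auto
  also have "\<dots> = \<bar>?v \<bullet> icog \<psi> a\<bar>" by (simp add: inner_add_left abs_mult)
  also have "\<dots> \<le> norm ?v * norm (icog \<psi> a)" by (rule Cauchy_Schwarz_ineq2)
  also have "\<dots> \<le> norm ?v * 2" using golden_bounds by (intro mult_left_mono norm_icog) auto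
  finally show ?thesis by simp
qed

text \<open>By \<open>pair_eq\<close> both \<open>l\<close> and \<open>m\<close> would complete
  \<open>k\<close> to the same multiple of the axis, so their vectors would be parallel.\<close>

lemma class_size:
  assumes d: "distinct [i, j, k, l, m]"
    and kl: "{i, j, k} \<in> prolate \<longleftrightarrow> {i, j, l} \<in> prolate"
    and km: "{i, j, k} \<in> prolate \<longleftrightarrow> {i, j, m} \<in> prolate"
  shows False
proof -
  have "orient i j l *\<^sub>R icog \<psi> l = orient i j m *\<^sub>R icog \<psi> m"
    using pair_eq[OF golden_root(2), of i j k l] pair_eq[OF golden_root(2), of i j k m] d kl km
    by (metis (no_types, lifting) add_left_cancel distinct_length_2_or_more)
  then have "orient i j l * (nrm \<psi> i m \<bullet> icog \<psi> l) = 0"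
    by (metis inner_scaleR_right mult_zero_right nrm_orth(2))
  moreover have "distinct [i, j, l]" "distinct [i, m, l]" using d by auto
  ultimately show False using orient_eq[of i j l] det_psi[of i m l] by auto
qed

lemma gsign_scale:
  "gsign i c *\<^sub>R u = v \<Longrightarrow> u = gsign i c *\<^sub>R (v :: real ^ 3)"
  by (auto simp: gsign_def)

text \<open>A triangle of worm axes in the plane orthogonal to \<open>v\<^sub>i\<close>. The side \<open>e\<close> is shorter than
  \<open>c\<close> by the factor \<open>1/\<phi>\<close> in physical space, but longer by \<open>\<phi>\<close> in internal space. There
  are enough such triangles to avoid one direction \<open>x\<close> at one end of \<open>c\<close> and one direction
  \<open>y\<close> at the other.\<close>

lemma contracting_relation:
  assumes "i \<noteq> c"
  shows "\<exists>a e (\<alpha> :: real \<Rightarrow> real) (\<beta> :: real \<Rightarrow> real). distinct [i, c, a, e] \<and> a \<noteq> x \<and> e \<noteq> y \<and>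
    (\<forall>g. g * g = g + 1 \<longrightarrow> nrm g i c = \<alpha> g *\<^sub>R nrm g i a + \<beta> g *\<^sub>R nrm g i e) \<and>
    (\<forall>g. \<bar>\<beta> g\<bar> = \<bar>g - 1\<bar>)"
proof -
  have gs: "\<bar>gsign p q\<bar> = 1" for p q by (simp add: gsign_def)
  have *: ?thesis if "distinct [i, c, a, e]" "a \<noteq> x" "e \<noteq> y" "{i, c, a} \<in> prolate" "{i, c,
      e} \<in> prolate" for a e
  proof -
    have "nrm g i c = - (gsign i c * (g - 1) * gsign i a) *\<^sub>R nrm g i a
        + - (gsign i c * (g - 1) * gsign i e) *\<^sub>R nrm g i e"
      if "g * g = g + 1" for g
      by (subst gsign_scale[OF rel_prolate_prolate[OF that \<open>distinct [i, c, a, e]\<close>]])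
        (use \<open>{i, c, a} \<in> prolate\<close> \<open>{i, c,
            e} \<in> prolate\<close> in \<open>simp_all add: scaleR_add_right scaleR_diff_right mult.assoc\<close>)
    moreover have "\<bar>- (gsign i c * (g - 1) * gsign i e)\<bar> = \<bar>g - 1\<bar>" for g by (simp add: abs_mult gs)
    ultimately show ?thesis using that(1,2,3)
      by (intro exI[of _ a] exI[of _ e] exI[of _ "\<lambda>g. - (gsign i c * (g - 1) * gsign i a)"]
          exI[of _ "\<lambda>g. - (gsign i c * (g - 1) * gsign i e)"]) blast
  qed
  have **: ?thesis if "distinct [i, c, a, e]" "a \<noteq> x" "e \<noteq> y" "{i, c, a} \<in> prolate" "{i, c,
      e} \<notin> prolate" "{i, a, e} \<notin> prolate" for a e
  proof -
    have "nrm g i c = - (gsign i c * gsign i a) *\<^sub>R nrm g i a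
        + (gsign i c * (g - 1) * gsign i e) *\<^sub>R nrm g i e"
      if "g * g = g + 1" for g
      by (subst gsign_scale[OF rel_prolate_oblate[OF that \<open>distinct [i, c, a, e]\<close>]])
        (use \<open>{i, c, a} \<in> prolate\<close> \<open>{i, c, e} \<notin> prolate\<close> \<open>{i, a, e} \<notin> prolate\<close> in
          \<open>simp_all add: scaleR_diff_right mult.assoc\<close>)
    moreover have "\<bar>gsign i c * (g - 1) * gsign i e\<bar> = \<bar>g - 1\<bar>" for g by (simp add: abs_mult gs)
    ultimately show ?thesis using that(1,2,3)
      by (intro exI[of _ a] exI[of _ e] exI[of _ "\<lambda>g. - (gsign i c * gsign i a)"]
          exI[of _ "\<lambda>g. gsign i c * (g - 1) * gsign i e"]) blast
  qed
  \<comment> \<open>Seen from \<open>c\<close> in the pentagon, \<open>a\<close> and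
    \<open>b\<close> are the opposite vertices, \<open>p\<close> and \<open>q\<close> vertices
    adjacent to \<open>c\<close> and to \<open>a\<close> or \<open>b\<close> respectively. One of
    the pairs (a,b), (b,a), (a,p), (b,q) avoids \<open>x\<close> in the first and \<open>y\<close>
    in the second place.\<close>
  obtain a b where ab: "distinct [i, c, a, b]" "{i, c, a} \<in> prolate" "{i, c, b} \<in> prolate"
    using prolate_pair[OF assms] by blast
  obtain p where p: "distinct [i, c, a, p]" "{i, c, p} \<notin> prolate" "{i, a, p} \<notin> prolate"
    using oblate_common[of i c a] ab by auto
  obtain q where q: "distinct [i, c, b, q]" "{i, c, q} \<notin> prolate" "{i, b, q} \<notin> prolate"
    using oblate_common[of i c b] ab by auto
  have "p \<noteq> b" "q \<noteq> a" using ab p q by auto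
  show ?thesis
  proof (cases "a = x")
    case False
    show ?thesis
    proof (cases "b = y")
      case True
      show ?thesis by (rule **[of a p]) (use True False p ab \<open>p \<noteq> b\<close> in auto)
    next
      case b: False
      show ?thesis by (rule *[of a b]) (use b False ab in auto)
    qed
  next
    case True
    then have "b \<noteq> x" using ab by auto
    show ?thesis
    proof (cases "a = y")
      case True
      show ?thesis by (rule **[of b q]) (use True \<open>b \<noteq> x\<close> q ab \<open>q \<noteq> a\<close> in auto)
    next
      case False
      show ?thesis by (rule *[of b a]) (use False \<open>b \<noteq> x\<close> ab in auto)
    qed
  qed
qed

lemma wv_nrm:
  assumes "g * g = g + 1" "distinct [i, j, k]"
  shows "wv g i j k \<bullet> nrm g i j = (if {i, j, k} \<in> prolate then 2 * g else 2 * (g + 1))"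
  using det_eq[OF assms] orient_eq[OF assms(2)] by (auto simp: wv_def inner_commute)

text \<open>Meant for a worm that misses one kind of tile: it has at most one tile of that class,
  and all others advance it in the same internal direction.\<close>

lemma sum_one_exception:
  fixes f :: "nat \<Rightarrow> real"
  assumes "\<And>n. n < N \<Longrightarrow> \<not> E n \<Longrightarrow> p \<le> f n" "\<And>n. n < N \<Longrightarrow> E n \<Longrightarrow> p - q \<le> f n" "0 \<le> q"
    and one: "\<And>m n. m < n \<Longrightarrow> n < N \<Longrightarrow> E m \<Longrightarrow> E n \<Longrightarrow> False"
  shows "N * p - q \<le> sum f {..<N}"
proof -
  have "card {n\<in>{..<N}. E n} \<le> 1"
    by (rule card_le_Suc0_iff_eq[THEN iffD2, folded One_nat_def]) (use one in \<open>auto,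
        metis linorder_neqE_nat\<close>)
  then have "real (card {n\<in>{..<N}. E n}) * q \<le> 1 * q" using assms(3) by (intro mult_right_mono) auto
  then have "N * p - q \<le> (\<Sum>n<N. p) - (\<Sum>n\<in>{n\<in>{..<N}. E n}. q)" by simp
  also have "\<dots> = (\<Sum>n<N. p - (if E n then q else 0))"
    unfolding sum_subtractf by (simp only: sum.inter_filter[OF finite_lessThan])
  also have "\<dots> \<le> sum f {..<N}" using assms(1,2) by (intro sum_mono) auto
  finally show ?thesis .
qed

section \<open>Displacement along worms in internal space\<close>

text \<open>\<open>T i j k b\<close> stands for a tile whose lower \<open>ij\<close>-face has the corner \<open>b\<close> and whose third edge
  is \<open>wv \<phi> i j k\<close>; \<open>F\<close> is the internal coordinate of the lifted vertices.\<close>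

locale coarse_tiling =
  fixes T :: "6 \<Rightarrow> 6 \<Rightarrow> 6 \<Rightarrow> real ^ 3 \<Rightarrow> bool" and F :: "real ^ 3 \<Rightarrow> real ^ 3"
  assumes T_distinct: "T i j k b \<Longrightarrow> distinct [i, j, k]"
    and up: "T i j k b \<Longrightarrow> \<exists>k'. T i j k' (b + wv \<phi> i j k)"
    and flip: "T i j k b \<Longrightarrow> T j i k (b + wv \<phi> i j k)"
    and turn: "T i j k b \<Longrightarrow> \<exists>b'. norm (b' - b) \<le> 8 \<and> T i k j b'"
    and step: "T i j k b \<Longrightarrow> F (b + wv \<phi> i j k) = F b + wv \<psi> i j k"
    and lip: "\<exists>C. \<forall>i j k b i' j' k' b'. T i j k b \<longrightarrow> T i' j' k' b' \<longrightarrow> norm (b' - b) \<le> r \<longrightarrow>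
        norm (F b' - F b) \<le> C"
    and alt: "\<And>i j \<kappa> \<beta> m n. (\<And>n. T i j (\<kappa> n) (\<beta> n)) \<Longrightarrow> (\<And>n. \<beta> (Suc n) = \<beta> n + wv \<phi> i j (\<kappa> n)) \<Longrightarrow>
        m < (n::nat) \<Longrightarrow>
      {i, j, \<kappa> m} \<in> prolate \<longleftrightarrow> {i, j, \<kappa> n} \<in> prolate \<Longrightarrow>
      (\<And>r. m < r \<Longrightarrow> r < n \<Longrightarrow> ({i, j, \<kappa> r} \<in> prolate) \<noteq> ({i, j, \<kappa> m} \<in> prolate)) \<Longrightarrow> \<kappa> m \<noteq> \<kappa> n"
begin

definition St :: "6 \<Rightarrow> 6 \<Rightarrow> real ^ 3 \<Rightarrow> bool" where
  "St i j b \<longleftrightarrow> (\<exists>k. T i j k b)"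

definition near :: "6 \<Rightarrow> 6 \<Rightarrow> real ^ 3 \<Rightarrow> real \<Rightarrow> bool" where
  "near i j p r \<longleftrightarrow> (\<exists>b. St i j b \<and> norm (b - p) \<le> r)"

definition wseq :: "6 \<Rightarrow> 6 \<Rightarrow> (nat \<Rightarrow> 6) \<Rightarrow> (nat \<Rightarrow> real ^ 3) \<Rightarrow> bool" where
  "wseq i j \<kappa> \<beta> \<longleftrightarrow> (\<forall>n. T i j (\<kappa> n) (\<beta> n) \<and> \<beta> (Suc n) = \<beta> n + wv \<phi> i j (\<kappa> n))"

lemma ex_wseq:
  assumes "T i j k b"
  shows "\<exists>\<kappa> \<beta>. wseq i j \<kappa> \<beta> \<and> \<beta> 0 = b"
  using ex_walk[of "T i j" "wv \<phi> i j"] up assms unfolding wseq_def by blast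

lemma wseq_alt:
  assumes "wseq i j \<kappa> \<beta>" "m < n" "{i, j, \<kappa> m} \<in> prolate \<longleftrightarrow> {i, j, \<kappa> n} \<in> prolate"
    and "\<And>r. m < r \<Longrightarrow> r < n \<Longrightarrow> ({i, j, \<kappa> r} \<in> prolate) \<noteq> ({i, j, \<kappa> m} \<in> prolate)"
  shows "\<kappa> m \<noteq> \<kappa> n"
  using alt[of i j \<kappa> \<beta> m n] assms unfolding wseq_def by blast

lemma wseq_distinct: "wseq i j \<kappa> \<beta> \<Longrightarrow> distinct [i, j, \<kappa> n]"
  using T_distinct unfolding wseq_def by blast

text \<open>Half the coefficient in \<open>pair_eq\<close>: a tile is credited with the average
  advance of a pair of its class.\<close>

definition height :: "real \<Rightarrow> 6 \<Rightarrow> 6 \<Rightarrow> 6 \<Rightarrow> real" where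
  "height g i j k = (if {i, j, k} \<in> prolate then g - 1 else 1) / 2"

text \<open>By \<open>pair_eq\<close> the deviations from the average advance are opposite for the
  two members of a class. Alternation leaves at most one deviation per class, each of norm at most
  8. The same sequence of tiles is thus controlled in both spaces.\<close>

lemma wseq_sum:
  assumes w: "wseq i j \<kappa> \<beta>" and g: "g * g = g + 1" "\<bar>g\<bar> \<le> 5/3"
  shows "norm ((\<Sum>m<N. wv g i j (\<kappa> m)) - (\<Sum>m<N. height g i j (\<kappa> m)) *\<^sub>R nrm g i j) \<le> 16"
proof -
  define f where "f k = wv g i j k - height g i j k *\<^sub>R nrm g i j" for k
  have fb: "norm (f k) \<le> 8" for k
  proof -
    have h: "\<bar>height g i j k\<bar> \<le> 3/2" using g(2) by (auto simp: height_def)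
    have "norm (f k) \<le> norm (wv g i j k) + norm (height g i j k *\<^sub>R nrm g i j)"
      unfolding f_def by (rule norm_triangle_ineq4)
    also have "\<dots> \<le> 2 + (3/2) * 4"
      unfolding norm_scaleR by (intro add_mono mult_mono norm_wv norm_nrm g h) auto
    finally show ?thesis by simp
  qed
  have opp: "f (\<kappa> m) + f (\<kappa> n) = 0"
    if "\<kappa> m \<noteq> \<kappa> n" "{i, j, \<kappa> m} \<in> prolate \<longleftrightarrow> {i, j, \<kappa> n} \<in> prolate" for m n
  proof -
    have "distinct [i, j, \<kappa> m, \<kappa> n]"
      using wseq_distinct[OF w, of m] wseq_distinct[OF w, of n] that(1) by auto
    from pair_eq[OF g(1) this that(2)] show ?thesis
      unfolding f_def wv_def height_def using that(2)
      by (simp add: algebra_simps flip: scaleR_add_left)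
  qed
  define s where "s P = (\<Sum>m<N. if P (\<kappa> m) then f (\<kappa> m) else 0)" for P
  have "norm (s (\<lambda>k. {i, j, k} \<in> prolate)) \<le> 8"
    using alternating_sum[of "\<lambda>k. {i, j, k} \<in> prolate" \<kappa> f N] wseq_alt[OF w] opp fb
    unfolding s_def by (smt (verit) norm_zero)
  moreover have "norm (s (\<lambda>k. {i, j, k} \<notin> prolate)) \<le> 8"
    using alternating_sum[of "\<lambda>k. {i, j, k} \<notin> prolate" \<kappa> f N] wseq_alt[OF w] opp fb
    unfolding s_def by (smt (verit) norm_zero)
  moreover have "(\<Sum>m<N. wv g i j (\<kappa> m)) - (\<Sum>m<N. height g i j (\<kappa> m)) *\<^sub>R nrm g i j = (\<Sum>m<N. f (\<kappa> m))"
    by (simp add: f_def sum_subtractf scaleR_sum_left)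
  moreover have "\<dots> = s (\<lambda>k. {i, j, k} \<in> prolate) + s (\<lambda>k. {i, j, k} \<notin> prolate)"
    unfolding s_def sum.distrib[symmetric] by (rule sum.cong) auto
  ultimately show ?thesis using norm_triangle_mono by force
qed

lemma wseq_sums:
  assumes "wseq i j \<kappa> \<beta>"
  shows "\<beta> N = \<beta> 0 + (\<Sum>m<N. wv \<phi> i j (\<kappa> m))" "F (\<beta> N) = F (\<beta> 0) + (\<Sum>m<N. wv \<psi> i j (\<kappa> m))"
proof -
  show "\<beta> N = \<beta> 0 + (\<Sum>m<N. wv \<phi> i j (\<kappa> m))"
    using assms by (induction N) (auto simp: wseq_def)
  have *: "F (\<beta> (Suc n)) = F (\<beta> n) + wv \<psi> i j (\<kappa> n)" for n
    using assms step[of i j "\<kappa> n" "\<beta> n"] by (simp add: wseq_def)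
  show "F (\<beta> N) = F (\<beta> 0) + (\<Sum>m<N. wv \<psi> i j (\<kappa> m))"
    by (induction N) (simp_all add: *)
qed

lemma wseq_shift:
  assumes "wseq i j \<kappa> \<beta>"
  shows "norm (\<beta> n - \<beta> 0) \<le> 2 * n"
proof (induction n)
  case (Suc n)
  have "\<beta> (Suc n) - \<beta> 0 = (\<beta> n - \<beta> 0) + wv \<phi> i j (\<kappa> n)" using assms by (simp add: wseq_def)
  then have "norm (\<beta> (Suc n) - \<beta> 0) \<le> real (2 * n) + 2"
    using norm_triangle_mono[OF Suc norm_wv[of \<phi> i j "\<kappa> n"]] golden_bounds by (simp only:)
  then show ?case by simp
qed simp

text \<open>Stop when the physical height first exceeds \<open>s\<close>: every tile adds between
  1/4 and 1, so this happens, with an overshoot of at most one axis vector. The bound 20 is 16 + 4.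
  The internal height \<open>t\<close> of the same stretch remains uncontrolled.\<close>

lemma worm_forward:
  assumes "St i j b" "0 \<le> s"
  shows "\<exists>b1 t. St i j b1 \<and> norm (b1 - b - s *\<^sub>R nrm \<phi> i j) \<le> 20
      \<and> norm (F b1 - F b - t *\<^sub>R nrm \<psi> i j) \<le> 16"
proof -
  obtain \<kappa> \<beta> where w: "wseq i j \<kappa> \<beta>" and b: "\<beta> 0 = b" using assms(1) ex_wseq unfolding St_def by meson
  define \<tau> where "\<tau> N = (\<Sum>m<N. height \<phi> i j (\<kappa> m))" for N
  have hb: "1/4 \<le> height \<phi> i j k" "height \<phi> i j k \<le> 1" for k
    using golden_bounds by (auto simp: height_def)
  have grow: "real N / 4 \<le> \<tau> N" for N
  proof (induction N)
    case (Suc N)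
    then show ?case using hb(1)[of "\<kappa> N"] by (simp add: \<tau>_def)
  qed (simp add: \<tau>_def)
  obtain M :: nat where "4 * s < M" using reals_Archimedean2 by blast
  then have "\<exists>N. s < \<tau> N" using grow[of M] by (intro exI[of _ M]) auto
  then obtain N where N: "s < \<tau> N" "\<And>m. m < N \<Longrightarrow> \<not> s < \<tau> m"
    using exists_least_iff[of "\<lambda>N. s < \<tau> N"] by blast
  have "N \<noteq> 0" using N(1) assms(2) by (auto simp: \<tau>_def intro: ccontr)
  then obtain n where n: "N = Suc n" using not0_implies_Suc by blast
  have "\<tau> N \<le> \<tau> n + 1" using hb by (simp add: n \<tau>_def)
  then have s: "\<bar>\<tau> N - s\<bar> \<le> 1" using N(1) N(2)[of n] n by simp
  have "\<beta> N - b - s *\<^sub>R nrm \<phi> i j =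
      ((\<Sum>m<N. wv \<phi> i j (\<kappa> m)) - \<tau> N *\<^sub>R nrm \<phi> i j) + (\<tau> N - s) *\<^sub>R nrm \<phi> i j"
    using wseq_sums(1)[OF w, of N] b by (simp add: algebra_simps)
  moreover have "norm ((\<tau> N - s) *\<^sub>R nrm \<phi> i j) \<le> 1 * 4"
    unfolding norm_scaleR using s golden_bounds by (intro mult_mono norm_nrm) auto
  moreover have "norm ((\<Sum>m<N. wv \<phi> i j (\<kappa> m)) - \<tau> N *\<^sub>R nrm \<phi> i j) \<le> 16"
    unfolding \<tau>_def using golden_bounds by (intro wseq_sum[OF w] golden_root) auto
  ultimately have "norm (\<beta> N - b - s *\<^sub>R nrm \<phi> i j) \<le> 16 + 4"
    using norm_triangle_mono by (metis mult_1)
  moreover have "norm (F (\<beta> N) - F b - (\<Sum>m<N. height \<psi> i j (\<kappa> m)) *\<^sub>R nrm \<psi> i j) \<le> 16"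
    using wseq_sum[OF w golden_root(2), of N] golden_bounds wseq_sums(2)[OF w, of N] b by simp
  moreover have "St i j (\<beta> N)" using w by (auto simp: wseq_def St_def)
  ultimately show ?thesis by auto
qed

lemma St_flip:
  assumes "St i j b"
  shows "\<exists>b'. St j i b' \<and> norm (b' - b) \<le> 2 \<and> norm (F b' - F b) \<le> 2"
proof -
  obtain k where k: "T i j k b" using assms by (auto simp: St_def)
  show ?thesis
    using flip[OF k] step[OF k] norm_wv[of \<phi> i j k] norm_wv[of \<psi> i j k] golden_bounds
    by (intro exI[of _ "b + wv \<phi> i j k"]) (auto simp: St_def)
qed

text \<open>For negative \<open>s\<close> the worm is read as a \<open>ji\<close>-worm, whose axis
  is reversed. Flipping at both ends costs 2 each, hence 24 = 2 + 20 + 2.\<close>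

lemma worm_shift:
  assumes "St i j b"
  shows "\<exists>b1 t. St i j b1 \<and> norm (b1 - b - s *\<^sub>R nrm \<phi> i j) \<le> 24
      \<and> norm (F b1 - F b - t *\<^sub>R nrm \<psi> i j) \<le> 24"
proof (cases "s \<ge> 0")
  case True
  obtain c t where "St i j c" "norm (c - b - s *\<^sub>R nrm \<phi> i j) \<le> 20"
      "norm (F c - F b - t *\<^sub>R nrm \<psi> i j) \<le> 16"
    using worm_forward[OF assms True] by blast
  then show ?thesis by (intro exI[of _ c] exI[of _ t]) auto
next
  case False
  obtain c where c: "St j i c" "norm (c - b) \<le> 2" "norm (F c - F b) \<le> 2"
    using St_flip[OF assms] by blast
  obtain d t where d: "St j i d" "norm (d - c - (- s) *\<^sub>R nrm \<phi> j i) \<le> 20"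
      "norm (F d - F c - t *\<^sub>R nrm \<psi> j i) \<le> 16"
    using worm_forward[OF c(1), of "- s"] False by auto
  obtain e where e: "St i j e" "norm (e - d) \<le> 2" "norm (F e - F d) \<le> 2"
    using St_flip[OF d(1)] by blast
  have *: "e - b - s *\<^sub>R nrm \<phi> i j = (e - d) + (c - b) + (d - c - (- s) *\<^sub>R nrm \<phi> j i)"
    by (simp add: nrm_swap[of _ j i])
  have "norm (e - b - s *\<^sub>R nrm \<phi> i j) \<le> 2 + 2 + 20"
    unfolding * by (rule norm_triangle_mono[OF norm_triangle_mono[OF e(2) c(2)] d(2)])
  moreover have **: "F e - F b - (- t) *\<^sub>R nrm \<psi> i j = (F e - F d) + (F c - F b)
      + (F d - F c - t *\<^sub>R nrm \<psi> j i)"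
    by (simp add: nrm_swap[of _ j i])
  have "norm (F e - F b - (- t) *\<^sub>R nrm \<psi> i j) \<le> 2 + 2 + 16"
    unfolding ** by (rule norm_triangle_mono[OF norm_triangle_mono[OF e(3) c(3)] d(3)])
  ultimately show ?thesis using e(1) by (intro exI[of _ e] exI[of _ "-t"]) auto
qed

lemma near_trans:
  assumes "near i j p r" "\<And>b. St i j b \<Longrightarrow> near k l b r'"
  shows "near k l p (r + r')"
proof -
  obtain b where b: "St i j b" "norm (b - p) \<le> r" using assms(1) by (auto simp: near_def)
  obtain c where c: "St k l c" "norm (c - b) \<le> r'" using assms(2)[OF b(1)] by (auto simp: near_def)
  have "c - p = (b - p) + (c - b)" by simp
  then have "norm (c - p) \<le> r + r'" using norm_triangle_mono[OF b(2) c(2)] by simp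
  with c show ?thesis by (auto simp: near_def)
qed

lemma near_mono: "near i j p r \<Longrightarrow> r \<le> r' \<Longrightarrow> near i j p r'"
  by (force simp: near_def)

lemma near_self: "St i j b \<Longrightarrow> 0 \<le> r \<Longrightarrow> near i j b r"
  unfolding near_def by (intro exI[of _ b]) simp

lemma near_turn: "T i j k b \<Longrightarrow> near i k b 8"
  using turn by (force simp: near_def St_def)

lemma near_flip: "St i j b \<Longrightarrow> near j i b 2"
  using St_flip by (force simp: near_def)

text \<open>A tile with edges \<open>i\<close>, \<open>j\<close>, \<open>k\<close> also belongs to
  an \<open>ik\<close>-worm, so the tiles met by one worm reveal which other worms pass
  nearby.\<close>

lemma wseq_near:
  assumes "wseq i j \<kappa> \<beta>"
  shows "near i (\<kappa> n) (\<beta> 0) (2 * n + 8)"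
proof -
  obtain c where c: "norm (c - \<beta> n) \<le> 8" "St i (\<kappa> n) c"
    using assms near_turn[of i j "\<kappa> n" "\<beta> n"] unfolding wseq_def near_def by blast
  have "c - \<beta> 0 = (\<beta> n - \<beta> 0) + (c - \<beta> n)" by simp
  then have "norm (c - \<beta> 0) \<le> 2 * n + 8"
    using norm_triangle_mono[OF wseq_shift[OF assms, of n] c(1)] by simp
  with c show ?thesis by (auto simp: near_def)
qed

text \<open>Two of any three successive tiles share their class. If they are chosen with no tile of
  that class in between, alternation makes their third edges different. The radius is 2 * 2 +
  8.\<close>

lemma near_pair:
  assumes "St i j b"
  shows "\<exists>k l. distinct [i, j, k, l] \<and> ({i, j, k} \<in> prolate \<longleftrightarrow> {i, j, l} \<in> prolate) \<and>
    near i k b 12 \<and> near i l b 12"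
proof -
  obtain k where "T i j k b" using assms by (auto simp: St_def)
  from ex_wseq[OF this] obtain \<kappa> \<beta> where w: "wseq i j \<kappa> \<beta>" and b: "\<beta> 0 = b" by blast
  have *: ?thesis if "m < n" "n \<le> 2" "{i, j, \<kappa> m} \<in> prolate \<longleftrightarrow> {i, j, \<kappa> n} \<in> prolate"
    "\<And>r. m < r \<Longrightarrow> r < n \<Longrightarrow> ({i, j, \<kappa> r} \<in> prolate) \<noteq> ({i, j, \<kappa> m} \<in> prolate)" for m n
  proof -
    have "\<kappa> m \<noteq> \<kappa> n" by (rule wseq_alt[OF w that(1,3,4)])
    then have "distinct [i, j, \<kappa> m, \<kappa> n]"
      using wseq_distinct[OF w, of m] wseq_distinct[OF w, of n] by auto
    moreover have "near i (\<kappa> m) b 12" "near i (\<kappa> n) b 12"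
      using near_mono[OF wseq_near[OF w, of m], of 12] near_mono[OF wseq_near[OF w, of n], of 12]
          that(1,2) b by auto
    ultimately show ?thesis using that(3) by blast
  qed
  consider "{i, j, \<kappa> 0} \<in> prolate \<longleftrightarrow> {i, j, \<kappa> 1} \<in> prolate"
    | "{i, j, \<kappa> 1} \<in> prolate \<longleftrightarrow> {i, j, \<kappa> 2} \<in> prolate"
    | "{i, j, \<kappa> 0} \<in> prolate \<longleftrightarrow> {i, j, \<kappa> 2} \<in> prolate" "({i, j, \<kappa> 1} \<in> prolate) \<noteq> ({i, j, \<kappa> 0} \<in> prolate)"
    by blast
  then show ?thesis
  proof cases
    case 1 show ?thesis by (rule *[of 0 1]) (use 1 in auto)
  next
    case 2 show ?thesis by (rule *[of 1 2]) (use 2 in auto)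
  next
    case 3
    have "({i, j, \<kappa> r} \<in> prolate) \<noteq> ({i, j, \<kappa> 0} \<in> prolate)" if "0 < r" "r < 2" for r
    proof -
      have "r = 1" using that by simp
      then show ?thesis using 3(2) by simp
    qed
    then show ?thesis by (intro *[of 0 2]) (use 3 in auto)
  qed
qed

text \<open>A pair \<open>k\<close>, \<open>l\<close> found from \<open>j\<close>, and then a pair
  found from \<open>k\<close>: by \<open>class_switch\<close> the second pair cannot be
  \<open>j\<close>, \<open>l\<close> again, so it contributes a fourth direction. The two searches
  cost 12 each.\<close>

lemma near_all_but_one:
  assumes "St i j b"
  shows "\<exists>x. \<forall>a. a \<noteq> i \<longrightarrow> a \<noteq> x \<longrightarrow> near i a b 24"
proof -
  obtain k l where kl: "distinct [i, j, k, l]" "{i, j, k} \<in> prolate \<longleftrightarrow> {i, j, l} \<in> prolate"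
    "near i k b 12" "near i l b 12" using near_pair[OF assms] by blast
  obtain c where c: "St i k c" "norm (c - b) \<le> 12" using kl(3) by (auto simp: near_def)
  obtain p q where pq: "distinct [i, k, p, q]" "{i, k, p} \<in> prolate \<longleftrightarrow> {i, k, q} \<in> prolate"
    "near i p c 12" "near i q c 12" using near_pair[OF c(1)] by blast
  have nr: "near i a b 24" if a: "near i a c 12" for a
  proof -
    obtain d where d: "St i a d" "norm (d - c) \<le> 12" using a by (auto simp: near_def)
    have "d - b = (c - b) + (d - c)" by simp
    then have "norm (d - b) \<le> 24" using norm_triangle_mono[OF c(2) d(2)] by simp
    with d show ?thesis by (auto simp: near_def)
  qed
  have "\<not> (p \<in> {j, l} \<and> q \<in> {j, l})"
  proof
    assume "p \<in> {j, l} \<and> q \<in> {j, l}"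
    then have "{i, k, j} \<in> prolate \<longleftrightarrow> {i, k, l} \<in> prolate" using pq(1,2) by auto
    moreover have "{i, k, j} = {i, j, k}" by auto
    ultimately show False using class_switch[OF kl(1,2)] by simp
  qed
  then obtain m where m: "m \<notin> {j, l}" "m = p \<or> m = q" by blast
  have d: "distinct [i, j, k, l, m]" and "near i m b 24" using m pq kl nr by auto
  have "card {i, j, k, l, m} = 5" using d by simp
  then have "card (UNIV - {i, j, k, l, m}) = 1" by (simp add: card_Diff_subset)
  then obtain x where x: "UNIV - {i, j, k, l, m} = {x}" by (auto simp: card_1_singleton_iff)
  have "near i a b 24" if "a \<noteq> i" "a \<noteq> x" for a
  proof -
    have "a \<in> {j, k, l, m}" using x that by blast
    then show ?thesis
      using near_self[OF assms, of 24] near_mono[OF kl(3), of 24] near_mono[OF kl(4),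
          of 24] \<open>near i m b 24\<close> by auto
  qed
  then show ?thesis by blast
qed

text \<open>Any two places of the same kind in the right relative position are compared, whether or
  not they lie on one worm; 24 is the accuracy of \<open>worm_shift\<close>.\<close>

definition bounded_shift :: "real \<Rightarrow> real \<Rightarrow> bool" where
  "bounded_shift B S \<longleftrightarrow> (\<forall>i c b b1 s. St i c b \<longrightarrow> St i c b1 \<longrightarrow> \<bar>s\<bar> \<le> S \<longrightarrow>
     norm (b1 - b - s *\<^sub>R nrm \<phi> i c) \<le> 24 \<longrightarrow> norm (F b1 - F b) \<le> B)"

lemma St_lip:
  obtains C where "0 \<le> C" "\<And>i j b i' j' b'. St i j b \<Longrightarrow> St i' j' b' \<Longrightarrow> norm (b' - b) \<le> r \<Longrightarrow>
      norm (F b' - F b) \<le> C"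
proof -
  obtain C where "\<forall>i j k b i' j' k' b'. T i j k b \<longrightarrow> T i' j' k' b' \<longrightarrow> norm (b' - b) \<le> r \<longrightarrow>
      norm (F b' - F b) \<le> C"
    using lip[of r] by blast
  then show thesis by (intro that[of "max C 0"]) (auto simp: St_def intro: max.coboundedI1)
qed

text \<open>The internal displacement \<open>t\<close> along \<open>c\<close> equals \<open>\<plusminus>1/\<phi>\<close> times the one along the short side
  \<open>e\<close> of a triangle, up to a constant. This contracts bounds while the length grows by \<open>\<phi>\<close>.\<close>

lemma bounded_shift_step:
  obtains E where "0 \<le> E" "\<And>B S. bounded_shift B S \<Longrightarrow> bounded_shift (5/8 * B + E) (\<phi> * S)"
    "\<And>B. E \<le> B \<Longrightarrow> bounded_shift B 1"
proof -
  obtain C where C: "0 \<le> C" "\<And>i j b i' j' b'. St i j b \<Longrightarrow> St i' j' b' \<Longrightarrow> norm (b' - b) \<le> 120 \<Longrightarrow>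
      norm (F b' - F b) \<le> C"
    using St_lip[of 120] by blast
  \<comment> \<open>\<open>D\<close> adds up the errors of the internal closing relation: four
    comparisons of nearby places and three worms with error 24. The radius 120 = 5 * 24 is the
    physical gap of the triangle.\<close>
  define D where "D = 4 * C + 72"
  define E where "E = 48 + C + 12 * D"
  define \<nu> where "\<nu> = sqrt (4 * (\<psi> + 1))"
  have \<nu>: "norm (nrm \<psi> i j) = \<nu>" if "i \<noteq> j" for i j
    using nrm_self[OF golden_root(2) that] by (simp add: \<nu>_def norm_eq_sqrt_inner)
  have "0 \<le> \<nu>" "\<nu> \<le> 4" using \<nu>[of 1 2] norm_nrm[of \<psi> 1 2] golden_bounds by auto
  have "0 \<le> E" "0 \<le> D" using C(1) by (simp_all add: E_def D_def)
  show thesis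
  proof
    show "0 \<le> E" by fact
    show "bounded_shift B 1" if "E \<le> B" for B
      unfolding bounded_shift_def
    proof (intro allI impI)
      fix i c b b1 s
      assume *: "St i c b" "St i c b1" "\<bar>s\<bar> \<le> (1::real)" "norm (b1 - b - s *\<^sub>R nrm \<phi> i c) \<le> 24"
      have "norm (s *\<^sub>R nrm \<phi> i c) \<le> 1 * 4"
        unfolding norm_scaleR using * golden_bounds by (intro mult_mono norm_nrm) auto
      from norm_triangle_mono[OF *(4) this] have "norm (b1 - b) \<le> 120" by simp
      then have "norm (F b1 - F b) \<le> C" using C(2) * by blast
      then show "norm (F b1 - F b) \<le> B" using that \<open>0 \<le> D\<close> by (simp add: E_def)
    qed
    show "bounded_shift (5/8 * B + E) (\<phi> * S)" if Q: "bounded_shift B S" for B S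
      unfolding bounded_shift_def
    proof (intro allI impI)
      fix i c b b1 s
      assume b: "St i c b" and b1: "St i c b1" and s: "\<bar>s\<bar> \<le> \<phi> * S"
        and bb1: "norm (b1 - b - s *\<^sub>R nrm \<phi> i c) \<le> 24"
      obtain x where x: "\<And>a. a \<noteq> i \<Longrightarrow> a \<noteq> x \<Longrightarrow> near i a b 24" using near_all_but_one[OF b] by blast
      obtain y where y: "\<And>a. a \<noteq> i \<Longrightarrow> a \<noteq> y \<Longrightarrow> near i a b1 24" using near_all_but_one[OF b1] by blast
      have "i \<noteq> c" using b T_distinct by (force simp: St_def)
      obtain a e and \<alpha> \<beta> :: "real \<Rightarrow> real" where ae: "distinct [i, c, a, e]" "a \<noteq> x" "e \<noteq> y"
        and rel: "\<And>g. g * g = g + 1 \<Longrightarrow> nrm g i c = \<alpha> g *\<^sub>R nrm g i a + \<beta> g *\<^sub>R nrm g i e"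
        and \<beta>: "\<And>g. \<bar>\<beta> g\<bar> = \<bar>g - 1\<bar>"
        using contracting_relation[OF \<open>i \<noteq> c\<close>, of x y] by blast
      obtain ba where ba: "St i a ba" "norm (ba - b) \<le> 24" using x[of a] ae by (auto simp: near_def)
      obtain be where be: "St i e be" "norm (be - b1) \<le> 24" using y[of e] ae by (auto simp: near_def)
      \<comment> \<open>From \<open>b\<close> along axis \<open>a\<close>, and from
        \<open>b1\<close> back along axis \<open>e\<close>: by the relation at \<phi> both paths end
        near the third corner of the triangle.\<close>
      obtain p ta where p: "St i a p" "norm (p - ba - (s * \<alpha> \<phi>) *\<^sub>R nrm \<phi> i a) \<le> 24"
          "norm (F p - F ba - ta *\<^sub>R nrm \<psi> i a) \<le> 24"
        using worm_shift[OF ba(1)] by blast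
      obtain q te where q: "St i e q" "norm (q - be - (- (s * \<beta> \<phi>)) *\<^sub>R nrm \<phi> i e) \<le> 24"
          "norm (F q - F be - te *\<^sub>R nrm \<psi> i e) \<le> 24"
        using worm_shift[OF be(1)] by blast
      \<comment> \<open>As \<open>b1\<close> may lie on another worm than \<open>b\<close>, the
        internal multiple \<open>t\<close> is read off at a place \<open>z\<close> on a worm from
        \<open>b\<close>, close to \<open>b1\<close>.\<close>
      obtain z t where z: "St i c z" "norm (z - b - s *\<^sub>R nrm \<phi> i c) \<le> 24"
          "norm (F z - F b - t *\<^sub>R nrm \<psi> i c) \<le> 24"
        using worm_shift[OF b] by blast
      have qp: "q - p = (q - be - (- (s * \<beta> \<phi>)) *\<^sub>R nrm \<phi> i e) + (be - b1) + (b1 - b - s *\<^sub>R nrm \<phi> i c)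
          - (p - ba - (s * \<alpha> \<phi>) *\<^sub>R nrm \<phi> i a) - (ba - b)"
        by (simp add: rel[OF golden_root(1)] algebra_simps)
      have "norm (q - p) \<le> 24 + 24 + 24 + 24 + 24"
        unfolding qp by (intro norm_triangle_mono norm_diff_mono q(2) be(2) bb1 p(2) ba(2))
      then have "norm (q - p) \<le> 120" by simp
      then have pq: "norm (F q - F p) \<le> C" using C(2) p(1) q(1) by blast
      have "norm (b1 - z) \<le> 120"
        using norm_triangle_ineq4[of "b1 - b - s *\<^sub>R nrm \<phi> i c" "z - b - s *\<^sub>R nrm \<phi> i c"] bb1 z(2)
            by simp
      then have zb1: "norm (F b1 - F z) \<le> C" using C(2) z(1) b1 by blast
      have Fa: "norm (F ba - F b) \<le> C" and Fe: "norm (F be - F b1) \<le> C"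
        using C(2)[OF b ba(1)] C(2)[OF b1 be(1)] ba(2) be(2) by auto
      \<comment> \<open>The triangle closed in internal space. Its component along \<open>e\<close>
        links \<open>t\<close> to \<open>te\<close>, and there the factor has absolute value |\<psi>
        - 1| = \<phi>.\<close>
      have "(t * \<alpha> \<psi> - ta) *\<^sub>R nrm \<psi> i a + (t * \<beta> \<psi> + te) *\<^sub>R nrm \<psi> i e =
          (t *\<^sub>R nrm \<psi> i c - (F z - F b)) - (F b1 - F z) - (F q - F be - te *\<^sub>R nrm \<psi> i e)
          - (F be - F b1) + (F q - F p) + (F p - F ba - ta *\<^sub>R nrm \<psi> i a) + (F ba - F b)"
        (is "?l = _") by (simp add: rel[OF golden_root(2)] algebra_simps)
      also have "norm \<dots> \<le> 24 + C + 24 + C + C + 24 + C"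
        using z(3) by (intro norm_triangle_mono norm_diff_mono zb1 q(3) Fe pq p(3) Fa) (simp add: norm_minus_commute)
      also have "\<dots> = D" by (simp add: D_def)
      finally have "\<bar>t * \<beta> \<psi> + te\<bar> \<le> 3 * D"
        using coeff_bound[of i a e "t * \<beta> \<psi> + te" "t * \<alpha> \<psi> - ta"] ae(1) by auto
      moreover have "\<bar>t * \<beta> \<psi>\<bar> = \<bar>t\<bar> * \<phi>" using golden_bounds by (simp add: abs_mult \<beta>)
      ultimately have t1: "\<bar>t\<bar> * \<phi> \<le> \<bar>te\<bar> + 3 * D" by linarith
      \<comment> \<open>The side along \<open>e\<close> is the shorter one, as \<phi> (\<phi> - 1) =
        1, so the assumed bound applies to it.\<close>
      have "\<bar>s * \<beta> \<phi>\<bar> \<le> S"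
      proof -
        have "\<bar>s * \<beta> \<phi>\<bar> = \<bar>s\<bar> * (\<phi> - 1)" using golden_bounds by (simp add: abs_mult \<beta>)
        also have "\<dots> \<le> (\<phi> * S) * (\<phi> - 1)" using s golden_bounds by (intro mult_right_mono) auto
        also have "\<dots> = (\<phi> * \<phi> - \<phi>) * S" by (simp add: algebra_simps)
        also have "\<dots> = S" by (simp add: golden_root(1))
        finally show ?thesis .
      qed
      then have "norm (F q - F be) \<le> B"
        using Q q(2) be(1) q(1) unfolding bounded_shift_def by (metis abs_minus_cancel)
      then have "norm (te *\<^sub>R nrm \<psi> i e) \<le> B + 24"
        using q(3) norm_triangle_ineq4[of "F q - F be" "F q - F be - te *\<^sub>R nrm \<psi> i e"] by simp
      then have te: "\<bar>te\<bar> * \<nu> \<le> B + 24" using \<nu>[of i e] ae(1) by simp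
      have "(\<bar>t\<bar> * \<phi>) * \<nu> \<le> (\<bar>te\<bar> + 3 * D) * \<nu>" using t1 \<open>0 \<le> \<nu>\<close> by (rule mult_right_mono)
      also have "\<dots> = \<bar>te\<bar> * \<nu> + (3 * D) * \<nu>" by (simp add: algebra_simps)
      also have "\<dots> \<le> (B + 24) + (3 * D) * 4"
          using te \<open>\<nu> \<le> 4\<close> \<open>0 \<le> D\<close> by (intro add_mono mult_left_mono) auto
      finally have t2: "(\<bar>t\<bar> * \<nu>) * \<phi> \<le> B + 24 + 12 * D" by (simp add: algebra_simps)
      have "(\<bar>t\<bar> * \<nu>) * (8/5) \<le> (\<bar>t\<bar> * \<nu>) * \<phi>" using golden_bounds \<open>0 \<le> \<nu>\<close> by (intro mult_left_mono) auto
      with t2 have "\<bar>t\<bar> * \<nu> \<le> 5/8 * (B + 24 + 12 * D)" by simp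
      then have t3: "norm (t *\<^sub>R nrm \<psi> i c) \<le> 5/8 * (B + 24 + 12 * D)" using \<nu>[OF \<open>i \<noteq> c\<close>] by simp
      have "F b1 - F b = (F b1 - F z) + (F z - F b - t *\<^sub>R nrm \<psi> i c) + t *\<^sub>R nrm \<psi> i c" by simp
      then have "norm (F b1 - F b) \<le> C + 24 + 5/8 * (B + 24 + 12 * D)"
        using norm_triangle_mono[OF norm_triangle_mono[OF zb1 z(3)] t3] by metis
      also have "\<dots> \<le> 5/8 * B + E" using \<open>0 \<le> D\<close> by (simp add: E_def)
      finally show "norm (F b1 - F b) \<le> 5/8 * B + E" .
    qed
  qed
qed

text \<open>\<open>8/3 * E\<close> is the fixed point of the map from \<open>B\<close> to
  \<open>5/8 * B + E\<close>, so the bound persists while the range grows like the powers of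
  \<phi>.\<close>

lemma worm_bounded:
  obtains B where "0 \<le> B" "\<And>S. bounded_shift B S"
proof -
  obtain E where E: "0 \<le> E" "\<And>B S. bounded_shift B S \<Longrightarrow> bounded_shift (5/8 * B + E) (\<phi> * S)"
    "\<And>B. E \<le> B \<Longrightarrow> bounded_shift B 1" using bounded_shift_step by blast
  have *: "bounded_shift (8/3 * E) (\<phi> ^ n)" for n
  proof (induction n)
    case (Suc n)
    have "5/8 * (8/3 * E) + E = 8/3 * E" by simp
    then show ?case using E(2)[OF Suc] by simp
  qed (use E in auto)
  have "bounded_shift (8/3 * E) S" for S
  proof -
    obtain n where "S < \<phi> ^ n" using real_arch_pow[of \<phi> S] golden_bounds by auto
    then show ?thesis using *[of n] unfolding bounded_shift_def by (meson less_le_not_le order_trans)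
  qed
  then show thesis using that[of "8/3 * E"] E(1) by auto
qed

text \<open>In internal space the two classes advance in opposite directions along the axis, so a bounded
  displacement forces both of them to occur regularly.\<close>

lemma all_kinds:
  obtains N where "\<And>i j \<kappa> \<beta> l. wseq i j \<kappa> \<beta> \<Longrightarrow> distinct [i, j, l] \<Longrightarrow> \<exists>n<N. \<kappa> n = l"
proof -
  obtain B where B: "0 \<le> B" "\<And>S. bounded_shift B S" using worm_bounded by blast
  obtain N :: nat where N: "6 * B + 10 < N" using reals_Archimedean2 by blast
  have "\<exists>n<N. \<kappa> n = l" if w: "wseq i j \<kappa> \<beta>" and l: "distinct [i, j, l]" for i j \<kappa> \<beta> l
  proof (rule ccontr)
    assume non: "\<not> (\<exists>n<N. \<kappa> n = l)"
    \<comment> \<open>The indices of tiles in the class of \<open>l\<close>. If \<open>l\<close>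
      never occurs, one third edge is left in this class, and alternation forbids it to occur twice
      in succession.\<close>
    define E where "E n \<longleftrightarrow> ({i, j, \<kappa> n} \<in> prolate \<longleftrightarrow> {i, j, l} \<in> prolate)" for n
    have one: False if "m < n" "n < N" "E m" "E n" for m n
    proof -
      define n' where "n' = (LEAST r. m < r \<and> E r)"
      have n': "m < n'" "E n'" using LeastI[of "\<lambda>r. m < r \<and> E r" n] that by (auto simp: n'_def)
      have "n' \<le> n" unfolding n'_def using that by (intro Least_le) auto
      have "\<not> E r" if "m < r" "r < n'" for r
        using not_less_Least[of r "\<lambda>r. m < r \<and> E r"] that by (auto simp: n'_def)
      then have "\<kappa> m \<noteq> \<kappa> n'"
        using wseq_alt[OF w n'(1)] that(3) n'(2) unfolding E_def by blast
      moreover have "\<kappa> m \<noteq> l" "\<kappa> n' \<noteq> l" using non that \<open>n' \<le> n\<close> by auto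
      ultimately have "distinct [i, j, l, \<kappa> m, \<kappa> n']"
        using l wseq_distinct[OF w, of m] wseq_distinct[OF w, of n'] by auto
      then show False using class_size that(3) n'(2) unfolding E_def by blast
    qed
    define f where "f n = wv \<psi> i j (\<kappa> n) \<bullet> nrm \<psi> i j" for n
    have f: "f n = (if {i, j, \<kappa> n} \<in> prolate then 2 * \<psi> else 2 * (\<psi> + 1))" for n
      unfolding f_def by (rule wv_nrm[OF golden_root(2) wseq_distinct[OF w]])
    \<comment> \<open>Tiles of the other class all contribute more than 2/3 with one sign; the
      single exceptional tile costs at most 2.\<close>
    have "2/3 * N - 4 \<le> \<bar>sum f {..<N}\<bar>"
    proof (cases "{i, j, l} \<in> prolate")
      case True
      have "N * (2/3) - 2 \<le> sum f {..<N}"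
        by (rule sum_one_exception[of N E]) (use one True golden_bounds in \<open>auto simp: f E_def\<close>)
      then show ?thesis by simp
    next
      case False
      have "N * (2/3) - 2 \<le> (\<Sum>n<N. - f n)"
        by (rule sum_one_exception[of N E]) (use one False golden_bounds in \<open>auto simp: f E_def\<close>)
      then show ?thesis by (simp add: sum_negf)
    qed
    also have "sum f {..<N} = (F (\<beta> N) - F (\<beta> 0)) \<bullet> nrm \<psi> i j"
      using wseq_sums(2)[OF w, of N] by (simp add: f_def inner_sum_left)
    also have "\<bar>\<dots>\<bar> \<le> norm (F (\<beta> N) - F (\<beta> 0)) * norm (nrm \<psi> i j)" by (rule Cauchy_Schwarz_ineq2)
    also have "\<dots> \<le> B * 4"
    proof (rule mult_mono)
      have "norm (\<beta> N - \<beta> 0 - (\<Sum>m<N. height \<phi> i j (\<kappa> m)) *\<^sub>R nrm \<phi> i j) \<le> 24"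
        using wseq_sum[OF w golden_root(1), of N] golden_bounds wseq_sums(1)[OF w, of N] by simp
      then show "norm (F (\<beta> N) - F (\<beta> 0)) \<le> B"
        using B(2) w unfolding bounded_shift_def St_def wseq_def by (metis order_refl)
    qed (use golden_bounds B in \<open>auto intro: norm_nrm\<close>)
    finally show False using N by simp
  qed
  then show thesis by (rule that)
qed

text \<open>By \<open>all_kinds\<close> the second index can be exchanged at will; after a flip the
  first one can be exchanged too.\<close>

lemma near_everything:
  obtains R where "\<And>i j b k l. St i j b \<Longrightarrow> k \<noteq> l \<Longrightarrow> near k l b R"
proof -
  obtain N where N: "\<And>i j \<kappa> \<beta> l. wseq i j \<kappa> \<beta> \<Longrightarrow> distinct [i, j, l] \<Longrightarrow> \<exists>n<N. \<kappa> n = l"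
    using all_kinds by blast
  define R :: real where "R = 2 * N + 8"
  have turnR: "near i k b R" if b: "St i j b" and "k \<noteq> i" for i j b k
  proof (cases "k = j")
    case True
    then show ?thesis using near_self[OF b] by (simp add: R_def)
  next
    case False
    obtain k0 where "T i j k0 b" using b by (auto simp: St_def)
    from ex_wseq[OF this] obtain \<kappa> \<beta> where w: "wseq i j \<kappa> \<beta>" and b: "\<beta> 0 = b" by blast
    have "distinct [i, j, k]" using wseq_distinct[OF w, of 0] that False by auto
    then obtain n where "n < N" "\<kappa> n = k" using N[OF w] by blast
    then show ?thesis using near_mono[OF wseq_near[OF w, of n], of R] b by (auto simp: R_def)
  qed
  have "near k l b (R + (2 + R))" if b: "St i j b" and kl: "k \<noteq> l" for i j b k l
  proof (cases "k = i")
    case True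
    then show ?thesis using turnR[OF b, of l] kl by (auto intro: near_mono simp: R_def)
  next
    case False
    have "near k l c (2 + R)" if "St i k c" for c
      using near_trans[OF near_flip[OF that]] turnR[of k i] kl by auto
    then show ?thesis using near_trans[OF turnR[OF b False]] by blast
  qed
  then show thesis by (rule that)
qed

text \<open>A journey along three orthogonal axes, each leg costing at most \<open>C + B\<close>
  however long it is: \<open>C\<close> for reaching a worm of the right kind, \<open>B\<close> for
  moving along it.\<close>

lemma F_bounded:
  obtains K where "\<And>i j b i' j' b'. St i j b \<Longrightarrow> St i' j' b' \<Longrightarrow> norm (F b' - F b) \<le> K"
proof -
  obtain B where B: "0 \<le> B" "\<And>S. bounded_shift B S" using worm_bounded by blast
  obtain R where R: "\<And>i j b k l. St i j b \<Longrightarrow> k \<noteq> l \<Longrightarrow> near k l b R" using near_everything by blast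
  obtain C where C: "0 \<le> C" "\<And>i j b i' j' b'. St i j b \<Longrightarrow> St i' j' b' \<Longrightarrow> norm (b' - b) \<le> R \<Longrightarrow>
      norm (F b' - F b) \<le> C"
    using St_lip[of R] by blast
  obtain C' where C': "0 \<le> C'" "\<And>i j b i' j' b'. St i j b \<Longrightarrow> St i' j' b' \<Longrightarrow> norm (b' - b) \<le> 3 * (R
      + 24) \<Longrightarrow> norm (F b' - F b) \<le> C'"
    using St_lip[of "3 * (R + 24)"] by blast
  have move: "\<exists>c. St k l c \<and> norm (c - b - s *\<^sub>R nrm \<phi> k l) \<le> R + 24 \<and> norm (F c - F b) \<le> C + B"
    if b: "St i j b" and kl: "k \<noteq> l" for i j b k l s
  proof -
    obtain d where d: "St k l d" "norm (d - b) \<le> R" using R[OF b kl] by (auto simp: near_def)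
    obtain c t where c: "St k l c" "norm (c - d - s *\<^sub>R nrm \<phi> k l) \<le> 24"
      using worm_shift[OF d(1)] by blast
    have "norm (F c - F d) \<le> B" using B(2) c d(1) unfolding bounded_shift_def by blast
    moreover have "norm (F d - F b) \<le> C" using C(2)[OF b d] .
    moreover have "F c - F b = (F d - F b) + (F c - F d)" by simp
    ultimately have "norm (F c - F b) \<le> C + B" using norm_triangle_mono by metis
    moreover have *: "c - b - s *\<^sub>R nrm \<phi> k l = (d - b) + (c - d - s *\<^sub>R nrm \<phi> k l)" by simp
    have "norm (c - b - s *\<^sub>R nrm \<phi> k l) \<le> R + 24"
      unfolding * by (rule norm_triangle_mono[OF d(2) c(2)])
    ultimately show ?thesis using c(1) by blast
  qed
  have "norm (F b' - F b) \<le> 3 * (C + B) + C'" if b: "St i j b" and b': "St i' j' b'" for i j b i' j' b'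
  proof -
    \<comment> \<open>The axes of the pairs 12, 34, 56 are the third, first and second coordinate
      vector times -2\<phi>.\<close>
    obtain s1 s2 s3 where s: "b' - b = s1 *\<^sub>R nrm \<phi> 1 2 + s2 *\<^sub>R nrm \<phi> 3 4 + s3 *\<^sub>R nrm \<phi> 5 6"
    proof -
      let ?v = "b' - b"
      have "\<phi> \<noteq> 0" using golden_bounds by auto
      then have "?v = (- ?v $ 3 / (2 * \<phi>)) *\<^sub>R nrm \<phi> 1 2 + (- ?v $ 1 / (2 * \<phi>)) *\<^sub>R nrm \<phi> 3 4
          + (- ?v $ 2 / (2 * \<phi>)) *\<^sub>R nrm \<phi> 5 6"
        by (simp add: nrm_simps)
      then show thesis by (rule that)
    qed
    obtain c1 where c1: "St 1 2 c1" "norm (c1 - b - s1 *\<^sub>R nrm \<phi> 1 2) \<le> R + 24"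
        "norm (F c1 - F b) \<le> C + B"
      using move[OF b, of 1 2 s1] by auto
    obtain c2 where c2: "St 3 4 c2" "norm (c2 - c1 - s2 *\<^sub>R nrm \<phi> 3 4) \<le> R + 24"
        "norm (F c2 - F c1) \<le> C + B"
      using move[OF c1(1), of 3 4 s2] by auto
    obtain c3 where c3: "St 5 6 c3" "norm (c3 - c2 - s3 *\<^sub>R nrm \<phi> 5 6) \<le> R + 24"
        "norm (F c3 - F c2) \<le> C + B"
      using move[OF c2(1), of 5 6 s3] by auto
    have *: "c3 - b' = (c1 - b - s1 *\<^sub>R nrm \<phi> 1 2) + (c2 - c1 - s2 *\<^sub>R nrm \<phi> 3 4)
        + (c3 - c2 - s3 *\<^sub>R nrm \<phi> 5 6)"
      using s by (simp add: algebra_simps)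
    have "norm (c3 - b') \<le> (R + 24) + (R + 24) + (R + 24)"
      unfolding * by (rule norm_triangle_mono[OF norm_triangle_mono[OF c1(2) c2(2)] c3(2)])
    then have "norm (b' - c3) \<le> 3 * (R + 24)" by (simp add: norm_minus_commute)
    then have "norm (F b' - F c3) \<le> C'" using C'(2)[OF c3(1) b'] by blast
    moreover have "F b' - F b = (F c1 - F b) + (F c2 - F c1) + (F c3 - F c2) + (F b' - F c3)" by simp
    ultimately show ?thesis
      using norm_triangle_mono[OF norm_triangle_mono[OF norm_triangle_mono[OF c1(3) c2(3)] c3(3)],
          of "F b' - F c3" C'] by simp
  qed
  then show thesis by (rule that)
qed

end

section \<open>Parallelepipeds and their faces\<close>

lemmas vec3_simps = cross3_def vec_eq_iff forall_3 inner_vec_def sum_3 vector_3 inner_real_def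

definition ppd :: "real ^ 3 \<Rightarrow> real ^ 3 \<Rightarrow> real ^ 3 \<Rightarrow> real ^ 3 \<Rightarrow> (real ^ 3) set" where
  "ppd b p q r = {b + s *\<^sub>R p + t *\<^sub>R q + u *\<^sub>R r | s t u. s \<in> {0..1} \<and> t \<in> {0..1} \<and> u \<in> {0..1}}"

text \<open>The coordinate of \<open>y\<close> along \<open>r\<close> in the basis \<open>p, q, r\<close> (it is 0 if these vectors are
  linearly dependent).\<close>

definition lco :: "real ^ 3 \<Rightarrow> real ^ 3 \<Rightarrow> real ^ 3 \<Rightarrow> real ^ 3 \<Rightarrow> real" where
  "lco p q r y = (cross3 p q \<bullet> y) / (cross3 p q \<bullet> r)"

lemma dot_cross_rotate: "cross3 q r \<bullet> p = cross3 p q \<bullet> r"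
  by (simp add: vec3_simps algebra_simps)

lemma lco_linear [simp]:
  "lco p q r (y + z) = lco p q r y + lco p q r z" "lco p q r (y - z) = lco p q r y - lco p q r z"
  "lco p q r (- y) = - lco p q r y" "lco p q r (c *\<^sub>R y) = c * lco p q r y" "lco p q r 0 = 0"
  by (simp_all add: lco_def inner_add_right inner_diff_right add_divide_distrib diff_divide_distrib)

lemma lco_basis:
  assumes "cross3 p q \<bullet> r \<noteq> 0"
  shows "lco p q r p = 0" "lco p q r q = 0" "lco p q r r = 1"
  using assms by (simp_all add: lco_def dot_cross_self)

lemma lco_all_basis:
  assumes "cross3 p q \<bullet> r \<noteq> 0"
  shows "lco p q r p = 0" "lco p q r q = 0" "lco p q r r = 1"
    "lco q r p p = 1" "lco q r p q = 0" "lco q r p r = 0"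
    "lco r p q p = 0" "lco r p q q = 1" "lco r p q r = 0"
  using assms by (simp_all add: lco_basis dot_cross_rotate)

text \<open>Cramer's rule.\<close>

lemma lco_expand:
  assumes "cross3 p q \<bullet> r \<noteq> 0"
  shows "y = lco q r p y *\<^sub>R p + lco r p q y *\<^sub>R q + lco p q r y *\<^sub>R r"
proof -
  let ?D = "cross3 p q \<bullet> r"
  have "?D *\<^sub>R y = (cross3 q r \<bullet> y) *\<^sub>R p + (cross3 r p \<bullet> y) *\<^sub>R q + (cross3 p q \<bullet> y) *\<^sub>R r"
    by (simp add: vec3_simps algebra_simps)
  then have "(1 / ?D) *\<^sub>R ?D *\<^sub>R y = (1 / ?D) *\<^sub>R ((cross3 q r \<bullet> y) *\<^sub>R p + (cross3 r p \<bullet> y) *\<^sub>R q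
      + (cross3 p q \<bullet> y) *\<^sub>R r)"
    by simp
  then show ?thesis
    using assms by (simp add: lco_def scaleR_add_right dot_cross_rotate[of r p q]
        dot_cross_rotate[of q r p])
qed

lemma ppd_iff:
  assumes "cross3 p q \<bullet> r \<noteq> 0"
  shows "y \<in> ppd b p q r \<longleftrightarrow>
    lco q r p (y - b) \<in> {0..1} \<and> lco r p q (y - b) \<in> {0..1} \<and> lco p q r (y - b) \<in> {0..1}"
proof
  assume "y \<in> ppd b p q r"
  then obtain s t u where "y = b + s *\<^sub>R p + t *\<^sub>R q + u *\<^sub>R r" "s \<in> {0..1}" "t \<in> {0..1}" "u \<in> {0..1}"
    by (auto simp: ppd_def)
  then show "lco q r p (y - b) \<in> {0..1} \<and> lco r p q (y - b) \<in> {0..1} \<and> lco p q r (y - b) \<in> {0..1}"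
    by (simp add: lco_all_basis[OF assms])
next
  assume *: "lco q r p (y - b) \<in> {0..1} \<and> lco r p q (y - b) \<in> {0..1} \<and> lco p q r (y - b) \<in> {0..1}"
  have "y = b + lco q r p (y - b) *\<^sub>R p + lco r p q (y - b) *\<^sub>R q + lco p q r (y - b) *\<^sub>R r"
    using lco_expand[OF assms, of "y - b"] by (simp add: algebra_simps)
  with * show "y \<in> ppd b p q r" unfolding ppd_def by blast
qed

lemma ppd_rotate: "ppd b q r p = ppd b p q r"
proof -
  have *: "ppd b q r p \<subseteq> ppd b p q r" for p q r
  proof
    fix y assume "y \<in> ppd b q r p"
    then obtain s t u where "y = b + s *\<^sub>R q + t *\<^sub>R r + u *\<^sub>R p" "s \<in> {0..1}" "t \<in> {0..1}" "u \<in> {0..1}"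
      unfolding ppd_def by blast
    moreover from this have "y = b + u *\<^sub>R p + s *\<^sub>R q + t *\<^sub>R r" by (simp add: add_ac)
    ultimately show "y \<in> ppd b p q r" unfolding ppd_def by blast
  qed
  show ?thesis using *[of q r p] *[of r p q] *[of p q r] by blast
qed

lemma ppd_swap: "ppd b q p r = ppd b p q r"
proof -
  have *: "ppd b q p r \<subseteq> ppd b p q r" for p q
  proof
    fix y assume "y \<in> ppd b q p r"
    then obtain s t u where "y = b + s *\<^sub>R q + t *\<^sub>R p + u *\<^sub>R r" "s \<in> {0..1}" "t \<in> {0..1}" "u \<in> {0..1}"
      unfolding ppd_def by blast
    moreover from this have "y = b + t *\<^sub>R p + s *\<^sub>R q + u *\<^sub>R r" by (simp add: add_ac)
    ultimately show "y \<in> ppd b p q r" unfolding ppd_def by blast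
  qed
  show ?thesis using *[of q p] *[of p q] by blast
qed

lemma ppd_flip: "ppd (b + r) p q (- r) = ppd b p q r"
proof -
  have "ppd (b + r) p q (- r) \<subseteq> ppd b p q r" for b r
  proof
    fix y assume "y \<in> ppd (b + r) p q (- r)"
    then obtain s t u where "y = b + r + s *\<^sub>R p + t *\<^sub>R q + u *\<^sub>R (- r)" "s \<in> {0..1}" "t \<in> {0..1}"
        "u \<in> {0..1}"
      by (auto simp: ppd_def)
    then have "y = b + s *\<^sub>R p + t *\<^sub>R q + (1 - u) *\<^sub>R r" "1 - u \<in> {0..1}" by (auto simp: algebra_simps)
    with \<open>s \<in> {0..1}\<close> \<open>t \<in> {0..1}\<close> show "y \<in> ppd b p q r" unfolding ppd_def by blast
  qed
  from this[of b r] this[of "b + r" "- r"] show ?thesis by auto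
qed

lemma ppd_eq_image: "ppd b p q r = (\<lambda>y. b + y) ` ppd 0 p q r"
proof (intro equalityI subsetI)
  fix y assume "y \<in> ppd b p q r"
  then obtain s t u where *: "y = b + s *\<^sub>R p + t *\<^sub>R q + u *\<^sub>R r" "s \<in> {0..1}" "t \<in> {0..1}" "u \<in> {0..1}"
    unfolding ppd_def by blast
  have "0 + s *\<^sub>R p + t *\<^sub>R q + u *\<^sub>R r \<in> ppd 0 p q r" unfolding ppd_def using *(2-4) by blast
  then show "y \<in> (\<lambda>y. b + y) ` ppd 0 p q r" by (rule rev_image_eqI) (simp add: *(1))
next
  fix y assume "y \<in> (\<lambda>y. b + y) ` ppd 0 p q r"
  then obtain s t u where *: "y = b + (0 + s *\<^sub>R p + t *\<^sub>R q + u *\<^sub>R r)" "s \<in> {0..1}" "t \<in> {0..1}"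
      "u \<in> {0..1}"
    unfolding ppd_def by blast
  then have "y = b + s *\<^sub>R p + t *\<^sub>R q + u *\<^sub>R r" by simp
  with *(2-4) show "y \<in> ppd b p q r" unfolding ppd_def by blast
qed

lemma compact_ppd: "compact (ppd b p q r)"
proof -
  have "ppd b p q r = (\<lambda>(s, t, u). b + s *\<^sub>R p + t *\<^sub>R q + u *\<^sub>R r) ` ({0..1} \<times> {0..1} \<times> {0..1})"
    unfolding ppd_def by (auto simp: image_iff Bex_def; blast)
  moreover have "compact \<dots>"
    by (intro compact_continuous_image compact_Times compact_Icc) (auto simp: case_prod_unfold intro!: continuous_intros)
  ultimately show ?thesis by simp
qed

lemma interval_overshoot:
  fixes a c :: real
  assumes "a \<in> {0..1}" "c \<in> {0..1}" "0 < a \<and> a < 1 \<or> c = a"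
  obtains \<delta> where "0 < \<delta>" "\<And>\<epsilon>. 0 < \<epsilon> \<Longrightarrow> \<epsilon> \<le> \<delta> \<Longrightarrow> a + \<epsilon> * (a - c) \<in> {0..1}"
proof (cases "c = a")
  case False
  define \<delta> where "\<delta> = min a (1 - a)"
  have "0 < \<delta>" using assms False by (auto simp: \<delta>_def)
  moreover have "a + \<epsilon> * (a - c) \<in> {0..1}" if "0 < \<epsilon>" "\<epsilon> \<le> \<delta>" for \<epsilon>
  proof -
    have "\<bar>\<epsilon> * (a - c)\<bar> \<le> \<epsilon> * 1" unfolding abs_mult using assms that by (intro mult_mono) auto
    then show ?thesis using that unfolding \<delta>_def by auto
  qed
  ultimately show thesis by (rule that)
qed (use assms that[of 1] in auto)

text \<open>The segment from \<open>z\<close> to \<open>y\<close> can be prolonged beyond \<open>y\<close> inside the parallelepiped.\<close>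

lemma face_of_ppd_spread:
  assumes D: "cross3 p q \<bullet> r \<noteq> 0" and F: "F face_of ppd b p q r" and y: "y \<in> F" and z: "z \<in> ppd b p q r"
    and "0 < lco q r p (y - b) \<and> lco q r p (y - b) < 1 \<or> lco q r p (z - b) = lco q r p (y - b)"
    and "0 < lco r p q (y - b) \<and> lco r p q (y - b) < 1 \<or> lco r p q (z - b) = lco r p q (y - b)"
    and "0 < lco p q r (y - b) \<and> lco p q r (y - b) < 1 \<or> lco p q r (z - b) = lco p q r (y - b)"
  shows "z \<in> F"
proof (cases "z = y")
  case False
  have yS: "y \<in> ppd b p q r" using F y face_of_imp_subset by blast
  note yc = yS[unfolded ppd_iff[OF D]] and zc = z[unfolded ppd_iff[OF D]]
  obtain d1 where d1: "0 < d1" "\<And>\<epsilon>. 0 < \<epsilon> \<Longrightarrow> \<epsilon> \<le> d1 \<Longrightarrow> lco q r p (y - b)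
      + \<epsilon> * (lco q r p (y - b) - lco q r p (z - b)) \<in> {0..1}"
    using interval_overshoot yc zc assms(5) by blast
  obtain d2 where d2: "0 < d2" "\<And>\<epsilon>. 0 < \<epsilon> \<Longrightarrow> \<epsilon> \<le> d2 \<Longrightarrow> lco r p q (y - b)
      + \<epsilon> * (lco r p q (y - b) - lco r p q (z - b)) \<in> {0..1}"
    using interval_overshoot yc zc assms(6) by blast
  obtain d3 where d3: "0 < d3" "\<And>\<epsilon>. 0 < \<epsilon> \<Longrightarrow> \<epsilon> \<le> d3 \<Longrightarrow> lco p q r (y - b)
      + \<epsilon> * (lco p q r (y - b) - lco p q r (z - b)) \<in> {0..1}"
    using interval_overshoot yc zc assms(7) by blast
  define e where "e = min d1 (min d2 d3)"
  have e: "0 < e" "e \<le> d1" "e \<le> d2" "e \<le> d3" using d1 d2 d3 by (auto simp: e_def)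
  define w where "w = y + e *\<^sub>R (y - z)"
  have "w - b = (y - b) + e *\<^sub>R ((y - b) - (z - b))" by (simp add: w_def)
  then have "w \<in> ppd b p q r"
    unfolding ppd_iff[OF D] using d1(2)[OF e(1,2)] d2(2)[OF e(1,3)] d3(2)[OF e(1,4)]
        by (simp only: lco_linear)
  moreover have "y \<in> open_segment z w"
    unfolding in_segment
  proof (intro conjI exI[of _ "1 / (1 + e)"])
    show "z \<noteq> w"
    proof
      assume "z = w"
      then have "(1 + e) *\<^sub>R (y - z) = 0" by (simp add: w_def algebra_simps)
      then show False using False e by auto
    qed
    have "(1 + e) *\<^sub>R ((1 - 1 / (1 + e)) *\<^sub>R z + (1 / (1 + e)) *\<^sub>R w) = e *\<^sub>R z + w"
      using e by (simp add: algebra_simps add_divide_distrib flip: scaleR_add_left) (simp add: field_simps)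
    also have "\<dots> = (1 + e) *\<^sub>R y" by (simp add: w_def algebra_simps)
    finally show "y = (1 - 1 / (1 + e)) *\<^sub>R z + (1 / (1 + e)) *\<^sub>R w" using e by simp
  qed (use e in auto)
  ultimately show ?thesis using F y z unfolding face_of_def by blast
qed (use y in simp)

lemma face_of_ppd_interior:
  assumes D: "cross3 p q \<bullet> r \<noteq> 0" and F: "F face_of ppd b p q r" and y: "y \<in> F"
    and "0 < lco q r p (y - b)" "lco q r p (y - b) < 1"
    and "0 < lco r p q (y - b)" "lco r p q (y - b) < 1"
    and "0 < lco p q r (y - b)" "lco p q r (y - b) < 1"
  shows "F = ppd b p q r"
proof
  show "F \<subseteq> ppd b p q r" using F by (rule face_of_imp_subset)
  show "ppd b p q r \<subseteq> F" using face_of_ppd_spread[OF D F y] assms(4-) by blast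
qed

text \<open>If a coordinate were strictly between 0 and 1, the face \<open>{y}\<close> would also
  contain the point with that coordinate set to 0. Conversely, 0 and 1 are extreme in the unit
  interval, coordinate by coordinate.\<close>

lemma extreme_point_of_ppd:
  assumes D: "cross3 p q \<bullet> r \<noteq> 0"
  shows "y extreme_point_of ppd b p q r \<longleftrightarrow>
    (\<exists>s\<in>{0,1}. \<exists>t\<in>{0,1}. \<exists>u\<in>{0,1}. y = b + s *\<^sub>R p + t *\<^sub>R q + u *\<^sub>R r)"
proof
  assume ext: "y extreme_point_of ppd b p q r"
  then have F: "{y} face_of ppd b p q r" by (simp add: face_of_singleton)
  have yS: "y \<in> ppd b p q r" using ext by (simp add: extreme_point_of_def)
  note yc = yS[unfolded ppd_iff[OF D]]
  have y: "y - b = lco q r p (y - b) *\<^sub>R p + lco r p q (y - b) *\<^sub>R q + lco p q r (y - b) *\<^sub>R r"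
    by (rule lco_expand[OF D])
  have nz: "p \<noteq> 0" "q \<noteq> 0" "r \<noteq> 0" using D by auto
  have "lco q r p (y - b) \<in> {0,1}"
  proof (rule ccontr)
    assume "lco q r p (y - b) \<notin> {0,1}"
    then have c: "0 < lco q r p (y - b)" "lco q r p (y - b) < 1" using yc by (auto simp del: lco_linear)
    have zc: "lco q r p (y - lco q r p (y - b) *\<^sub>R p - b) = 0"
      "lco r p q (y - lco q r p (y - b) *\<^sub>R p - b) = lco r p q (y - b)"
      "lco p q r (y - lco q r p (y - b) *\<^sub>R p - b) = lco p q r (y - b)"
      by (simp_all add: lco_all_basis[OF D])
    have "y - lco q r p (y - b) *\<^sub>R p \<in> ppd b p q r"
      unfolding ppd_iff[OF D] zc using yc by simp
    from face_of_ppd_spread[OF D F singletonI this disjI1[OF conjI[OF c]] disjI2[OF zc(2)]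
        disjI2[OF zc(3)]] show False
      using c nz by (auto simp del: lco_linear)
  qed
  moreover have "lco r p q (y - b) \<in> {0,1}"
  proof (rule ccontr)
    assume "lco r p q (y - b) \<notin> {0,1}"
    then have c: "0 < lco r p q (y - b)" "lco r p q (y - b) < 1" using yc by (auto simp del: lco_linear)
    have zc: "lco q r p (y - lco r p q (y - b) *\<^sub>R q - b) = lco q r p (y - b)"
      "lco r p q (y - lco r p q (y - b) *\<^sub>R q - b) = 0"
      "lco p q r (y - lco r p q (y - b) *\<^sub>R q - b) = lco p q r (y - b)"
      by (simp_all add: lco_all_basis[OF D])
    have "y - lco r p q (y - b) *\<^sub>R q \<in> ppd b p q r"
      unfolding ppd_iff[OF D] zc using yc by simp
    from face_of_ppd_spread[OF D F singletonI this disjI2[OF zc(1)] disjI1[OF conjI[OF c]]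
        disjI2[OF zc(3)]] show False
      using c nz by (auto simp del: lco_linear)
  qed
  moreover have "lco p q r (y - b) \<in> {0,1}"
  proof (rule ccontr)
    assume "lco p q r (y - b) \<notin> {0,1}"
    then have c: "0 < lco p q r (y - b)" "lco p q r (y - b) < 1" using yc by (auto simp del: lco_linear)
    have zc: "lco q r p (y - lco p q r (y - b) *\<^sub>R r - b) = lco q r p (y - b)"
      "lco r p q (y - lco p q r (y - b) *\<^sub>R r - b) = lco r p q (y - b)"
      "lco p q r (y - lco p q r (y - b) *\<^sub>R r - b) = 0"
      by (simp_all add: lco_all_basis[OF D])
    have "y - lco p q r (y - b) *\<^sub>R r \<in> ppd b p q r"
      unfolding ppd_iff[OF D] zc using yc by simp
    from face_of_ppd_spread[OF D F singletonI this disjI2[OF zc(1)] disjI2[OF zc(2)]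
        disjI1[OF conjI[OF c]]] show False
      using c nz by (auto simp del: lco_linear)
  qed
  moreover have "y = b + lco q r p (y - b) *\<^sub>R p + lco r p q (y - b) *\<^sub>R q + lco p q r (y - b) *\<^sub>R r"
    using arg_cong[OF y, of "\<lambda>x. b + x"] by (simp add: add.assoc del: lco_linear)
  ultimately show "\<exists>s\<in>{0,1}. \<exists>t\<in>{0,1}. \<exists>u\<in>{0,1}. y = b + s *\<^sub>R p + t *\<^sub>R q + u *\<^sub>R r" by blast
next
  assume "\<exists>s\<in>{0,1}. \<exists>t\<in>{0,1}. \<exists>u\<in>{0,1}. y = b + s *\<^sub>R p + t *\<^sub>R q + u *\<^sub>R r"
  then obtain s t u where stu: "s \<in> {0,1}" "t \<in> {0,1}" "u \<in> {0,1}" "y = b + s *\<^sub>R p + t *\<^sub>R q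
      + u *\<^sub>R r" by blast
  have yc: "lco q r p (y - b) = s" "lco r p q (y - b) = t" "lco p q r (y - b) = u"
    using stu(4) by (simp_all add: lco_all_basis[OF D])
  have end01: "c = d" if "c \<in> {0..1}" "d \<in> {0..1}" "(1 - w) * c + w * d \<in> {0,1}" "0 < w" "w < 1"
      for c d w :: real
  proof -
    have "(1 - w) * c + w * d = 0 \<or> (1 - w) * (1 - c) + w * (1 - d) = 0"
      using that(3) by (auto simp: algebra_simps)
    then show ?thesis using that
      by (elim disjE; subst (asm) add_nonneg_eq_0_iff) auto
  qed
  show "y extreme_point_of ppd b p q r"
    unfolding extreme_point_of_def
  proof (intro conjI ballI notI)
    show "y \<in> ppd b p q r" unfolding ppd_iff[OF D] yc using stu by auto
    fix a c assume a: "a \<in> ppd b p q r" and c: "c \<in> ppd b p q r" and "y \<in> open_segment a c"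
    then obtain w where w: "a \<noteq> c" "0 < w" "w < 1" "y = (1 - w) *\<^sub>R a + w *\<^sub>R c"
        by (auto simp: in_segment)
    have yb: "y - b = (1 - w) *\<^sub>R (a - b) + w *\<^sub>R (c - b)" using w(4) by (simp add: algebra_simps)
    note ac = a[unfolded ppd_iff[OF D]] c[unfolded ppd_iff[OF D]]
    have cv: "lco p' q' r' (y - b) = (1 - w) * lco p' q' r' (a - b) + w * lco p' q' r' (c - b)"
        for p' q' r'
      unfolding yb by (simp only: lco_linear)
    have "lco q r p (a - b) = lco q r p (c - b)"
    proof (rule end01[of _ _ w])
      show "(1 - w) * lco q r p (a - b) + w * lco q r p (c - b) \<in> {0,1}"
        unfolding cv[symmetric] yc by (rule stu)
    qed (use ac w in blast)+
    moreover have "lco r p q (a - b) = lco r p q (c - b)"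
    proof (rule end01[of _ _ w])
      show "(1 - w) * lco r p q (a - b) + w * lco r p q (c - b) \<in> {0,1}"
        unfolding cv[symmetric] yc by (rule stu)
    qed (use ac w in blast)+
    moreover have "lco p q r (a - b) = lco p q r (c - b)"
    proof (rule end01[of _ _ w])
      show "(1 - w) * lco p q r (a - b) + w * lco p q r (c - b) \<in> {0,1}"
        unfolding cv[symmetric] yc by (rule stu)
    qed (use ac w in blast)+
    ultimately have "a - b = c - b" using lco_expand[OF D] by metis
    with w(1) show False by simp
  qed
qed

lemma aff_dim_ppd: 
  assumes D: "cross3 p q \<bullet> r \<noteq> 0"
  shows "\<not> aff_dim (ppd b p q r) \<le> 1"
proof
  assume "aff_dim (ppd b p q r) \<le> 1"
  then have "collinear (ppd b p q r)" by (simp add: collinear_aff_dim)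
  moreover have m: "b \<in> ppd b p q r" "b + p \<in> ppd b p q r" "b + q \<in> ppd b p q r"
    by (simp_all add: ppd_iff[OF D] lco_all_basis[OF D])
  ultimately obtain u where u: "\<And>x y. x \<in> ppd b p q r \<Longrightarrow> y \<in> ppd b p q r \<Longrightarrow> \<exists>c. x - y = c *\<^sub>R u"
    unfolding collinear_def by blast
  obtain c d where "p = c *\<^sub>R u" "q = d *\<^sub>R u" using u[OF m(2,1)] u[OF m(3,1)] by auto
  then have "cross3 p q = 0" by (simp add: cross_mult_left cross_mult_right)
  with D show False by simp
qed

text \<open>Vertex, edge and facet are merged into one case, a proper face. For vertex and edge,
  properness is a matter of dimension.\<close>

lemma face_to_face_ppd:
  assumes D: "cross3 p q \<bullet> r \<noteq> 0" and S: "S = ppd b p q r" and ff: "face_to_face S S'" "S \<inter> S' \<noteq> {}"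
  shows "S \<inter> S' face_of S" "S \<inter> S' \<noteq> S"
proof -
  consider x where "S \<inter> S' = {x}" "x extreme_point_of S" | "S \<inter> S' edge_of S" | "S \<inter> S' facet_of S"
    using ff unfolding face_to_face_def by blast
  then have "S \<inter> S' face_of S \<and> S \<inter> S' \<noteq> S"
  proof cases
    case 1
    have "S \<noteq> {x}" using aff_dim_ppd[OF D, of b] by (auto simp: S)
    then show ?thesis using 1 by (simp add: face_of_singleton)
  next
    case 2
    then show ?thesis using aff_dim_ppd[OF D, of b] by (auto simp: S edge_of_def)
  next
    case 3
    then show ?thesis by (auto simp: facet_of_def)
  qed
  then show "S \<inter> S' face_of S" "S \<inter> S' \<noteq> S" by auto
qed

section \<open>Tiles, worms and neighbours\<close>

lemma ico_eq_icog: "ico i = icog \<phi> i"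
  by (simp add: ico_def icog_def)

lemma det_phi_pos:
  assumes "distinct [i, j, k]"
  shows "3 < cross3 (icog \<phi> i) (icog \<phi> j) \<bullet> wv \<phi> i j k"
  using wv_nrm[OF golden_root(1) assms] golden_bounds by (simp add: nrm_def inner_commute)

lemma det_phi_ne:
  assumes "distinct [i, j, k]"
  shows "cross3 (icog \<phi> i) (icog \<phi> j) \<bullet> icog \<phi> k \<noteq> 0"
  using det_eq[OF golden_root(1) assms] orient_eq[OF assms] golden_bounds by (auto simp: nrm_def)

lemma det_phi_zero_iff:
  assumes "l \<noteq> m" "cross3 (icog \<phi> l) (icog \<phi> m) \<bullet> icog \<phi> i = 0"
  shows "i \<in> {l, m}"
  using det_phi_ne[of l m i] assms by auto

definition tile :: "6 \<Rightarrow> 6 \<Rightarrow> 6 \<Rightarrow> real ^ 3 \<Rightarrow> (real ^ 3) set" where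
  "tile i j k b = ppd b (icog \<phi> i) (icog \<phi> j) (wv \<phi> i j k)"

lemma translate_rhombohedron:
  "(\<lambda>y. x + y) ` rhombohedron i j k = ppd x (icog \<phi> i) (icog \<phi> j) (icog \<phi> k)"
proof -
  have "rhombohedron i j k = ppd 0 (icog \<phi> i) (icog \<phi> j) (icog \<phi> k)"
    unfolding rhombohedron_def ppd_def ico_eq_icog by (rule Collect_cong) auto
  then show ?thesis by (metis ppd_eq_image)
qed

lemma wv_cases: "distinct [i, j, k] \<Longrightarrow> wv g i j k = icog g k \<and> orient i j k = 1 \<or> wv g i j k
    = - icog g k \<and> orient i j k = -1"
  using orient_eq[of i j k] by (auto simp: wv_def)

lemma tile_of_ppd:
  assumes "distinct [i, j, k]"
  obtains b where "ppd x (icog \<phi> i) (icog \<phi> j) (icog \<phi> k) = tile i j k b" "norm (b - x) \<le> 2"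
proof (cases "orient i j k = 1")
  case True
  then show thesis using that[of x] by (simp add: tile_def wv_def)
next
  case False
  then have w: "wv \<phi> i j k = - icog \<phi> k" using wv_cases[OF assms] by auto
  have "tile i j k (x + icog \<phi> k) = ppd x (icog \<phi> i) (icog \<phi> j) (icog \<phi> k)"
    by (simp add: tile_def w ppd_flip)
  moreover have "norm (icog \<phi> k) \<le> 2" using golden_bounds by (intro norm_icog) auto
  ultimately show thesis using that[of "x + icog \<phi> k"] by simp
qed

lemma ppd_of_tile:
  assumes "distinct [i, j, k]"
  obtains x where "tile i j k b = ppd x (icog \<phi> i) (icog \<phi> j) (icog \<phi> k)" "norm (x - b) \<le> 2"
    "x = b \<and> orient i j k = 1 \<or> x = b - icog \<phi> k \<and> orient i j k = - 1"
proof (cases "orient i j k = 1")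
  case True
  then show thesis using that[of b] by (simp add: tile_def wv_def)
next
  case False
  then have w: "wv \<phi> i j k = - icog \<phi> k" "orient i j k = -1" using wv_cases[OF assms] by auto
  have "tile i j k b = ppd (b - icog \<phi> k) (icog \<phi> i) (icog \<phi> j) (icog \<phi> k)"
    using ppd_flip[of "b - icog \<phi> k" "icog \<phi> k"] by (simp add: tile_def w)
  moreover have "norm (icog \<phi> k) \<le> 2" using golden_bounds by (intro norm_icog) auto
  ultimately show thesis using that[of "b - icog \<phi> k"] w by simp
qed

text \<open>The cross product has norm at most 4 and 4 * (3/8) / 3 = 1/2, so the ball of radius 3/8
  about the centre of a tile stays inside it.\<close>

lemma lco_small:
  assumes pqr: "norm p \<le> 2" "norm q \<le> 2" and D: "3 < \<bar>cross3 p q \<bullet> r\<bar>" and y: "norm y < 3/8"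
  shows "\<bar>lco p q r y\<bar> < 1/2"
proof -
  have "(norm (cross3 p q))\<^sup>2 \<le> (norm p * norm q)\<^sup>2"
    using norm_cross_dot[of p q] by (smt (verit) zero_le_power2)
  then have "norm (cross3 p q) \<le> norm p * norm q" by (rule power2_le_imp_le) simp
  also have "\<dots> \<le> 2 * 2" using pqr by (intro mult_mono) auto
  finally have c: "norm (cross3 p q) \<le> 4" by simp
  have "\<bar>cross3 p q \<bullet> y\<bar> \<le> norm (cross3 p q) * norm y" by (rule Cauchy_Schwarz_ineq2)
  also have "\<dots> \<le> 4 * norm y" using c by (intro mult_right_mono) auto
  also have "\<dots> < 3/2" using y by simp
  finally have "\<bar>cross3 p q \<bullet> y\<bar> < 3/2" .
  then show ?thesis using D by (simp add: lco_def divide_simps)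
qed

lemma relpow_subset:
  fixes R S :: "('a \<times> 'a) set"
  shows "R \<subseteq> S \<Longrightarrow> R ^^ n \<subseteq> S ^^ n"
  by (induction n) (auto simp: relcomp_mono)

locale golden =
  fixes \<T> :: "(real ^ 3) set set"
  assumes golden: "golden_tiling \<T>"
begin

definition T :: "6 \<Rightarrow> 6 \<Rightarrow> 6 \<Rightarrow> real ^ 3 \<Rightarrow> bool" where
  "T i j k b \<longleftrightarrow> distinct [i, j, k] \<and> tile i j k b \<in> \<T>"

lemma tile_ppd:
  assumes "S \<in> \<T>"
  obtains x i j k where "distinct [i, j, k]" "S = ppd x (icog \<phi> i) (icog \<phi> j) (icog \<phi> k)"
proof -
  obtain i j k where "distinct [i, j, k]" "translate_of S (rhombohedron i j k)"
    using golden[unfolded golden_tiling_def, THEN conjunct1, rule_format, OF assms] by (elim exE conjE)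
  moreover from this obtain x where "S = ppd x (icog \<phi> i) (icog \<phi> j) (icog \<phi> k)"
    by (auto simp only: translate_of_def translate_rhombohedron)
  ultimately show thesis using that by blast
qed

lemma tile_T:
  assumes "S \<in> \<T>"
  obtains b i j k where "T i j k b" "S = tile i j k b"
proof -
  obtain x i j k where *: "distinct [i, j, k]" "S = ppd x (icog \<phi> i) (icog \<phi> j) (icog \<phi> k)"
    using tile_ppd[OF assms] .
  obtain b where "S = tile i j k b" using tile_of_ppd[OF *(1), of x] *(2) by metis
  with * assms that[of i j k b] show thesis by (simp add: T_def)
qed

lemma cover: "\<exists>S\<in>\<T>. x \<in> S"
  using golden[unfolded golden_tiling_def, THEN conjunct2, THEN conjunct1] by (metis UNIV_I UnionE)

lemma ftf: "S \<in> \<T> \<Longrightarrow> S' \<in> \<T> \<Longrightarrow> S \<noteq> S' \<Longrightarrow> face_to_face S S'"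
  using golden[unfolded golden_tiling_def, THEN conjunct2, THEN conjunct2] by simp

lemma proper_face:
  assumes "S \<in> \<T>" "S' \<in> \<T>" "S \<noteq> S'" "S \<inter> S' \<noteq> {}"
  shows "S \<inter> S' face_of S" "S \<inter> S' \<noteq> S" "S \<inter> S' face_of S'" "S \<inter> S' \<noteq> S'"
proof -
  have *: "S \<inter> S' face_of S \<and> S \<inter> S' \<noteq> S" if S: "S \<in> \<T>" "S' \<in> \<T>" "S \<noteq> S'" "S \<inter> S' \<noteq> {}" for S S'
  proof -
    obtain x i j k where "distinct [i, j, k]" "S = ppd x (icog \<phi> i) (icog \<phi> j) (icog \<phi> k)"
      using tile_ppd[OF S(1)] .
    then show ?thesis using face_to_face_ppd[OF det_phi_ne _ ftf[OF S(1-3)] S(4)] by blast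
  qed
  from *[OF assms] *[of S' S] assms
  show "S \<inter> S' face_of S" "S \<inter> S' \<noteq> S" "S \<inter> S' face_of S'" "S \<inter> S' \<noteq> S'"
    by (auto simp: Int_commute)
qed

lemma closed_tile: "S \<in> \<T> \<Longrightarrow> closed S"
  by (metis tile_ppd compact_ppd compact_imp_closed)

section \<open>Local finiteness and chains of adjacent tiles\<close>

definition centre_of :: "(real ^ 3) set \<Rightarrow> real ^ 3 \<Rightarrow> bool" where
  "centre_of S c \<longleftrightarrow> (\<exists>i j k. distinct [i, j, k] \<and>
     S = ppd (c - (1/2) *\<^sub>R (icog \<phi> i + icog \<phi> j + icog \<phi> k)) (icog \<phi> i) (icog \<phi> j) (icog \<phi> k))"

lemma ex_centre: "S \<in> \<T> \<Longrightarrow> \<exists>c. centre_of S c"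
proof -
  assume "S \<in> \<T>"
  then obtain x i j k where *: "distinct [i, j, k]" "S = ppd x (icog \<phi> i) (icog \<phi> j) (icog \<phi> k)"
    by (rule tile_ppd)
  have "x = (x + (1/2) *\<^sub>R (icog \<phi> i + icog \<phi> j + icog \<phi> k)) - (1/2) *\<^sub>R (icog \<phi> i + icog \<phi> j
      + icog \<phi> k)"
    by simp
  with * show ?thesis unfolding centre_of_def by metis
qed

lemma centre_dist:
  assumes "centre_of S c" "y \<in> S"
  shows "norm (y - c) \<le> 3"
proof -
  obtain i j k s t u where y: "y = c - (1/2) *\<^sub>R (icog \<phi> i + icog \<phi> j + icog \<phi> k) + s *\<^sub>R icog \<phi> i
      + t *\<^sub>R icog \<phi> j + u *\<^sub>R icog \<phi> k"
    and stu: "s \<in> {0..1}" "t \<in> {0..1}" "u \<in> {0..1}"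
    using assms unfolding centre_of_def ppd_def by blast
  have b: "norm ((s - 1/2) *\<^sub>R icog \<phi> i) \<le> 1/2 * 2" if "s \<in> {0..1}" for s i
  proof -
    have "\<bar>s - 1/2\<bar> \<le> 1/2" unfolding abs_le_iff using that by auto
    then show ?thesis unfolding norm_scaleR using golden_bounds by (intro mult_mono norm_icog) auto
  qed
  have "y - c = (s - 1/2) *\<^sub>R icog \<phi> i + (t - 1/2) *\<^sub>R icog \<phi> j + (u - 1/2) *\<^sub>R icog \<phi> k"
    unfolding y by (simp add: algebra_simps)
  then show ?thesis
    using norm_triangle_mono[OF norm_triangle_mono[OF b[OF stu(1)] b[OF stu(2)]] b[OF stu(3)],
        of i j k] by simp
qed

lemma centre_coordinates:
  assumes "centre_of S c" "norm (y - c) < 3/8"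
  obtains b p q r where "cross3 p q \<bullet> r \<noteq> 0" "S = ppd b p q r"
    "0 < lco q r p (y - b)" "lco q r p (y - b) < 1" "0 < lco r p q (y - b)" "lco r p q (y - b) < 1"
    "0 < lco p q r (y - b)" "lco p q r (y - b) < 1"
proof -
  obtain i j k where d: "distinct [i, j, k]"
    and S: "S = ppd (c - (1/2) *\<^sub>R (icog \<phi> i + icog \<phi> j + icog \<phi> k)) (icog \<phi> i) (icog \<phi> j) (icog \<phi> k)"
      (is "S = ppd ?b ?p ?q ?r")
    using assms(1) unfolding centre_of_def by blast
  have D: "cross3 ?p ?q \<bullet> ?r \<noteq> 0" by (rule det_phi_ne[OF d])
  have n: "norm (icog \<phi> l) \<le> 2" for l using golden_bounds by (intro norm_icog) auto
  have D3: "3 < \<bar>cross3 (icog \<phi> l) (icog \<phi> m) \<bullet> icog \<phi> n\<bar>" if "distinct [l, m, n]" for l m n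
    using det_phi_pos[OF that] wv_cases[OF that, of \<phi>] by auto
  have yb: "y - ?b = (y - c) + (1/2) *\<^sub>R ?p + (1/2) *\<^sub>R ?q + (1/2) *\<^sub>R ?r" by (simp add: algebra_simps)
  have c1: "\<bar>lco ?q ?r ?p (y - c)\<bar> < 1/2" "\<bar>lco ?r ?p ?q (y - c)\<bar> < 1/2" "\<bar>lco ?p ?q ?r (y - c)\<bar> < 1/2"
    by (rule lco_small[OF n n D3 assms(2)]; use d in auto)+
  have eq: "lco ?q ?r ?p (y - ?b) = lco ?q ?r ?p (y - c) + 1/2"
    "lco ?r ?p ?q (y - ?b) = lco ?r ?p ?q (y - c) + 1/2"
    "lco ?p ?q ?r (y - ?b) = lco ?p ?q ?r (y - c) + 1/2"
    unfolding yb lco_linear(1,4) by (simp_all add: lco_all_basis[OF D] del: lco_linear)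
  show thesis by (rule that[OF D S]; unfold eq; use c1 in linarith)
qed

lemma centre_interior:
  assumes "centre_of S c" "F face_of S" "c \<in> F"
  shows "F = S"
proof -
  have "norm (c - c) < 3/8" by simp
  from centre_coordinates[OF assms(1) this] show ?thesis
    using face_of_ppd_interior assms(2,3) by metis
qed

lemma ball_subset_tile:
  assumes "centre_of S c" "norm (y - c) < 3/8"
  shows "y \<in> S"
proof -
  obtain b p q r where *: "cross3 p q \<bullet> r \<noteq> 0" "S = ppd b p q r"
    "0 < lco q r p (y - b)" "lco q r p (y - b) < 1" "0 < lco r p q (y - b)" "lco r p q (y - b) < 1"
    "0 < lco p q r (y - b)" "lco p q r (y - b) < 1"
    by (rule centre_coordinates[OF assms])
  then show ?thesis unfolding *(2) ppd_iff[OF *(1)] by (simp del: lco_linear)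
qed

text \<open>Otherwise the centre of \<open>S\<close> lies in \<open>S'\<close>, and the face
  \<open>S \<inter> S'\<close> of \<open>S\<close> contains an interior point of \<open>S\<close>,
  which makes it all of \<open>S\<close>.\<close>

lemma centres_separated:
  assumes "S \<in> \<T>" "S' \<in> \<T>" "centre_of S c" "centre_of S' c'" "norm (c - c') < 3/8"
  shows "S = S'"
proof (rule ccontr)
  assume "S \<noteq> S'"
  have "norm (c - c) < 3/8" by simp
  then have "c \<in> S \<inter> S'" using ball_subset_tile assms(3-5) by blast
  then show False
    using centre_interior[OF assms(3)] proper_face(1,2)[OF assms(1,2) \<open>S \<noteq> S'\<close>] by blast
qed

lemma locally_finite:
  obtains N where "\<And>z. finite {S \<in> \<T>. S \<inter> cball z r \<noteq> {}}" "\<And>z. card {S \<in> \<T>. S \<inter> cball z r \<noteq> {}} \<le> N"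
proof -
  \<comment> \<open>One cover about 0 is translated to every \<open>z\<close>, which makes the count
    uniform. A tile meeting the ball has its centre within \<open>r + 3\<close>, and balls of radius
    3/16 hold at most one centre.\<close>
  have "\<exists>k. finite k \<and> cball (0 :: real ^ 3) (r + 3) \<subseteq> (\<Union>x\<in>k. ball x (3/16))"
    using compact_cball[of "0 :: real ^ 3" "r + 3"] unfolding compact_eq_totally_bounded
        by (meson zero_less_divide_iff zero_less_numeral)
  then obtain P where P: "finite P" "cball (0 :: real ^ 3) (r + 3) \<subseteq> (\<Union>x\<in>P. ball x (3/16))" by blast
  have inj: "\<exists>f. inj_on f {S \<in> \<T>. S \<inter> cball z r \<noteq> {}} \<and> f ` {S \<in> \<T>. S \<inter> cball z r \<noteq> {}} \<subseteq> P" for z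
  proof -
    let ?A = "{S \<in> \<T>. S \<inter> cball z r \<noteq> {}}"
    have "\<forall>S\<in>?A. \<exists>x. x \<in> P \<and> (\<exists>c. centre_of S c \<and> norm (c - z - x) < 3/16)"
    proof
      fix S assume "S \<in> ?A"
      then obtain y where y: "S \<in> \<T>" "y \<in> S" "norm (y - z) \<le> r"
          by (auto simp: dist_norm norm_minus_commute)
      obtain c where c: "centre_of S c" using ex_centre[OF y(1)] by blast
      have "norm (c - z) \<le> r + 3"
        using norm_diff_mono[OF y(3) centre_dist[OF c y(2)]] by (simp add: algebra_simps)
      then have "c - z \<in> cball 0 (r + 3)" by simp
      then obtain x where "x \<in> P" "c - z \<in> ball x (3/16)" using P(2) by blast
      then show "\<exists>x. x \<in> P \<and> (\<exists>c. centre_of S c \<and> norm (c - z - x) < 3/16)"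
        using c by (auto simp: dist_norm norm_minus_commute)
    qed
    from bchoice[OF this] obtain f where
      f: "\<forall>S\<in>?A. f S \<in> P \<and> (\<exists>c. centre_of S c \<and> norm (c - z - f S) < 3/16)" ..
    have "inj_on f ?A"
    proof (rule inj_onI)
      fix S S' assume *: "S \<in> ?A" "S' \<in> ?A" "f S = f S'"
      obtain c where c: "centre_of S c" "norm (c - z - f S) < 3/16" using bspec[OF f *(1)] by blast
      obtain c' where c': "centre_of S' c'" "norm (c' - z - f S) < 3/16" using bspec[OF f *(2)] *(3)
          by auto
      have "norm (c - c') < 3/8"
        using norm_triangle_ineq4[of "c - z - f S" "c' - z - f S"] c(2) c'(2) by simp
      then show "S = S'" using centres_separated c c' * by blast
    qed
    moreover have "f ` ?A \<subseteq> P" using f by (intro image_subsetI) simp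
    ultimately show ?thesis by (intro exI conjI)
  qed
  have "finite {S \<in> \<T>. S \<inter> cball z r \<noteq> {}} \<and> card {S \<in> \<T>. S \<inter> cball z r \<noteq> {}} \<le> card P" for z
  proof -
    obtain f where "inj_on f {S \<in> \<T>. S \<inter> cball z r \<noteq> {}}" "f ` {S \<in> \<T>. S \<inter> cball z r \<noteq> {}} \<subseteq> P"
      using inj[of z] by blast
    then show ?thesis using inj_on_finite[OF _ _ P(1)] card_inj_on_le[OF _ _ P(1)] by (intro conjI)
  qed
  then show thesis using that by blast
qed

definition adj :: "((real ^ 3) set \<times> (real ^ 3) set) set" where
  "adj = {(S, S'). S \<in> \<T> \<and> S' \<in> \<T> \<and> S \<inter> S' \<noteq> {}}"

text \<open>The finitely many closed tiles near the segment cover it. If \<open>S'\<close> could not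
  be reached from \<open>S\<close>, the reachable and the unreachable ones would disconnect the
  segment. The length is bounded by the number of adjacent pairs.\<close>

lemma tile_chain:
  obtains N where "\<And>S S' x y. S \<in> \<T> \<Longrightarrow> S' \<in> \<T> \<Longrightarrow> x \<in> S \<Longrightarrow> y \<in> S' \<Longrightarrow> norm (y - x) \<le> r \<Longrightarrow>
      \<exists>n\<le>N. (S, S') \<in> adj ^^ n"
proof -
  obtain N where N: "\<And>z. finite {S \<in> \<T>. S \<inter> cball z r \<noteq> {}}" "\<And>z. card {S \<in> \<T>. S \<inter> cball z r \<noteq> {}} \<le> N"
    using locally_finite by blast
  have "\<exists>n\<le>N * N. (S, S') \<in> adj ^^ n" if S: "S \<in> \<T>" "S' \<in> \<T>" "x \<in> S" "y \<in> S'" "norm (y - x) \<le> r"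
      for S S' x y
  proof -
    define A where "A = {S \<in> \<T>. S \<inter> cball x r \<noteq> {}}"
    define R where "R = adj \<inter> A \<times> A"
    have A\<T>: "B \<in> \<T>" if "B \<in> A" for B using that by (simp add: A_def)
    have finA: "finite A" and cardA: "card A \<le> N" using N by (auto simp: A_def)
    have finR: "finite R" using finA by (auto simp: R_def)
    have "0 \<le> r" using S(5) norm_ge_zero order_trans by blast
    have xy: "closed_segment x y \<subseteq> cball x r"
      using S(5) \<open>0 \<le> r\<close> by (intro closed_segment_subset) (auto simp: dist_norm norm_minus_commute)
    have SA: "S \<in> A" "S' \<in> A"
      using S xy \<open>0 \<le> r\<close> by (auto simp: A_def)
    have "(S, S') \<in> R\<^sup>*"
    proof (rule ccontr)
      assume no: "(S, S') \<notin> R\<^sup>*"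
      let ?X = "\<Union>{B \<in> A. (S, B) \<in> R\<^sup>*}" and ?Y = "\<Union>{B \<in> A. (S, B) \<notin> R\<^sup>*}"
      have "closed ?X" "closed ?Y"
        using finA closed_tile by (auto intro!: closed_Union dest: A\<T>)
      moreover have "closed_segment x y \<subseteq> ?X \<union> ?Y"
      proof
        fix p assume "p \<in> closed_segment x y"
        moreover obtain B where "B \<in> \<T>" "p \<in> B" using cover by blast
        ultimately have "B \<in> A" using xy by (auto simp: A_def)
        with \<open>p \<in> B\<close> show "p \<in> ?X \<union> ?Y" by blast
      qed
      moreover have "?X \<inter> ?Y = {}"
      proof (rule ccontr)
        assume "?X \<inter> ?Y \<noteq> {}"
        then obtain B B' p where B: "B \<in> A" "(S, B) \<in> R\<^sup>*" "B' \<in> A" "(S, B') \<notin> R\<^sup>*" "p \<in> B" "p \<in> B'"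
            by blast
        then have "(B, B') \<in> R" by (auto simp: R_def adj_def A_def)
        with B show False by (meson rtrancl.rtrancl_into_rtrancl)
      qed
      moreover have "x \<in> ?X" using S(3) SA by blast
      moreover have "y \<in> ?Y" using S(4) SA no by blast
      ultimately show False
        using connected_segment(1)[of x y] unfolding connected_closed
        by (metis (no_types, lifting) disjoint_iff ends_in_segment(1,2) inf_bot_left inf.assoc)
    qed
    then obtain n where n: "n \<le> card R" "(S, S') \<in> R ^^ n"
      using rtrancl_finite_eq_relpow[OF finR] by auto
    have "card R \<le> card (A \<times> A)" using finA by (intro card_mono) (auto simp: R_def)
    also have "\<dots> \<le> N * N" using cardA by (simp add: card_cartesian_product mult_mono)
    finally have "n \<le> N * N" using n(1) by simp
    moreover have "(S, S') \<in> adj ^^ n" using n(2) relpow_subset[of R adj n] by (auto simp: R_def)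
    ultimately show ?thesis by blast
  qed
  then show thesis by (rule that)
qed

lemma T_flip: "T i j k b \<Longrightarrow> T j i k (b + wv \<phi> i j k)"
  using ppd_flip[of b "wv \<phi> i j k" "icog \<phi> j" "icog \<phi> i"]
  by (auto simp: T_def tile_def wv_swap[of _ j i] ppd_swap)

lemma T_turn: "T i j k b \<Longrightarrow> \<exists>b'. norm (b' - b) \<le> 8 \<and> T i k j b'"
proof -
  assume T: "T i j k b"
  then obtain x where x: "tile i j k b = ppd x (icog \<phi> i) (icog \<phi> j) (icog \<phi> k)" "norm (x - b) \<le> 2"
    using ppd_of_tile[of i j k b] by (auto simp: T_def)
  have d: "distinct [i, k, j]" using T by (auto simp: T_def)
  have "ppd x (icog \<phi> i) (icog \<phi> j) (icog \<phi> k) = ppd x (icog \<phi> i) (icog \<phi> k) (icog \<phi> j)"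
    by (metis ppd_swap ppd_rotate)
  then obtain b' where b': "tile i j k b = tile i k j b'" "norm (b' - x) \<le> 2"
    using tile_of_ppd[OF d, of x] x(1) by metis
  have "norm (b' - b) \<le> 2 + 2" using norm_triangle_mono[OF b'(2) x(2)] by simp
  with T b' d show ?thesis by (intro exI[of _ b']) (auto simp: T_def)
qed

text \<open>By local finiteness the nearby tiles that avoid \<open>m\<close> keep a positive
  distance from it, so a tile covering a point just beyond \<open>m\<close> contains
  \<open>m\<close>.\<close>

lemma tile_adjacent_point:
  assumes "S \<in> \<T>" "m \<in> S" and out: "\<And>u. 0 < u \<Longrightarrow> m + u *\<^sub>R r \<notin> S"
  obtains S' where "S' \<in> \<T>" "S' \<noteq> S" "m \<in> S'"
proof -
  obtain N where "\<And>z. finite {S \<in> \<T>. S \<inter> cball z (norm r) \<noteq> {}}" using locally_finite by blast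
  then have fin: "finite {S' \<in> \<T>. S' \<inter> cball m (norm r) \<noteq> {} \<and> m \<notin> S'}" (is "finite ?G")
    by (rule rev_finite_subset) auto
  have "closed (\<Union>?G)" using fin closed_tile by (intro closed_Union) auto
  moreover have "m \<notin> \<Union>?G" by blast
  ultimately obtain e where e: "0 < e" "ball m e \<inter> \<Union>?G = {}"
    by (meson disjoint_iff open_Compl open_contains_ball ComplI ComplD subsetD)
  define u where "u = min 1 (e / (2 * (norm r + 1)))"
  have u: "0 < u" "u \<le> 1" using e by (auto simp: u_def add_nonneg_pos)
  have "u * norm r \<le> (e / (2 * (norm r + 1))) * norm r" by (intro mult_right_mono) (auto simp: u_def)
  also have "\<dots> < e" using e by (simp add: divide_simps add_nonneg_pos)
  finally have "m + u *\<^sub>R r \<in> ball m e" using u by (simp add: dist_norm)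
  moreover have "m + u *\<^sub>R r \<in> cball m (norm r)"
    using u by (simp add: dist_norm mult_left_le_one_le)
  moreover obtain S' where S': "S' \<in> \<T>" "m + u *\<^sub>R r \<in> S'" using cover by blast
  ultimately have "m \<in> S'" using e(2) by blast
  moreover have "S' \<noteq> S" using S' out[OF u(1)] by blast
  ultimately show thesis using S' that by blast
qed

end

lemma small_perturbation:
  fixes a x :: real
  assumes "0 < a" "a < 1"
  obtains \<delta> where "0 < \<delta>" "\<And>\<epsilon>. 0 < \<epsilon> \<Longrightarrow> \<epsilon> \<le> \<delta> \<Longrightarrow> a - \<epsilon> * x \<in> {0..1}"
proof
  let ?\<delta> = "min a (1 - a) / (\<bar>x\<bar> + 1)"
  show "0 < ?\<delta>" using assms by simp
  show "a - \<epsilon> * x \<in> {0..1}" if "0 < \<epsilon>" "\<epsilon> \<le> ?\<delta>" for \<epsilon>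
  proof -
    have "\<bar>\<epsilon> * x\<bar> \<le> ?\<delta> * (\<bar>x\<bar> + 1)"
      unfolding abs_mult using that by (intro mult_mono) auto
    also have "\<dots> = min a (1 - a)" by simp
    finally show ?thesis by auto
  qed
qed

lemma class_distinct:
  assumes "{i, j, p} \<in> prolate \<union> oblate"
  shows "distinct [i, j, p]"
proof -
  have "\<forall>X\<in>prolate \<union> oblate. card X = 3"
    unfolding prolate_def oblate_def by (simp add: neq_6)
  then have "card {i, j, p} = 3" using assms by blast
  then show ?thesis by (auto simp: card_insert_if split: if_splits)
qed

text \<open>The width in direction \<open>v\<^sub>i \<times> v\<^sub>j\<close> distinguishes the two classes.\<close>

lemma same_class:
  assumes "distinct [i, j, k]" "distinct [i, j, p]"
    and eq: "ppd x (icog \<phi> i) (icog \<phi> j) (icog \<phi> k) = ppd y (icog \<phi> i) (icog \<phi> j) (icog \<phi> p)"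
  shows "{i, j, k} \<in> prolate \<longleftrightarrow> {i, j, p} \<in> prolate"
proof -
  have le: "\<bar>nrm \<phi> i j \<bullet> icog \<phi> k\<bar> \<le> \<bar>nrm \<phi> i j \<bullet> icog \<phi> p\<bar>"
    if eq: "ppd x (icog \<phi> i) (icog \<phi> j) (icog \<phi> k) = ppd y (icog \<phi> i) (icog \<phi> j) (icog \<phi> p)"
      and k: "distinct [i, j, k]" for x y k p
  proof -
    have "x \<in> ppd x (icog \<phi> i) (icog \<phi> j) (icog \<phi> k)" "x
        + icog \<phi> k \<in> ppd x (icog \<phi> i) (icog \<phi> j) (icog \<phi> k)"
      by (simp_all add: ppd_iff[OF det_phi_ne[OF k]] lco_all_basis[OF det_phi_ne[OF k]])
    then have "x \<in> ppd y (icog \<phi> i) (icog \<phi> j) (icog \<phi> p)" "x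
        + icog \<phi> k \<in> ppd y (icog \<phi> i) (icog \<phi> j) (icog \<phi> p)"
      unfolding eq .
    then obtain s t u s' t' u' where
      x: "x = y + s *\<^sub>R icog \<phi> i + t *\<^sub>R icog \<phi> j + u *\<^sub>R icog \<phi> p"
         "x + icog \<phi> k = y + s' *\<^sub>R icog \<phi> i + t' *\<^sub>R icog \<phi> j + u' *\<^sub>R icog \<phi> p"
      and u: "u \<in> {0..1}" "u' \<in> {0..1}"
      unfolding ppd_def by blast
    have "nrm \<phi> i j \<bullet> icog \<phi> k = nrm \<phi> i j \<bullet> (x + icog \<phi> k) - nrm \<phi> i j \<bullet> x"
        by (simp add: inner_add_right)
    also have "\<dots> = (u' - u) * (nrm \<phi> i j \<bullet> icog \<phi> p)"
      unfolding x(2) unfolding x(1) by (simp add: inner_add_right algebra_simps)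
    finally have "\<bar>nrm \<phi> i j \<bullet> icog \<phi> k\<bar> = \<bar>u' - u\<bar> * \<bar>nrm \<phi> i j \<bullet> icog \<phi> p\<bar>" by (simp add: abs_mult)
    also have "\<dots> \<le> 1 * \<bar>nrm \<phi> i j \<bullet> icog \<phi> p\<bar>"
      using u by (intro mult_right_mono) auto
    finally show ?thesis by simp
  qed
  have "\<bar>nrm \<phi> i j \<bullet> icog \<phi> k\<bar> = \<bar>nrm \<phi> i j \<bullet> icog \<phi> p\<bar>"
    using le[OF eq assms(1)] le[OF eq[symmetric] assms(2)] by simp
  then show ?thesis
    using det_eq[OF golden_root(1) assms(1)] det_eq[OF golden_root(1) assms(2)]
      orient_eq[OF assms(1)] orient_eq[OF assms(2)] golden_bounds
    by (auto simp: abs_mult split: if_splits)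
qed

context golden
begin

text \<open>The given point is the middle of the upper face, so a face of the tile through it
  contains the whole upper face. With a lower point it would also contain a midpoint interior to the
  tile.\<close>

lemma top_face:
  assumes T: "T i j k b" and S': "S' \<in> \<T>" "S' \<noteq> tile i j k b"
    and m: "b + (1/2) *\<^sub>R icog \<phi> i + (1/2) *\<^sub>R icog \<phi> j + wv \<phi> i j k \<in> S'" (is "?m \<in> S'")
  shows "tile i j k b \<inter> S' =
    {y \<in> tile i j k b. lco (icog \<phi> i) (icog \<phi> j) (wv \<phi> i j k) (y - b) = 1}"
proof -
  let ?p = "icog \<phi> i" and ?q = "icog \<phi> j" and ?r = "wv \<phi> i j k"
  define S where "S = ppd b ?p ?q ?r"
  have S: "S = tile i j k b" "S \<in> \<T>" using T by (auto simp: S_def tile_def T_def)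
  have D: "cross3 ?p ?q \<bullet> ?r \<noteq> 0" using det_phi_pos[of i j k] T by (auto simp: T_def)
  have mc: "lco ?q ?r ?p (?m - b) = 1/2" "lco ?r ?p ?q (?m - b) = 1/2" "lco ?p ?q ?r (?m - b) = 1"
    by (simp_all add: lco_all_basis[OF D])
  have "?m \<in> S" unfolding S_def ppd_iff[OF D] mc by simp
  with m have mR: "?m \<in> S \<inter> S'" by blast
  have ne: "S \<noteq> S'" using S' S by auto
  have F: "S \<inter> S' face_of S" "S \<inter> S' \<noteq> S" using proper_face[OF S(2) S'(1) ne] mR by blast+
  have top: "lco ?p ?q ?r (y - b) = 1" if y: "y \<in> S \<inter> S'" for y
  proof (rule ccontr)
    assume "lco ?p ?q ?r (y - b) \<noteq> 1"
    moreover have yc: "lco ?q ?r ?p (y - b) \<in> {0..1}" "lco ?r ?p ?q (y - b) \<in> {0..1}"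
        "lco ?p ?q ?r (y - b) \<in> {0..1}"
      using y unfolding S_def Int_iff ppd_iff[OF D] by blast+
    ultimately have lt: "lco ?p ?q ?r (y - b) < 1" by (simp del: lco_linear)
    define z where "z = (1/2) *\<^sub>R ?m + (1/2) *\<^sub>R y"
    have z: "z \<in> S \<inter> S'"
      unfolding z_def by (rule convexD[OF face_of_imp_convex[OF F(1)] mR y]) auto
    have zb: "z - b = (1/2) *\<^sub>R (?m - b) + (1/2) *\<^sub>R (y - b)"
      unfolding z_def by (simp add: vec_eq_iff field_simps)
    have zc: "lco ?q ?r ?p (z - b) = 1/4 + 1/2 * lco ?q ?r ?p (y - b)" "lco ?r ?p ?q (z - b) = 1/4
        + 1/2 * lco ?r ?p ?q (y - b)"
      "lco ?p ?q ?r (z - b) = 1/2 + 1/2 * lco ?p ?q ?r (y - b)"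
      unfolding zb lco_linear(1) unfolding lco_linear(4) mc by simp_all
    have "S \<inter> S' = S"
      unfolding S_def
      by (rule face_of_ppd_interior[OF D F(1)[unfolded S_def]
          z[unfolded S_def]]; unfold zc; use yc lt in \<open>simp del: lco_linear\<close>)
    then show False using F(2) by blast
  qed
  have "y \<in> S \<inter> S'" if y: "y \<in> S" "lco ?p ?q ?r (y - b) = 1" for y
    using face_of_ppd_spread[OF D F(1)[unfolded S_def] mR[unfolded S_def] y(1)[unfolded S_def]] mc y(2)
    unfolding S_def[symmetric] by (simp del: lco_linear)
  with top show ?thesis unfolding S(1)[symmetric] by blast
qed

lemma tile_above:
  assumes T: "T i j k b" and T': "T i j k' (b + wv \<phi> i j k)"
  shows "tile i j k b \<inter> tile i j k' (b + wv \<phi> i j k) = (\<lambda>y. b + wv \<phi> i j k + y) ` rhombus i j"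
proof -
  let ?p = "icog \<phi> i" and ?q = "icog \<phi> j" and ?r = "wv \<phi> i j k" and ?r' = "wv \<phi> i j k'"
  let ?S' = "tile i j k' (b + ?r)"
  have D: "0 < cross3 ?p ?q \<bullet> ?r" using det_phi_pos[of i j k] T by (auto simp: T_def)
  have D': "0 < cross3 ?p ?q \<bullet> ?r'" using det_phi_pos[of i j k'] T' by (auto simp: T_def)
  have Dn: "cross3 ?p ?q \<bullet> ?r \<noteq> 0" and Dn': "cross3 ?p ?q \<bullet> ?r' \<noteq> 0" using D D' by simp_all
  have "b + (1/2) *\<^sub>R ?p + (1/2) *\<^sub>R ?q + ?r \<in> ?S'"
    by (simp add: tile_def ppd_iff[OF Dn'] lco_all_basis[OF Dn'])
  \<comment> \<open>The two tiles are different since \<open>b\<close> is strictly below the base of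
    the upper one.\<close>
  moreover have "b \<notin> ?S'"
  proof
    assume "b \<in> ?S'"
    then have "0 \<le> lco ?p ?q ?r' (b - (b + ?r))" unfolding tile_def ppd_iff[OF Dn']
        by (simp del: lco_linear)
    then show False using D D' by (simp add: lco_def zero_le_divide_iff divide_le_0_iff)
  qed
  moreover have "b \<in> tile i j k b" by (simp add: tile_def ppd_iff[OF Dn])
  ultimately have "tile i j k b \<inter> ?S' = {y \<in> tile i j k b. lco ?p ?q ?r (y - b) = 1}"
    using T' by (intro top_face[OF T]) (auto simp: T_def)
  also have "\<dots> = (\<lambda>y. b + ?r + y) ` rhombus i j"
  proof (intro equalityI subsetI)
    fix y assume "y \<in> {y \<in> tile i j k b. lco ?p ?q ?r (y - b) = 1}"
    then have y: "lco ?q ?r ?p (y - b) \<in> {0..1}" "lco ?r ?p ?q (y - b) \<in> {0..1}"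
        "lco ?p ?q ?r (y - b) = 1"
      unfolding tile_def mem_Collect_eq ppd_iff[OF Dn] by blast+
    let ?z = "lco ?q ?r ?p (y - b) *\<^sub>R ?p + lco ?r ?p ?q (y - b) *\<^sub>R ?q"
    have "y - b = ?z + lco ?p ?q ?r (y - b) *\<^sub>R ?r" by (rule lco_expand[OF Dn])
    then have "y - b = ?z + ?r" by (simp only: y(3) scaleR_one)
    then have "y = b + ?r + ?z" by (simp add: algebra_simps del: lco_linear)
    moreover have "?z \<in> rhombus i j" unfolding rhombus_def ico_eq_icog using y(1,2)
        by (auto simp del: lco_linear)
    ultimately show "y \<in> (\<lambda>y. b + ?r + y) ` rhombus i j" by blast
  next
    fix y assume "y \<in> (\<lambda>y. b + ?r + y) ` rhombus i j"
    then obtain s t where "y = b + ?r + (s *\<^sub>R ?p + t *\<^sub>R ?q)" "0 \<le> s" "s \<le> 1" "0 \<le> t" "t \<le> 1"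
      unfolding rhombus_def ico_eq_icog by blast
    then show "y \<in> {y \<in> tile i j k b. lco ?p ?q ?r (y - b) = 1}"
      by (simp add: tile_def ppd_iff[OF Dn] lco_all_basis[OF Dn])
  qed
  finally show ?thesis .
qed

text \<open>The tile across the upper face first turns out to have the edges \<open>i\<close> and
  \<open>j\<close>, then to lie on the upper side, and finally to have its corner exactly at
  \<open>b + wv \<phi> i j k\<close>.\<close>

lemma T_up:
  assumes T: "T i j k b"
  shows "\<exists>k'. T i j k' (b + wv \<phi> i j k)"
proof -
  let ?p = "icog \<phi> i" and ?q = "icog \<phi> j" and ?r = "wv \<phi> i j k"
  let ?m = "b + (1/2) *\<^sub>R ?p + (1/2) *\<^sub>R ?q + ?r"
  define S where "S = tile i j k b"
  have ij: "i \<noteq> j" and ST: "S \<in> \<T>" using T by (auto simp: S_def T_def)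
  have Dpos: "0 < cross3 ?p ?q \<bullet> ?r" using det_phi_pos[of i j k] T by (auto simp: T_def)
  then have D: "cross3 ?p ?q \<bullet> ?r \<noteq> 0" by simp
  have Siff: "y \<in> S \<longleftrightarrow> lco ?q ?r ?p (y - b) \<in> {0..1} \<and> lco ?r ?p ?q (y - b) \<in> {0..1}
      \<and> lco ?p ?q ?r (y - b) \<in> {0..1}" for y
    unfolding S_def tile_def by (rule ppd_iff[OF D])
  have mS: "?m \<in> S" by (simp add: Siff lco_all_basis[OF D])
  have "?m + u *\<^sub>R ?r \<notin> S" if "0 < u" for u
    using that by (simp add: Siff lco_all_basis[OF D])
  then obtain S' where S': "S' \<in> \<T>" "S' \<noteq> S" "?m \<in> S'" using tile_adjacent_point[OF ST mS] by blast
  have R: "S \<inter> S' = {y \<in> S. lco ?p ?q ?r (y - b) = 1}"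
    using top_face[OF T S'(1)] S'(2,3) unfolding S_def by blast
  have mR: "?m \<in> S \<inter> S'" using mS S'(3) by blast
  have F: "S \<inter> S' face_of S'" "S \<inter> S' \<noteq> S'"
    using proper_face(3,4)[OF ST S'(1)] S'(2) mR by blast+
  \<comment> \<open>A coordinate that is 0 or 1 at the middle of the shared face cannot vary along
    \<open>i\<close> or \<open>j\<close>, for it would leave the unit interval on one side.\<close>
  have edge: "cross3 p' q' \<bullet> ?p = 0 \<and> cross3 p' q' \<bullet> ?q = 0"
    if S'eq: "S'
        = ppd x p' q' r'" and D': "cross3 p' q' \<bullet> r' \<noteq> 0" and c: "lco p' q' r' (?m - x) \<in> {0,1}"
        for x p' q' r'
  proof -
    have "cross3 p' q' \<bullet> d = 0" if d: "d = ?p \<or> d = ?q" for d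
    proof -
      have "?m + (1/2) *\<^sub>R d \<in> S \<inter> S'" "?m - (1/2) *\<^sub>R d \<in> S \<inter> S'"
        unfolding R using d by (auto simp: Siff lco_all_basis[OF D])
      then have "lco p' q' r' ((?m + (1/2) *\<^sub>R d) - x) \<in> {0..1}"
          "lco p' q' r' ((?m - (1/2) *\<^sub>R d) - x) \<in> {0..1}"
        unfolding S'eq Int_iff ppd_iff[OF D'] by blast+
      moreover have "lco p' q' r' ((?m + (1/2) *\<^sub>R d) - x) = lco p' q' r' (?m - x) + lco p' q' r' d / 2"
        "lco p' q' r' ((?m - (1/2) *\<^sub>R d) - x) = lco p' q' r' (?m - x) - lco p' q' r' d / 2"
        by simp_all
      ultimately have "lco p' q' r' d = 0" using c by (auto simp del: lco_linear)
      then show ?thesis using D' by (simp add: lco_def)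
    qed
    then show ?thesis by blast
  qed
  have extremal: "lco q' r' p' (?m - x) \<in> {0,1} \<or> lco r' p' q' (?m - x) \<in> {0,1} \<or> lco p' q' r' (?m - x) \<in> {0,1}"
    if S'eq: "S' = ppd x p' q' r'" and D': "cross3 p' q' \<bullet> r' \<noteq> 0" for x p' q' r'
  proof (rule ccontr)
    assume no: "\<not> ?thesis"
    have "lco q' r' p' (?m - x) \<in> {0..1} \<and> lco r' p' q' (?m - x) \<in> {0..1}
        \<and> lco p' q' r' (?m - x) \<in> {0..1}"
      using S'(3) unfolding S'eq ppd_iff[OF D'] .
    with no have "0 < lco q' r' p' (?m - x)" "lco q' r' p' (?m - x) < 1" "0 < lco r' p' q' (?m - x)"
        "lco r' p' q' (?m - x) < 1"
      "0 < lco p' q' r' (?m - x)" "lco p' q' r' (?m - x) < 1"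
          by (auto simp del: lco_linear simp: less_le)
    then have "S \<inter> S' = S'" using face_of_ppd_interior[OF D' F(1)[unfolded S'eq] mR[unfolded S'eq]]
        S'eq by simp
    then show False using F(2) by blast
  qed
  have "\<exists>x l m n. distinct [l, m, n] \<and> S' = ppd x (icog \<phi> l) (icog \<phi> m) (icog \<phi> n) \<and>
      lco (icog \<phi> l) (icog \<phi> m) (icog \<phi> n) (?m - x) \<in> {0,1}"
  proof -
    obtain x l m n where lmn: "distinct [l, m, n]" and S'eq: "S'
        = ppd x (icog \<phi> l) (icog \<phi> m) (icog \<phi> n)"
      using tile_ppd[OF S'(1)] .
    have d: "distinct [m, n, l]" "distinct [n, l, m]" using lmn by auto
    have eq: "S' = ppd x (icog \<phi> m) (icog \<phi> n) (icog \<phi> l)" "S' = ppd x (icog \<phi> n) (icog \<phi> l) (icog \<phi> m)"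
      using S'eq ppd_rotate by metis+
    from extremal[OF S'eq det_phi_ne[OF lmn]] show ?thesis
      using lmn S'eq d eq by blast
  qed
  then obtain x l m n where lmn: "distinct [l, m, n]" and S'eq: "S'
      = ppd x (icog \<phi> l) (icog \<phi> m) (icog \<phi> n)"
    and c: "lco (icog \<phi> l) (icog \<phi> m) (icog \<phi> n) (?m - x) \<in> {0,1}" by blast
  have "i \<in> {l, m}" "j \<in> {l, m}"
    using edge[OF S'eq det_phi_ne[OF lmn] c] det_phi_zero_iff[of l m] lmn by auto
  then have d: "distinct [i, j, n]" and "S' = ppd x ?p ?q (icog \<phi> n)"
    using ij lmn S'eq ppd_swap[of x "icog \<phi> m" "icog \<phi> l"] by auto
  then obtain b' where b': "S' = tile i j n b'" using tile_of_ppd[OF d] by metis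
  let ?r' = "wv \<phi> i j n"
  have Dpos': "0 < cross3 ?p ?q \<bullet> ?r'" using det_phi_pos[OF d] by simp
  then have D': "cross3 ?p ?q \<bullet> ?r' \<noteq> 0" by simp
  have D'r: "cross3 ?q ?r' \<bullet> ?p \<noteq> 0" "cross3 ?r' ?p \<bullet> ?q \<noteq> 0" using D' by (metis dot_cross_rotate)+
  have S'iff: "y \<in> S' \<longleftrightarrow> lco ?q ?r' ?p (y - b') \<in> {0..1} \<and> lco ?r' ?p ?q (y - b') \<in> {0..1}
      \<and> lco ?p ?q ?r' (y - b') \<in> {0..1}" for y
    unfolding b' tile_def by (rule ppd_iff[OF D'])
  have S'p: "S' = ppd b' ?p ?q ?r'" "S' = ppd b' ?q ?r' ?p" "S' = ppd b' ?r' ?p ?q"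
    using b' ppd_rotate unfolding tile_def by metis+
  have A: "lco ?q ?r' ?p (?m - b') \<notin> {0,1}" using edge[OF S'p(2) D'r(1)] D'r(1) by blast
  have B: "lco ?r' ?p ?q (?m - b') \<notin> {0,1}" using edge[OF S'p(3) D'r(2)] D'r(2) by blast
  have C: "lco ?p ?q ?r' (?m - b') \<in> {0,1}" using extremal[OF S'p(1) D'] A B by blast
  have AB: "0 < lco ?q ?r' ?p (?m - b')" "lco ?q ?r' ?p (?m - b') < 1" "0 < lco ?r' ?p ?q (?m - b')"
      "lco ?r' ?p ?q (?m - b') < 1"
    using S'(3)[unfolded S'iff] A B by (auto simp del: lco_linear simp: less_le)
  \<comment> \<open>If the shared face were the upper one of \<open>S'\<close>, a point slightly
    below it would be common to both tiles, although they share only that face.\<close>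
  have C0: "lco ?p ?q ?r' (?m - b') = 0"
  proof (rule ccontr)
    assume "lco ?p ?q ?r' (?m - b') \<noteq> 0"
    then have C1: "lco ?p ?q ?r' (?m - b') = 1" using C by blast
    define \<gamma> where "\<gamma> = lco ?p ?q ?r' ?r"
    have \<gamma>: "0 < \<gamma>" unfolding \<gamma>_def lco_def using Dpos Dpos' by simp
    obtain d1 where d1: "0 < d1" "\<And>\<epsilon>. 0 < \<epsilon> \<Longrightarrow> \<epsilon> \<le> d1 \<Longrightarrow>
        lco ?q ?r' ?p (?m - b') - \<epsilon> * lco ?q ?r' ?p ?r \<in> {0..1}"
      using small_perturbation[OF AB(1,2)] by blast
    obtain d2 where d2: "0 < d2" "\<And>\<epsilon>. 0 < \<epsilon> \<Longrightarrow> \<epsilon> \<le> d2 \<Longrightarrow>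
        lco ?r' ?p ?q (?m - b') - \<epsilon> * lco ?r' ?p ?q ?r \<in> {0..1}"
      using small_perturbation[OF AB(3,4)] by blast
    define e where "e = min (min d1 d2) (min (1/\<gamma>) 1)"
    have e: "0 < e" "e \<le> d1" "e \<le> d2" "e \<le> 1" "e \<le> 1/\<gamma>" using d1 d2 \<gamma> by (auto simp: e_def)
    have e\<gamma>: "1 - e * \<gamma> \<in> {0..1}" using e(1,5) \<gamma> by (simp add: field_simps)
    have split: "?m - e *\<^sub>R ?r - b' = (?m - b') - e *\<^sub>R ?r" by simp
    have "?m - e *\<^sub>R ?r \<in> S'"
      unfolding S'iff split lco_linear(2)[of _ _ _ "?m - b'"] lco_linear(4) C1 \<gamma>_def[symmetric]
      using d1(2)[OF e(1,2)] d2(2)[OF e(1,3)] e\<gamma> by blast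
    moreover have "?m - e *\<^sub>R ?r \<in> S" using e by (simp add: Siff lco_all_basis[OF D])
    ultimately have "lco ?p ?q ?r (?m - e *\<^sub>R ?r - b) = 1" using R by blast
    then show False using e(1) by (simp add: lco_all_basis[OF D])
  qed
  \<comment> \<open>Each of \<open>b'\<close> and \<open>b + ?r\<close> lies in the rhombus that
    starts at the other one, so the coordinates of their difference are nonnegative both ways and
    vanish.\<close>
  have "b' \<in> S'" by (simp add: S'iff)
  then have "b' \<in> S \<inter> S'"
    using face_of_ppd_spread[OF D' F(1)[unfolded S'p(1)] mR[unfolded S'p(1)], of b'] AB C0
        unfolding S'p(1)[symmetric]
    by (simp del: lco_linear add: lco_linear(5))
  then have b'c: "b' \<in> S" "lco ?p ?q ?r (b' - b) = 1" unfolding R by blast+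
  have "b + ?r \<in> S \<inter> S'" unfolding R by (simp add: Siff lco_all_basis[OF D])
  then have brc: "0 \<le> lco ?q ?r' ?p (b + ?r - b')" "0 \<le> lco ?r' ?p ?q (b + ?r - b')"
    unfolding Int_iff S'iff by (auto simp del: lco_linear)
  define s t where "s = lco ?q ?r ?p (b' - b)" and "t = lco ?r ?p ?q (b' - b)"
  have st: "0 \<le> s" "0 \<le> t" using b'c(1) unfolding Siff s_def t_def by (auto simp del: lco_linear)
  have "b' - b = s *\<^sub>R ?p + t *\<^sub>R ?q + lco ?p ?q ?r (b' - b) *\<^sub>R ?r"
    unfolding s_def t_def by (rule lco_expand[OF D])
  then have "b' - b = s *\<^sub>R ?p + t *\<^sub>R ?q + ?r" by (simp only: b'c(2) scaleR_one)
  then have br: "b + ?r - b' = - (s *\<^sub>R ?p + t *\<^sub>R ?q)" by (simp add: algebra_simps)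
  have "s = 0" "t = 0" using brc st unfolding br by (simp_all add: lco_all_basis[OF D'])
  then have "b' = b + ?r" using br by simp
  then show ?thesis using S'(1) b' d by (auto simp: T_def)
qed

end

section \<open>Lifting and planarity\<close>

lemma UNIV_6: "(UNIV :: 6 set) = {1, 2, 3, 4, 5, 6}"
  using exhaust_6 by blast

lemma sum_6: "sum f (UNIV :: 6 set) = f 1 + f 2 + f 3 + f 4 + f 5 + f 6"
  unfolding UNIV_6 by (simp add: neq_6 add.assoc)

text \<open>Infinite descent for the irrationality of the square root of 5.\<close>

lemma square_eq_5_square:
  fixes a b :: nat
  assumes "a * a = 5 * (b * b)"
  shows "b = 0"
  using assms
proof (induction b arbitrary: a rule: less_induct)
  case (less b)
  have "5 dvd a * a" using less.prems by simp
  moreover have "prime (5::nat)" by simp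
  ultimately have "5 dvd a" using prime_dvd_multD by blast
  then obtain c where c: "a = 5 * c" by blast
  with less.prems have eq: "b * b = 5 * (c * c)" by simp
  show ?case
  proof (rule ccontr)
    assume "b \<noteq> 0"
    have "c < b"
    proof (rule ccontr)
      assume "\<not> c < b"
      then have "b * b \<le> c * c" by (intro mult_le_mono) auto
      then show False using eq \<open>b \<noteq> 0\<close> by simp
    qed
    from less.IH[OF this eq] show False using eq \<open>b \<noteq> 0\<close> by simp
  qed
qed

text \<open>From a = -\<phi> b follows (2a + b)^2 = 5 b^2, as (2\<phi> - 1)^2 = 5.\<close>

lemma golden_indep:
  assumes "a \<in> \<int>" "b \<in> \<int>" "a + \<phi> * b = 0"
  shows "a = 0" "b = 0"
proof -
  obtain m n where mn: "a = of_int m" "b = of_int n" using assms by (auto elim!: Ints_cases)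
  have "(2 * a + b) * (2 * a + b) = 5 * (b * b)"
  proof -
    have a: "a = - (\<phi> * b)" using assms(3) by simp
    have "(2 * a + b) * (2 * a + b) = (4 * (\<phi> * \<phi>) - 4 * \<phi> + 1) * (b * b)"
      unfolding a by (simp add: algebra_simps)
    also have "4 * (\<phi> * \<phi>) - 4 * \<phi> + 1 = 5" by (simp add: golden_root(1))
    finally show ?thesis .
  qed
  then have "(of_int ((2 * m + n) * (2 * m + n)) :: real) = of_int (5 * (n * n))" by (simp add: mn)
  then have "(2 * m + n) * (2 * m + n) = 5 * (n * n)" by (simp only: of_int_eq_iff)
  then have "int (nat \<bar>2 * m + n\<bar> * nat \<bar>2 * m + n\<bar>) = int (5 * (nat \<bar>n\<bar> * nat \<bar>n\<bar>))"
    by (simp add: abs_mult_self_eq)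
  then have "nat \<bar>2 * m + n\<bar> * nat \<bar>2 * m + n\<bar> = 5 * (nat \<bar>n\<bar> * nat \<bar>n\<bar>)"
    by (simp only: of_nat_eq_iff)
  then have "nat \<bar>n\<bar> = 0" by (rule square_eq_5_square)
  then have "n = 0" by simp
  then show "b = 0" by (simp add: mn)
  with assms(3) show "a = 0" by simp
qed

section \<open>The physical and the internal projection of six-space\<close>

definition lin :: "real \<Rightarrow> real ^ 6 \<Rightarrow> real ^ 3" where
  "lin g z = (\<Sum>i\<in>UNIV. z $ i *\<^sub>R icog g i)"

lemma linear_lin: "linear (lin g)"
  by (intro linearI) (simp_all add: lin_def scaleR_add_left sum.distrib scaleR_sum_right)

lemmas lin_simps = linear_add[OF linear_lin] linear_diff[OF linear_lin] linear_0[OF linear_lin]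
    linear_cmul[OF linear_lin]

lemma lin_axis [simp]: "lin g (axis i 1) = icog g i"
proof -
  have "lin g (axis i 1) = (\<Sum>j\<in>UNIV. if j = i then icog g j else 0)"
    unfolding lin_def axis_def by (intro sum.cong) auto
  then show ?thesis by simp
qed

lemma lin_phi_inj:
  assumes "\<And>i. z $ i \<in> \<int>" "lin \<phi> z = 0"
  shows "z = 0"
proof -
  have eq: "(z $ 5 - z $ 6) + \<phi> * (z $ 1 + z $ 2) = 0" "(z $ 1 - z $ 2) + \<phi> * (z $ 3 + z $ 4) = 0"
    "(z $ 3 - z $ 4) + \<phi> * (z $ 5 + z $ 6) = 0"
    using assms(2) by (simp_all add: lin_def sum_6 vec_eq_iff forall_3 vector_3 algebra_simps)
  have "z $ 5 - z $ 6 = 0" "z $ 1 + z $ 2 = 0" "z $ 1 - z $ 2 = 0" "z $ 3 + z $ 4 = 0"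
      "z $ 3 - z $ 4 = 0" "z $ 5 + z $ 6 = 0"
    using golden_indep[OF _ _ eq(1)] golden_indep[OF _ _ eq(2)] golden_indep[OF _ _ eq(3)] assms(1)
    by (simp_all add: Ints_add Ints_diff)
  then show ?thesis by (simp add: vec_eq_iff forall_6)
qed

text \<open>The three rows of the matrix are orthogonal with common squared norm 2\<psi>^2 + 2, and
  the kernel is the orthogonal complement of their span.\<close>

lemma dim_kernel_lin: "dim {z. lin \<psi> z = 0} = 3"
proof -
  define row :: "3 \<Rightarrow> real ^ 6" where "row a = (\<chi> i. icog \<psi> i $ a)" for a
  have inner: "row a \<bullet> z = lin \<psi> z $ a" for a z
    by (simp add: row_def inner_vec_def lin_def mult.commute)
  have orth: "row a \<bullet> row b = 0" if "a \<noteq> b" for a b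
    using that exhaust_3[of a] exhaust_3[of b]
    by (elim disjE) (simp_all add: row_def inner_vec_def sum_6 vector_3)
  have pos: "row a \<bullet> row a \<noteq> 0" for a
  proof -
    have "row a \<bullet> row a = 2 * (\<psi> * \<psi>) + 2"
      using exhaust_3[of a] by (elim disjE) (simp_all add: row_def inner_vec_def sum_6 vector_3)
    then show ?thesis by (simp add: golden_root(2)) (use golden_bounds in linarith)
  qed
  have inj: "inj row"
    using orth pos by (intro injI) metis
  have "independent (range row)"
    using orth pos
        by (intro pairwise_orthogonal_independent) (auto simp: pairwise_def orthogonal_def,
        metis inner_zero_left)
  then have "dim (span (range row)) = 3"
    using inj by (simp add: dim_eq_card_independent card_image dim_span)
  moreover have "{z. lin \<psi> z = 0} = {y \<in> UNIV. \<forall>x\<in>span (range row). orthogonal x y}"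
  proof -
    have "lin \<psi> z = 0 \<longleftrightarrow> (\<forall>x\<in>span (range row). orthogonal x z)" for z
    proof -
      have "lin \<psi> z = 0 \<longleftrightarrow> (\<forall>x\<in>range row. orthogonal z x)"
        by (simp add: vec_eq_iff orthogonal_def inner_commute[of z] inner)
      also have "\<dots> \<longleftrightarrow> (\<forall>x\<in>span (range row). orthogonal z x)"
        using orthogonal_to_span span_base by blast
      finally show ?thesis by (simp add: orthogonal_commute)
    qed
    then show ?thesis by auto
  qed
  ultimately show ?thesis
    using dim_subspace_orthogonal_to_vectors[of "span (range row)" UNIV] by simp
qed

text \<open>The conjugate vectors positively span the internal space, so that the image of a cube with the
  corner 0 is a neighbourhood of 0.\<close>

lemma zonotope:
  assumes "norm u \<le> K"
  shows "\<exists>c. c \<in> cbox 0 (\<chi> _. 3 * K) \<and> lin \<psi> c = u"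
proof -
  \<comment> \<open>The centre of the cube is mapped to the vector with all entries
    \<open>3 * K * \<psi>\<close>. The rest \<open>w\<close> is produced by opposite changes in the
    pairs 12, 34, 56, which keep the sums of the pairs. As |\<psi>| < 2/3, a side of
    \<open>3 * K\<close> leaves enough room.\<close>
  define w where "w a = (u $ a - 3 * K * \<psi>)" for a
  define c :: "real ^ 6" where "c = (\<chi> i. (3 * K +
    (if i = 1 then w 2 else if i = 2 then - w 2 else if i = 3 then w 3 else if i = 4 then - w 3
     else if i = 5 then w 1 else - w 1)) / 2)"
  have c: "c $ 1 = (3 * K + w 2) / 2" "c $ 2 = (3 * K - w 2) / 2" "c $ 3 = (3 * K + w 3) / 2"
    "c $ 4 = (3 * K - w 3) / 2" "c $ 5 = (3 * K + w 1) / 2" "c $ 6 = (3 * K - w 1) / 2"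
    by (simp_all add: c_def neq_6 neq_6[symmetric])
  have K: "0 \<le> K" using assms norm_ge_zero order_trans by blast
  have w: "\<bar>w a\<bar> \<le> 3 * K" for a
  proof -
    have "\<bar>u $ a\<bar> \<le> K" using component_le_norm_cart assms order_trans by blast
    moreover have "0 \<le> - \<psi> * (3 * K)" "- \<psi> * (3 * K) \<le> 2/3 * (3 * K)"
      using K golden_bounds by (intro mult_nonneg_nonneg mult_right_mono; simp)+
    ultimately show ?thesis unfolding w_def by (auto simp: algebra_simps)
  qed
  have "c \<in> cbox 0 (\<chi> _. 3 * K)"
    unfolding mem_box_cart forall_6 c using w[of 1] w[of 2] w[of 3] by (auto simp: abs_le_iff)
  moreover have "lin \<psi> c = u"
    by (simp add: lin_def sum_6 vec_eq_iff forall_3 vector_3 c w_def field_simps)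
  ultimately show ?thesis by blast
qed

context golden
begin

text \<open>The given upward sequence is continued downwards to a bi-infinite worm, as the alternation
  condition only speaks about those.\<close>

lemma T_alt:
  assumes T: "\<And>n. T i j (\<kappa> n) (\<beta> n)" and Suc: "\<And>n. \<beta> (Suc n) = \<beta> n + wv \<phi> i j (\<kappa> n)"
    and alt: "has_alternation \<T>" and mn: "m < (n::nat)"
    and cl: "{i, j, \<kappa> m} \<in> prolate \<longleftrightarrow> {i, j, \<kappa> n} \<in> prolate"
    and btw: "\<And>r. m < r \<Longrightarrow> r < n \<Longrightarrow> ({i, j, \<kappa> r} \<in> prolate) \<noteq> ({i, j, \<kappa> m} \<in> prolate)"
  shows "\<kappa> m \<noteq> \<kappa> n"
proof -
  obtain \<kappa>' \<beta>' where down: "\<beta>' 0 = \<beta> 0 + wv \<phi> i j (\<kappa> 0)" "\<kappa>' 0 = \<kappa> 0"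
      "\<And>n. T j i (\<kappa>' n) (\<beta>' n)" "\<And>n. \<beta>' (Suc n) = \<beta>' n + wv \<phi> j i (\<kappa>' n)"
    using ex_walk[of "T j i" "wv \<phi> j i", OF T_up T_flip[OF T[of 0]]] by blast
  \<comment> \<open>The downward walk starts at tile 0 itself, read from above. Its n-th corner is
    the upper one of tile -n, so the lower corner is the next entry, whence the \<open>Suc\<close>
    in \<open>B\<close>.\<close>
  define K where "K n = (if 0 \<le> n then \<kappa> (nat n) else \<kappa>' (nat (- n)))" for n
  define B where "B n = (if 0 \<le> n then \<beta> (nat n) else \<beta>' (Suc (nat (- n))))" for n
  have TZ: "T i j (K n) (B n)" for n
    using T[of "nat n"] T_flip[OF down(3)[of "nat (- n)"]] down(4)[of "nat (- n)"]
        by (simp add: K_def B_def)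
  have BZ: "B (n + 1) = B n + wv \<phi> i j (K n)" for n
  proof (cases "0 \<le> n")
    case True
    then have "nat (n + 1) = Suc (nat n)" by simp
    then show ?thesis using True Suc[of "nat n"] by (simp add: B_def K_def)
  next
    case False
    then have a: "nat (- n) = Suc (nat (- (n + 1)))" by simp
    have B': "B (n + 1) = \<beta>' (nat (- n))"
    proof (cases "n + 1 = 0")
      case True
      then have "n = -1" by simp
      then show ?thesis using down(1,2) down(4)[of 0] by (simp add: B_def wv_swap[of _ j i])
    next
      case False
      then show ?thesis using \<open>\<not> 0 \<le> n\<close> unfolding a by (simp add: B_def)
    qed
    show ?thesis unfolding B' using False down(4)[of "nat (- n)"]
      by (simp add: B_def K_def wv_swap[of _ j i])
  qed
  define w where "w n = tile i j (K n) (B n)" for n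
  have ij: "i \<noteq> j" using T[of 0] by (auto simp: T_def)
  let ?n = "nrm \<phi> i j"
  have dist: "distinct [i, j, K n]" for n using TZ[of n] by (simp add: T_def)
  have Dp: "0 < ?n \<bullet> wv \<phi> i j (K n)" for n
    using det_phi_pos[OF dist, of n] by (simp add: nrm_def)
  \<comment> \<open>The base corners climb strictly along the axis and every tile lies above its
    base corner, which yields injectivity.\<close>
  have mono: "?n \<bullet> B n < ?n \<bullet> B (n + 1 + int d)" for n d
  proof (induction d)
    case 0
    then show ?case using Dp[of n] by (simp add: BZ inner_add_right)
  next
    case (Suc d)
    have "B (n + 1 + int (Suc d)) = B (n + 1 + int d) + wv \<phi> i j (K (n + 1 + int d))"
      using BZ[of "n + 1 + int d"] by (simp add: add.assoc add.commute)
    then show ?case using Suc Dp[of "n + 1 + int d"] by (simp add: inner_add_right)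
  qed
  have neq: "w a \<noteq> w c" if "a < c" for a c
  proof
    assume eq: "w a = w c"
    obtain d where d: "c = a + 1 + int d" using zless_iff_Suc_zadd[of a c] \<open>a < c\<close> by auto
    have Dn: "cross3 (icog \<phi> i) (icog \<phi> j) \<bullet> wv \<phi> i j (K a) \<noteq> 0" for a
      using det_phi_pos[OF dist, of a] by simp
    have "B a \<in> w a" by (simp add: w_def tile_def ppd_iff[OF Dn])
    then have "B a \<in> w c" using eq by simp
    then obtain s t u where "B a = B c + s *\<^sub>R icog \<phi> i + t *\<^sub>R icog \<phi> j + u *\<^sub>R wv \<phi> i j (K c)"
        "u \<in> {0..1}"
      unfolding w_def tile_def ppd_def by blast
    then have "?n \<bullet> B a = ?n \<bullet> B c + u * (?n \<bullet> wv \<phi> i j (K c))" by (simp add: inner_add_right)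
    moreover have "0 \<le> u * (?n \<bullet> wv \<phi> i j (K c))" using \<open>u \<in> {0..1}\<close> Dp[of c] by simp
    ultimately show False using mono[of a d] d by simp
  qed
  have worm: "worm \<T> i j w"
    unfolding worm_def
  proof (intro conjI allI)
    show "i \<noteq> j" by fact
    show "range w \<subseteq> \<T>" using TZ by (auto simp: w_def T_def)
    show "inj w" using neq by (metis injI linorder_neqE)
    show "translate_of (w n \<inter> w (n + 1)) (rhombus i j)" for n
      using tile_above[OF TZ[of n] TZ[of "n + 1", unfolded BZ]] unfolding w_def BZ translate_of_def
          by blast
  qed
  have tr: "\<exists>x. tile i j k b = ppd x (icog \<phi> i) (icog \<phi> j) (icog \<phi> k)" if "distinct [i, j, k]" for k b
    using ppd_of_tile[OF that] by metis
  have trans: "translate_of (w n) (rhombohedron i j (K n))" for n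
    unfolding translate_of_def translate_rhombohedron w_def by (rule tr[OF dist])
  \<comment> \<open>\<open>alternates\<close> speaks about every description of a tile as a
    translate, so each description must give the same class.\<close>
  have cls: "{i, j, p} \<in> prolate \<longleftrightarrow> {i, j, K n} \<in> prolate"
    if p: "translate_of (w n) (rhombohedron i j p)" "distinct [i, j, p]" for n p
  proof -
    obtain x where "w n = ppd x (icog \<phi> i) (icog \<phi> j) (icog \<phi> p)"
      using p(1) unfolding translate_of_def translate_rhombohedron by blast
    moreover obtain y where "w n = ppd y (icog \<phi> i) (icog \<phi> j) (icog \<phi> (K n))"
      using trans[of n] unfolding translate_of_def translate_rhombohedron by blast
    ultimately show ?thesis using same_class[OF p(2) dist[of n]] by metis
  qed
  have Kn: "K (int n) = \<kappa> n" for n by (simp add: K_def)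
  have *: "\<kappa> m \<noteq> \<kappa> n" if C: "alternates C i j w" "C = prolate \<or> C = oblate" "{i, j, \<kappa> m} \<in> C" "{i,
      j, \<kappa> n} \<in> C" for C
  proof -
    have "\<not> (\<exists>p. {i, j, p} \<in> C \<and> translate_of (w r) (rhombohedron i j p))" if r: "int m < r"
        "r < int n" for r
    proof
      assume "\<exists>p. {i, j, p} \<in> C \<and> translate_of (w r) (rhombohedron i j p)"
      then obtain p where p: "{i, j, p} \<in> C" "translate_of (w r) (rhombohedron i j p)" by blast
      have dp: "distinct [i, j, p]" using p(1) C(2) by (intro class_distinct) auto
      define r' where "r' = nat r"
      have r': "r = int r'" "m < r'" "r' < n" using r by (auto simp: r'_def)
      have "{i, j, p} \<in> prolate \<longleftrightarrow> {i, j, \<kappa> r'} \<in> prolate"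
        using cls[OF p(2) dp] by (simp add: r'(1) Kn)
      moreover have "{i, j, p} \<in> prolate \<longleftrightarrow> {i, j, \<kappa> m} \<in> prolate"
        using C(2-3) p(1) oblate_iff[OF dp] oblate_iff[OF dist[of "int m", unfolded Kn]] by blast
      ultimately show False using btw[OF r'(2,3)] by blast
    qed
    then show ?thesis
      using C(1)[unfolded alternates_def, rule_format, of "int m" "int n" "\<kappa> m" "\<kappa> n"] mn C(3,4)
        trans[of "int m", unfolded Kn] trans[of "int n", unfolded Kn] by auto
  qed
  have "alternates prolate i j w \<and> alternates oblate i j w"
    using alt worm unfolding has_alternation_def by blast
  then show ?thesis
    using *[of prolate] *[of oblate] cl oblate_iff[OF dist[of "int m", unfolded Kn]]
        oblate_iff[OF dist[of "int n", unfolded Kn]]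
    by blast
qed

lemma common_vertex:
  assumes "(S, S') \<in> adj"
  obtains v where "v extreme_point_of S" "v extreme_point_of S'"
proof (cases "S = S'")
  case True
  have "S \<in> \<T>" using assms by (auto simp: adj_def)
  then obtain x i j k where *: "distinct [i, j, k]" "S = ppd x (icog \<phi> i) (icog \<phi> j) (icog \<phi> k)"
    by (rule tile_ppd)
  have "x extreme_point_of S"
    unfolding *(2) extreme_point_of_ppd[OF det_phi_ne[OF *(1)]] by (intro bexI[of _ 0]) auto
  with True that show thesis by blast
next
  case False
  have S: "S \<in> \<T>" "S' \<in> \<T>" "S \<inter> S' \<noteq> {}" using assms by (auto simp: adj_def)
  have F: "S \<inter> S' face_of S" "S \<inter> S' face_of S'" using proper_face[OF S(1,2) False S(3)] by auto
  \<comment> \<open>A nonempty compact convex set has an extreme point, and an extreme point of a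
    face is one of the tile.\<close>
  have "compact (S \<inter> S')"
    by (metis S(1,2) tile_ppd compact_ppd compact_Int_closed closed_tile)
  then obtain v where "v extreme_point_of (S \<inter> S')"
    using extreme_point_exists_convex face_of_imp_convex[OF F(1)] S(3) by blast
  then show thesis using that extreme_point_of_face[OF F(1)] extreme_point_of_face[OF F(2)] by blast
qed

text \<open>Serves both the integrality of coordinates and the growth estimate for the lift: a chain
  is followed through common vertices, and \<open>Q 0\<close> handles a single tile.\<close>

lemma chain_vertices:
  fixes Q :: "nat \<Rightarrow> real ^ 3 \<Rightarrow> real ^ 3 \<Rightarrow> bool"
  assumes base: "\<And>S y y'. S \<in> \<T> \<Longrightarrow> y extreme_point_of S \<Longrightarrow> y' extreme_point_of S \<Longrightarrow> Q 0 y y'"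
    and trans: "\<And>n y y' y''. Q n y y' \<Longrightarrow> Q 0 y' y'' \<Longrightarrow> Q (Suc n) y y''"
    and "S \<in> \<T>" "(S, S') \<in> adj ^^ n" "y extreme_point_of S" "y' extreme_point_of S'"
  shows "Q n y y'"
  using assms(4,6)
proof (induction n arbitrary: S' y')
  case 0
  then show ?case using base assms(3,5) by auto
next
  case (Suc n)
  obtain S'' where S'': "(S, S'') \<in> adj ^^ n" "(S'', S') \<in> adj" using Suc.prems(1) by auto
  obtain v where v: "v extreme_point_of S''" "v extreme_point_of S'" using common_vertex[OF S''(2)] .
  have "Q n y v" by (rule Suc.IH[OF S''(1) v(1)])
  moreover have "Q 0 v y'" using base[OF _ v(2) Suc.prems(2)] S''(2) by (auto simp: adj_def)
  ultimately show ?case by (rule trans)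
qed

text \<open>All vertices lie in a translate of the \<open>\<int>\<close>-module generated by the \<open>v\<^sub>i\<close>, which is free of
  rank 6, and taking coordinates there is a lift.\<close>

lemma ex_lifting: "\<exists>h. lifting_map \<T> h"
proof -
  obtain S0 where S0: "S0 \<in> \<T>" using cover by blast
  obtain x0 i0 j0 k0 where *: "distinct [i0, j0, k0]" "S0 = ppd x0 (icog \<phi> i0) (icog \<phi> j0) (icog \<phi> k0)"
    using tile_ppd[OF S0] .
  have x0: "x0 extreme_point_of S0"
    unfolding *(2) extreme_point_of_ppd[OF det_phi_ne[OF *(1)]] by (intro bexI[of _ 0]) auto
  define Q where "Q n y y' \<longleftrightarrow> (\<exists>z. (\<forall>i. z $ i \<in> \<int>) \<and> y' - y = lin \<phi> z)" for n :: nat and y y'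
  have base: "Q 0 y y'" if S: "S \<in> \<T>" "y extreme_point_of S" "y' extreme_point_of S" for S y y'
  proof -
    obtain x i j k where *: "distinct [i, j, k]" "S = ppd x (icog \<phi> i) (icog \<phi> j) (icog \<phi> k)"
      using tile_ppd[OF S(1)] .
    note ext = extreme_point_of_ppd[OF det_phi_ne[OF *(1)], of _ x]
    obtain s t u where stu: "s \<in> {0,1}" "t \<in> {0,1}" "u \<in> {0,1}" "y = x + s *\<^sub>R icog \<phi> i
        + t *\<^sub>R icog \<phi> j + u *\<^sub>R icog \<phi> k"
      using S(2) unfolding *(2) ext by blast
    obtain s' t' u' where stu': "s' \<in> {0,1}" "t' \<in> {0,1}" "u' \<in> {0,1}" "y' = x + s' *\<^sub>R icog \<phi> i
        + t' *\<^sub>R icog \<phi> j + u' *\<^sub>R icog \<phi> k"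
      using S(3) unfolding *(2) ext by blast
    let ?z = "(s' - s) *\<^sub>R axis i 1 + (t' - t) *\<^sub>R axis j 1 + (u' - u) *\<^sub>R axis k (1::real) :: real ^ 6"
    have "s \<in> \<int>" "t \<in> \<int>" "u \<in> \<int>" "s' \<in> \<int>" "t' \<in> \<int>" "u' \<in> \<int>" using stu stu' by auto
    then have "\<forall>l. ?z $ l \<in> \<int>" by (simp add: axis_def)
    moreover have "y' - y = lin \<phi> ?z" unfolding stu(4) stu'(4) lin_simps lin_axis
        by (simp add: algebra_simps)
    ultimately show ?thesis unfolding Q_def by blast
  qed
  have trans: "Q (Suc n) y y''" if Q: "Q n y y'" "Q 0 y' y''" for n y y' y''
  proof -
    obtain z z' where "\<forall>i. z $ i \<in> \<int>" "y' - y = lin \<phi> z" "\<forall>i. z' $ i \<in> \<int>" "y'' - y' = lin \<phi> z'"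
      using Q unfolding Q_def by blast
    then have "\<forall>i. (z + z') $ i \<in> \<int>" "y'' - y = lin \<phi> (z + z')" by (auto simp: lin_simps algebra_simps)
    then show ?thesis unfolding Q_def by blast
  qed
  have all: "\<exists>z. (\<forall>i. z $ i \<in> \<int>) \<and> y - x0 = lin \<phi> z" if yv: "y \<in> tiling_vertices \<T>" for y
  proof -
    obtain S where S: "S \<in> \<T>" "y extreme_point_of S" using yv by (auto simp: tiling_vertices_def)
    have "x0 \<in> S0" "y \<in> S" using x0 S(2) by (auto simp: extreme_point_of_def)
    then obtain n where "(S0, S) \<in> adj ^^ n"
      using tile_chain[of "norm (y - x0)"] S0 S(1) by (metis order_refl)
    from chain_vertices[of Q, OF base trans S0 this x0 S(2)] show ?thesis unfolding Q_def .
  qed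
  \<comment> \<open>By \<open>lin_phi_inj\<close> the chosen coordinates are unique, which makes
    their differences along edges the right ones.\<close>
  define h where "h y = (SOME z. (\<forall>i. z $ i \<in> \<int>) \<and> y - x0 = lin \<phi> z)" for y
  have h: "h y $ i \<in> \<int>" "y - x0 = lin \<phi> (h y)" if "y \<in> tiling_vertices \<T>" for y i
    using someI_ex[OF all[OF that]] unfolding h_def by blast+
  have x0v: "x0 \<in> tiling_vertices \<T>" using S0 x0 by (auto simp: tiling_vertices_def)
  have "h x0 = 0" using h[OF x0v] by (intro lin_phi_inj) auto
  moreover have "h q - h p = axis i 1"
    if "p \<in> tiling_vertices \<T>" "q \<in> tiling_vertices \<T>" "q - p = ico i" for p q i
  proof -
    have "h q - h p - axis i 1 = 0"
    proof (rule lin_phi_inj)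
      show "(h q - h p - axis i 1) $ l \<in> \<int>" for l using h(1)[OF that(1)] h(1)[OF that(2)]
          by (simp add: axis_def)
      have "lin \<phi> (h q) - lin \<phi> (h p) = icog \<phi> i"
        using that(3) h(2)[OF that(1)] h(2)[OF that(2)]
            by (simp add: ico_eq_icog algebra_simps flip: h(2)[OF that(1)])
      then show "lin \<phi> (h q - h p - axis i 1) = 0" by (simp add: lin_simps)
    qed
    then show ?thesis by simp
  qed
  ultimately show ?thesis unfolding lifting_map_def using x0v by blast
qed

lemma lift_step:
  assumes "lifting_map \<T> h" "p \<in> tiling_vertices \<T>" "p + s *\<^sub>R icog \<phi> i \<in> tiling_vertices \<T>" "s \<in> {0,1}"
  shows "h (p + s *\<^sub>R icog \<phi> i) = h p + s *\<^sub>R axis i 1"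
proof (cases "s = 0")
  case False
  then have s: "s = 1" using assms(4) by simp
  have "h (p + icog \<phi> i) - h p = axis i 1"
    using assms(1-3) unfolding lifting_map_def s by (simp add: ico_eq_icog)
  then show ?thesis by (simp add: s algebra_simps)
qed simp

lemma corner_vertex:
  assumes "ppd x (icog \<phi> i) (icog \<phi> j) (icog \<phi> k) \<in> \<T>" "distinct [i, j, k]" "s \<in> {0,1}" "t \<in> {0,1}"
      "u \<in> {0,1}"
  shows "x + s *\<^sub>R icog \<phi> i + t *\<^sub>R icog \<phi> j + u *\<^sub>R icog \<phi> k \<in> tiling_vertices \<T>"
  unfolding tiling_vertices_def mem_Collect_eq
  by (rule bexI[OF _ assms(1)]) (use extreme_point_of_ppd[OF det_phi_ne[OF assms(2)]]
      assms(3-5) in blast)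

lemma lift_corner:
  assumes h: "lifting_map \<T> h" and S: "ppd x (icog \<phi> i) (icog \<phi> j) (icog \<phi> k) \<in> \<T>" "distinct [i, j, k]"
    and stu: "s \<in> {0,1}" "t \<in> {0,1}" "u \<in> {0,1}"
  shows "h (x + s *\<^sub>R icog \<phi> i + t *\<^sub>R icog \<phi> j + u *\<^sub>R icog \<phi> k) =
    h x + s *\<^sub>R axis i 1 + t *\<^sub>R axis j 1 + u *\<^sub>R axis k 1"
proof -
  have z: "(0::real) \<in> {0,1}" by simp
  note v = corner_vertex[OF S]
  have v0: "x \<in> tiling_vertices \<T>" using v[OF z z z] by simp
  have v1: "x + s *\<^sub>R icog \<phi> i \<in> tiling_vertices \<T>" using v[OF stu(1) z z] by simp
  have v2: "x + s *\<^sub>R icog \<phi> i + t *\<^sub>R icog \<phi> j \<in> tiling_vertices \<T>" using v[OF stu(1,2) z] by simp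
  show ?thesis
    using lift_step[OF h v2 v[OF stu] stu(3)] lift_step[OF h v1 v2 stu(2)]
        lift_step[OF h v0 v1 stu(1)] by simp
qed

lemma lift_tile:
  assumes h: "lifting_map \<T> h" and S: "S \<in> \<T>" "y extreme_point_of S" "y' extreme_point_of S"
  shows "norm (lin \<psi> (h y') - lin \<psi> (h y)) \<le> 12"
proof -
  obtain x i j k where *: "distinct [i, j, k]" "S = ppd x (icog \<phi> i) (icog \<phi> j) (icog \<phi> k)"
    using tile_ppd[OF S(1)] .
  have near: "norm (lin \<psi> (h y) - lin \<psi> (h x)) \<le> 2 + 2 + 2" if "y extreme_point_of S" for y
  proof -
    obtain s t u where stu: "s \<in> {0,1}" "t \<in> {0,1}" "u \<in> {0,1}" "y = x + s *\<^sub>R icog \<phi> i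
        + t *\<^sub>R icog \<phi> j + u *\<^sub>R icog \<phi> k"
      using \<open>y extreme_point_of S\<close> unfolding *(2) extreme_point_of_ppd[OF det_phi_ne[OF *(1)]] by blast
    have n: "norm (s *\<^sub>R icog \<psi> i) \<le> 2" if "s \<in> {0,1}" for s i
      using that norm_icog[of \<psi> i] golden_bounds by auto
    have eq: "lin \<psi> (h y) - lin \<psi> (h x) = s *\<^sub>R icog \<psi> i + t *\<^sub>R icog \<psi> j + u *\<^sub>R icog \<psi> k"
      unfolding stu(4) using lift_corner[OF h S(1)[unfolded *(2)] *(1) stu(1-3)] by (simp add: lin_simps)
    show ?thesis unfolding eq by (intro norm_triangle_mono n stu)
  qed
  show ?thesis using norm_diff_mono[OF near[OF S(3)] near[OF S(2)]] by simp
qed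

text \<open>A chain of boundedly many tiles joins the two vertices, and within one tile the internal
  image changes by at most 12.\<close>

lemma lift_lipschitz:
  assumes h: "lifting_map \<T> h"
  shows "\<exists>C. \<forall>S\<in>\<T>. \<forall>S'\<in>\<T>. \<forall>y y'. y extreme_point_of S \<longrightarrow> y' extreme_point_of S' \<longrightarrow> norm (y' - y) \<le> r \<longrightarrow>
    norm (lin \<psi> (h y') - lin \<psi> (h y)) \<le> C"
proof -
  obtain N where N: "\<And>S S' x y. S \<in> \<T> \<Longrightarrow> S' \<in> \<T> \<Longrightarrow> x \<in> S \<Longrightarrow> y \<in> S' \<Longrightarrow> norm (y - x) \<le> r \<Longrightarrow>
      \<exists>n\<le>N. (S, S') \<in> adj ^^ n"
    using tile_chain by blast
  define Q where "Q n y y' \<longleftrightarrow> norm (lin \<psi> (h y') - lin \<psi> (h y)) \<le> 12 * real (Suc n)" for n y y'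
  have base: "Q 0 y y'" if "S \<in> \<T>" "y extreme_point_of S" "y' extreme_point_of S" for S y y'
    using lift_tile[OF h that] by (simp add: Q_def)
  have trans: "Q (Suc n) y y''" if "Q n y y'" "Q 0 y' y''" for n y y' y''
    using norm_triangle_mono[OF that[unfolded Q_def]] by (simp add: Q_def algebra_simps)
  have "norm (lin \<psi> (h y') - lin \<psi> (h y)) \<le> 12 * real (Suc N)"
    if S: "S \<in> \<T>" "S' \<in> \<T>" and y: "y extreme_point_of S" "y' extreme_point_of S'"
        "norm (y' - y) \<le> r" for S S' y y'
  proof -
    obtain n where n: "n \<le> N" "(S, S') \<in> adj ^^ n"
      using N[OF S _ _ y(3)] y by (auto simp: extreme_point_of_def)
    have "Q n y y'" by (rule chain_vertices[of Q, OF base trans S(1) n(2) y(1,2)])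
    then show ?thesis using n(1) unfolding Q_def
        by (meson le_SucI mult_left_mono of_nat_le_iff order_trans Suc_le_mono zero_le_numeral)
  qed
  then show ?thesis by blast
qed

lemma T_vertex:
  assumes "T i j k b"
  shows "tile i j k b \<in> \<T>" "b extreme_point_of tile i j k b"
proof -
  have d: "distinct [i, j, k]" and S: "tile i j k b \<in> \<T>" using assms by (auto simp: T_def)
  have D: "cross3 (icog \<phi> i) (icog \<phi> j) \<bullet> wv \<phi> i j k \<noteq> 0" using det_phi_pos[OF d] by simp
  show "tile i j k b \<in> \<T>" by fact
  show "b extreme_point_of tile i j k b"
    unfolding tile_def extreme_point_of_ppd[OF D] by (intro bexI[of _ 0]) auto
qed

lemma T_step:
  assumes h: "lifting_map \<T> h" and T: "T i j k b"
  shows "lin \<psi> (h (b + wv \<phi> i j k)) = lin \<psi> (h b) + wv \<psi> i j k"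
proof -
  have d: "distinct [i, j, k]" using T by (auto simp: T_def)
  obtain x where x: "tile i j k b = ppd x (icog \<phi> i) (icog \<phi> j) (icog \<phi> k)"
    "x = b \<and> orient i j k = 1 \<or> x = b - icog \<phi> k \<and> orient i j k = - 1"
    using ppd_of_tile[OF d] by metis
  have "h (x + 0 *\<^sub>R icog \<phi> i + 0 *\<^sub>R icog \<phi> j + 1 *\<^sub>R icog \<phi> k) = h x + 0 *\<^sub>R axis i 1
      + 0 *\<^sub>R axis j 1 + 1 *\<^sub>R axis k 1"
    using T x(1) by (intro lift_corner[OF h _ d]) (auto simp: T_def)
  then have "lin \<psi> (h (x + icog \<phi> k)) = lin \<psi> (h x) + icog \<psi> k" by (simp add: lin_simps)
  then show ?thesis using x(2) by (auto simp: wv_def)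
qed

lemma alternation_planar:
  assumes alt: "has_alternation \<T>"
  shows "planar_tiling \<T>"
  unfolding planar_tiling_def
proof (intro conjI allI impI)
  show "\<exists>h. lifting_map \<T> h" by (rule ex_lifting)
  fix h assume h: "lifting_map \<T> h"
  interpret coarse_tiling T "\<lambda>y. lin \<psi> (h y)"
  proof
    show "distinct [i, j, k]" if "T i j k b" for i j k b using that by (simp add: T_def)
    show "\<exists>C. \<forall>i j k b i' j' k' b'. T i j k b \<longrightarrow> T i' j' k' b' \<longrightarrow> norm (b' - b) \<le> r \<longrightarrow>
        norm (lin \<psi> (h b') - lin \<psi> (h b)) \<le> C" for r
    proof -
      obtain C where C: "\<forall>S\<in>\<T>. \<forall>S'\<in>\<T>. \<forall>y y'. y extreme_point_of S \<longrightarrow> y' extreme_point_of S' \<longrightarrow>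
          norm (y' - y) \<le> r \<longrightarrow> norm (lin \<psi> (h y') - lin \<psi> (h y)) \<le> C"
        using lift_lipschitz[OF h, of r] by blast
      have "norm (lin \<psi> (h b') - lin \<psi> (h b)) \<le> C"
        if "T i j k b" "T i' j' k' b'" "norm (b' - b) \<le> r" for i j k b i' j' k' b'
        using C[rule_format, OF T_vertex(1)[OF that(1)] T_vertex(1)[OF that(2)]
            T_vertex(2)[OF that(1)] T_vertex(2)[OF that(2)] that(3)] .
      then show ?thesis by blast
    qed
    show "\<exists>k'. T i j k' (b + wv \<phi> i j k)" if "T i j k b" for i j k b by (rule T_up[OF that])
    show "T j i k (b + wv \<phi> i j k)" if "T i j k b" for i j k b by (rule T_flip[OF that])
    show "\<exists>b'. norm (b' - b) \<le> 8 \<and> T i k j b'" if "T i j k b" for i j k b by (rule T_turn[OF that])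
    show "lin \<psi> (h (b + wv \<phi> i j k)) = lin \<psi> (h b) + wv \<psi> i j k" if "T i j k b" for i j k b
      by (rule T_step[OF h that])
  qed (rule T_alt[OF _ _ alt])
  obtain K where K: "\<And>i j b i' j' b'. St i j b \<Longrightarrow> St i' j' b' \<Longrightarrow> norm (lin \<psi> (h b') - lin \<psi> (h b)) \<le> K"
    using F_bounded by blast
  obtain p0 S0 where p0: "S0 \<in> \<T>" "p0 extreme_point_of S0" "h p0 = 0"
    using h unfolding lifting_map_def tiling_vertices_def by blast
  have bound: "norm (lin \<psi> (h x)) \<le> K + 24" if S: "S \<in> \<T>" "x extreme_point_of S" for S x
  proof -
    obtain b i j k where b: "T i j k b" "S = tile i j k b" using tile_T[OF S(1)] .
    obtain b0 i0 j0 k0 where b0: "T i0 j0 k0 b0" "S0 = tile i0 j0 k0 b0" using tile_T[OF p0(1)] .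
    have "norm (lin \<psi> (h b) - lin \<psi> (h b0)) \<le> K" using b(1) b0(1) by (intro K) (auto simp: St_def)
    moreover have "norm (lin \<psi> (h x) - lin \<psi> (h b)) \<le> 12"
      using lift_tile[OF h S(1) T_vertex(2)[OF b(1), folded b(2)] S(2)] .
    moreover have "norm (lin \<psi> (h b0) - lin \<psi> (h p0)) \<le> 12"
      using lift_tile[OF h p0(1,2) T_vertex(2)[OF b0(1), folded b0(2)]] .
    ultimately have "norm ((lin \<psi> (h x) - lin \<psi> (h b)) + (lin \<psi> (h b) - lin \<psi> (h b0))
        + (lin \<psi> (h b0) - lin \<psi> (h p0))) \<le> 12 + K + 12"
      by (intro norm_triangle_mono)
    then show ?thesis by (simp add: p0(3) lin_simps)
  qed
  \<comment> \<open>The bound 30 is 24 for the vertices plus 6 for the points of a lifted face; the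
    maximum with 1 ensures a thickness of at least 1.\<close>
  define L where "L = max (K + 30) 1"
  show "\<exists>t\<ge>1. \<exists>E :: (real ^ 6) set. subspace E \<and> dim E = 3 \<and>
      lifted_tiling \<T> h \<subseteq> {x + y | x y. x \<in> E \<and> y \<in> cbox 0 (\<chi> _. t)}"
  proof (intro exI conjI)
    have "1 \<le> L" by (simp add: L_def)
    then show "1 \<le> 3 * L" by simp
    show "subspace {z. lin \<psi> z = 0}" by (rule linear_subspace_kernel[OF linear_lin])
    show "dim {z. lin \<psi> z = 0} = 3" by (rule dim_kernel_lin)
    show "lifted_tiling \<T> h \<subseteq> {x + y | x y. x \<in> {z. lin \<psi> z = 0} \<and> y \<in> cbox 0 (\<chi> _. 3 * L)}"
    proof
      fix X assume "X \<in> lifted_tiling \<T> h"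
      then obtain x i j k y where xy: "distinct [i, j, k]" "(\<lambda>y. x + y) ` rhombohedron i j k \<in> \<T>"
          "X = h x + y" "y \<in> cube_face i j k"
        unfolding lifted_tiling_def by blast
      obtain s t u where stu: "y = s *\<^sub>R axis i 1 + t *\<^sub>R axis j 1 + u *\<^sub>R axis k 1"
          "s \<in> {0..1}" "t \<in> {0..1}" "u \<in> {0..1}"
        using xy(4) unfolding cube_face_def by auto
      have n: "norm (s *\<^sub>R icog \<psi> i) \<le> 2" if "s \<in> {0..1}" for s i
      proof -
        have "\<bar>s\<bar> * norm (icog \<psi> i) \<le> 1 * 2"
          using that golden_bounds by (intro mult_mono norm_icog) auto
        then show ?thesis by simp
      qed
      have "lin \<psi> y = s *\<^sub>R icog \<psi> i + t *\<^sub>R icog \<psi> j + u *\<^sub>R icog \<psi> k" by (simp add: stu(1) lin_simps)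
      then have "norm (lin \<psi> y) \<le> 2 + 2 + 2" using stu by (simp only: norm_triangle_mono n)
      moreover have "x extreme_point_of ppd x (icog \<phi> i) (icog \<phi> j) (icog \<phi> k)"
        unfolding extreme_point_of_ppd[OF det_phi_ne[OF xy(1)]] by (intro bexI[of _ 0]) auto
      then have "norm (lin \<psi> (h x)) \<le> K + 24" using bound xy(2) unfolding translate_rhombohedron by blast
      ultimately have "norm (lin \<psi> X) \<le> (K + 24) + (2 + 2 + 2)"
        unfolding xy(3) lin_simps(1) by (rule norm_triangle_mono[rotated])
      then have "norm (lin \<psi> X) \<le> L" by (simp add: L_def)
      \<comment> \<open>A point \<open>c\<close> of the cube with the same internal image as
        \<open>X\<close> leaves \<open>X - c\<close> in the kernel.\<close>
      from zonotope[OF this] obtain c where c: "c \<in> cbox 0 (\<chi> _. 3 * L)" "lin \<psi> c = lin \<psi> X" by blast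
      have "X = (X - c) + c" "lin \<psi> (X - c) = 0" using c(2) by (simp_all add: lin_simps)
      with c(1) show "X \<in> {x + y | x y. x \<in> {z. lin \<psi> z = 0} \<and> y \<in> cbox 0 (\<chi> _. 3 * L)}" by blast
    qed
  qed
qed

end

theorem theorem1:
  fixes \<T> :: "(real ^ 3) set set"
  assumes "golden_tiling \<T>"
    and "has_alternation \<T>"
  shows "planar_tiling \<T>"
proof -
  interpret golden \<T> by unfold_locales (rule assms(1))
  show ?thesis using assms(2) by (rule alternation_planar)
qed

end
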